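(* (Rate with noisy compressed communication.) Consider the TiCoPD recursion defined in the context. Assume: (i) for any fixed $\mathbf X\in\mathbb R^{nd}$ there exist $\delta\in(0,1]$, $r>0$ and $\sigma_\xi\ge0$ such that $Q(\mathbf X;\xi_q)=\widehat Q(\mathbf X;\bar\xi_q)+\mathbf W$, where $\mathbb E[\mathbf W]=0$, $\mathbb E\|\mathbf W\|^2\le\sigma_\xi^2$, and $\mathbb E_{\bar\xi_q}\|\mathbf X-\widehat Q(\mathbf X;\bar\xi_q)/r\|^2\le(1-\delta)^2\|\mathbf X\|^2$; and the communication is noisy, $\sigma_\xi>0$; (ii) each $f_i$ is $L$-smooth, i.e. $\|\nabla f_i(x)-\nabla f_i(y)\|\le L\|x-y\|$ for all $x,y\in\mathbb R^d$, and there is $f^\star>-\infty$ with $f_i(x)\ge f^\star$ for all $x$ and $i$; (iii) for every $i$ and every fixed $y\in\mathbb R^d$ there is $\sigma_i\ge0$ with $\mathbb E\|\nabla f_i(y;\xi_i)-\nabla f_i(y)\|^2\le\sigma_i^2$, and $\xi_1,\dots,\xi_n$ are mutually independent; put $\bar\sigma^2=\frac1n\sum_{i=1}^n\sigma_i^2$; (iv) there are $\rho_{\max}\ge\rho_{\min}>0$ and $\tilde\rho_{\max}\ge\tilde\rho_{\min}>0$ with $\rho_{\min}\mathbf K\preceq\bar{\mathbf A}^\top\mathbf R\bar{\mathbf A}\preceq\rho_{\max}\mathbf K$ and $\tilde\rho_{\min}\mathbf K\preceq\bar{\mathbf A}^\top\bar{\mathbf A}\preceq\tilde\rho_{\max}\mathbf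 K$; (v) $\mathbb E\|\bar{\mathbf A}^\top\bar{\mathbf A}(\xi_a)\mathbf X-\bar{\mathbf A}^\top\mathbf R\bar{\mathbf A}\mathbf X\|^2\le\sigma_A^2\|\bar{\mathbf A}\mathbf X\|_{\mathbf R}^2$ for any fixed $\mathbf X\in\mathbb R^{nd}$. Fix the number of iterations $T\gg1$, let $\mathsf R$ be drawn uniformly and independently from $\{0,1,\dots,T-1\}$, and let the parameters obey the step-size conditions stated in the context, which involve a free quantity $\mathtt a>0$. With noisy gradients ($\bar\sigma>0$), by choosing $\alpha=\mathcal O(T^{-2/3})$, $\theta=\mathcal O(T^{1/3})$, $\mathtt a=\mathcal O(T^{-1/3})$, $\gamma=\mathcal O(T^{-1/3})$, it holds that $$\mathbb E\|\nabla f(\bar{\mathbf x}^{\mathsf R})\|^2=\mathcal O\Big(\frac{1+\sigma_\xi^2}{T^{1/3}}\Big),\qquad\mathbb E\|\mathbf X^{\mathsf R}\|_{\mathbf K}^2=\mathcal O\Big(\frac{1}{T^{1/3}}\Big).$$ With exact gradients ($\bar\sigma=0$), the same choices of $\alpha,\theta,\mathtt a,\gamma$ give the same two bounds.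
   Context: **Graph.** $G=(V,E)$ is an undirected connected graph on $V=\{1,\dots,n\}$ with (signed) incidence matrix $\mathbf A\in\mathbb R^{|E|\times n}$; $\bar{\mathbf A}=\mathbf A\otimes\mathbf I_d$. A random variable $\xi_a$ gives a random diagonal matrix $\mathbf I(\xi_a)\in\{0,1\}^{|E|\times|E|}$ selecting the active edges, and $\mathbf R=\mathbb E[\mathbf I(\xi_a)]\succ c_0\mathbf I$ for some $c_0>0$. Notation: $\bar{\mathbf A}^\top\bar{\mathbf A}(\xi_a)=(\mathbf A^\top\mathbf I(\xi_a)\mathbf A)\otimes\mathbf I_d$, $\bar{\mathbf A}^\top\mathbf R\bar{\mathbf A}=(\mathbf A^\top\mathbf R\mathbf A)\otimes\mathbf I_d$, $\|\bar{\mathbf A}\mathbf X\|_{\mathbf R}^2=\mathbf X^\top\bar{\mathbf A}^\top\mathbf R\bar{\mathbf A}\mathbf X$. **Norms.** For positive semidefinite $\mathbf M$, $\|\mathbf a\|_{\mathbf M}^2=\mathbf a^\top\mathbf M\mathbf a$. $\mathbf K=(\mathbf I_n-\mathbf 1\mathbf 1^\top/n)\otimes\mathbf I_d$. **Objective.** $f_i(x)=\mathbb E_{\xi_i\sim\mathbb P_i}[f_i(x;\xi_i)]$ and $f=\frac1n\sum_{i=1}^n f_i$ on $\mathbb R^d$, each $f_i$ continuously differentiable; $\nabla f_i(x;\xi_i)$ is the stochastic gradient and $\nabla f_i(x)$ the expected gradient. For $\mathbf X=[\mathbf x_1;\dots;\mathbf x_n]\in\mathbb R^{nd}$, $\nabla\mathbf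 f(\mathbf X;\xi)\in\mathbb R^{nd}$ stacks the $\nabla f_i(\mathbf x_i;\xi_i)$. $\bar{\mathbf x}^t=\frac1n\sum_i\mathbf x_i^t$. **TiCoPD.** With step sizes and parameters $\alpha,\theta,\eta,\gamma>0$ and a random map $Q(\cdot;\xi_q)$ on $\mathbb R^{nd}$ (noisy compression operator), for $t\ge0$ a fresh sample $\xi^{t+1}=(\xi_1^{t+1},\dots,\xi_n^{t+1},\xi_a^{t+1})$ and fresh compressor randomness $\xi_q^{t+1}$ are drawn, and $$\mathbf X^{t+1}=\mathbf X^t-\alpha\big(\nabla\mathbf f(\mathbf X^t;\xi^{t+1})+\widetilde{\boldsymbol\lambda}^t+\theta\,\bar{\mathbf A}^\top\bar{\mathbf A}(\xi_a^{t+1})\hat{\mathbf X}^t\big),$$ $$\widetilde{\boldsymbol\lambda}^{t+1}=\widetilde{\boldsymbol\lambda}^t+\eta\,\bar{\mathbf A}^\top\bar{\mathbf A}(\xi_a^{t+1})\hat{\mathbf X}^t,\qquad \hat{\mathbf X}^{t+1}=\hat{\mathbf X}^t+\gamma\,Q(\mathbf X^{t+1}-\hat{\mathbf X}^t;\xi_q^{t+1}).$$ Here $\widetilde{\boldsymbol\lambda}^t=\bar{\mathbf A}^\top\boldsymbol\lambda^t$ for a dual variable $\boldsymbol\lambda^t\in\mathbb R^{|E|d}$. **Step-size conditions.** For a free quantity $\mathtt a>0$ (which may be related to $T$): $\gamma\le\frac1r$, $\eta=\frac{r\gamma\delta}{8\tilde\rho_{\max}}$, $$\theta\ge\frac{4}{\rho_{\min}}\max\Big\{\frac{2L^2}{n\mathtt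 a},\frac{2048\tilde\rho_{\max}}{r\gamma\delta\rho_{\min}},L^2\Big\},$$ $$\alpha\le\frac{r\gamma\delta}{256\,\theta}\min\Big\{\frac{\rho_{\min}^2}{\rho_{\max}^2\tilde\rho_{\max}},\frac{\rho_{\min}^2}{\sigma_A^2\rho_{\max}\tilde\rho_{\max}},\frac{1}{72n\mathtt a\tilde\rho_{\max}},\frac{\rho_{\min}}{2\tilde\rho_{\max}\mathtt a}\Big\}.$$ *)

theory Defs
  imports "HOL-Probability.Probability" "HOL-Library.Landau_Symbols"
begin

section \<open>Gradients\<close>

definition grad :: "('v::real_inner \<Rightarrow> real) \<Rightarrow> 'v \<Rightarrow> 'v" where
  "grad f x = (THE D. GDERIV f x :> D)"

section \<open>Graphs and block matrices\<close>

text \<open>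
  A simple undirected graph on the vertex type \<open>'n\<close> is given together with the orientation that
  fixes the signs of its incidence matrix: every edge occurs in the set as exactly one ordered pair.
\<close>

definition connected_graph :: "('n::finite \<times> 'n) set \<Rightarrow> bool" where
  "connected_graph E \<longleftrightarrow> asym E \<and> (E \<union> E\<inverse>)\<^sup>* = UNIV"

text \<open>
  Edge-indexed vectors and matrices are indexed by all ordered pairs; the rows of the incidence
  matrix at pairs outside \<open>E\<close> are zero padding. (An edge type instead would exclude \<open>n = 1\<close>,
  where \<open>E\<close> is empty.)
\<close>

definition incidence :: "('n::finite \<times> 'n) set \<Rightarrow> real ^ 'n ^ ('n \<times> 'n)" where
  "incidence E = (\<chi> e k. if e \<in> E then of_bool (k = fst e) - of_bool (k = snd e) else 0)"

definition selector :: "'e::finite set \<Rightarrow> real ^ 'e ^ 'e" where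
  "selector S = (\<chi> e e'. of_bool (e = e' \<and> e \<in> S))"

text \<open>\<open>A\<^sup>T D A\<close> for a matrix \<open>D\<close> indexed by edges.\<close>

definition laplacian ::
    "('n::finite \<times> 'n) set \<Rightarrow> real ^ ('n \<times> 'n) ^ ('n \<times> 'n) \<Rightarrow> real ^ 'n ^ 'n" where
  "laplacian E D = transpose (incidence E) ** D ** incidence E"

definition centering :: "real ^ 'n::finite ^ 'n" where
  "centering = mat 1 - (\<chi> i j. 1 / real CARD('n))"

text \<open>
  \<open>\<real>\<^bsup>nd\<^esup>\<close> is \<open>(real ^ 'd) ^ 'n\<close>, whose norm is the Euclidean norm of the stacked vector, and
  \<open>kron_id B\<close> is the action of the Kronecker product of \<open>B\<close> with the identity of size \<open>d\<close>.
\<close>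

definition kron_id :: "real ^ 'm::finite ^ 'k::finite \<Rightarrow> (real ^ 'd::finite) ^ 'm \<Rightarrow> (real ^ 'd) ^ 'k"
  where "kron_id B X = (\<chi> i. \<Sum>j\<in>UNIV. B $ i $ j *\<^sub>R X $ j)"

definition sqnorm :: "real ^ 'm::finite ^ 'm \<Rightarrow> (real ^ 'd::finite) ^ 'm \<Rightarrow> real" where
  "sqnorm B X = X \<bullet> kron_id B X"

definition average :: "(real ^ 'd::finite) ^ 'n::finite \<Rightarrow> real ^ 'd" where
  "average X = (1 / real CARD('n)) *\<^sub>R (\<Sum>i\<in>UNIV. X $ i)"

section \<open>Objective\<close>

definition local_obj ::
    "('n::finite \<Rightarrow> 'b measure) \<Rightarrow> ('n \<Rightarrow> real ^ 'd::finite \<Rightarrow> 'b \<Rightarrow> real) \<Rightarrow> 'n \<Rightarrow> real ^ 'd \<Rightarrow> real" where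
  "local_obj P fs i x = (LINT s|P i. fs i x s)"

definition global_obj ::
    "('n::finite \<Rightarrow> 'b measure) \<Rightarrow> ('n \<Rightarrow> real ^ 'd::finite \<Rightarrow> 'b \<Rightarrow> real) \<Rightarrow> real ^ 'd \<Rightarrow> real" where
  "global_obj P fs x = (1 / real CARD('n)) * (\<Sum>i\<in>UNIV. local_obj P fs i x)"

definition stoch_grad ::
    "('n::finite \<Rightarrow> real ^ 'd::finite \<Rightarrow> 'b \<Rightarrow> real) \<Rightarrow> (real ^ 'd) ^ 'n \<Rightarrow> ('n \<Rightarrow> 'b) \<Rightarrow> (real ^ 'd) ^ 'n" where
  "stoch_grad fs X s = (\<chi> i. grad (\<lambda>y. fs i y (s i)) (X $ i))"

section \<open>Compression\<close>

text \<open>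
  The constants \<open>\<delta>\<close>, \<open>r\<close>, \<open>\<sigma>\<close> do not depend on \<open>X\<close>, since \<open>\<delta>\<close> and \<open>r\<close> enter the step sizes. Both parts
  of the decomposition are functions of the full compressor randomness and may be correlated.
\<close>

definition noisy_compressor ::
    "real \<Rightarrow> real \<Rightarrow> real \<Rightarrow> 'q measure \<Rightarrow> ('v::euclidean_space \<Rightarrow> 'q \<Rightarrow> 'v) \<Rightarrow> bool" where
  "noisy_compressor \<delta> r \<sigma> Mq Q \<longleftrightarrow>
     prob_space Mq \<and>
     (\<lambda>(X, s). Q X s) \<in> borel_measurable (borel \<Otimes>\<^sub>M Mq) \<and>
     (\<exists>Qh W. \<forall>X.
        (\<forall>s\<in>space Mq. Q X s = Qh X s + W X s) \<and>
        Qh X \<in> borel_measurable Mq \<and>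
        has_bochner_integral Mq (W X) 0 \<and>
        integrable Mq (\<lambda>s. (norm (W X s))\<^sup>2) \<and>
        (LINT s|Mq. (norm (W X s))\<^sup>2) \<le> \<sigma>\<^sup>2 \<and>
        integrable Mq (\<lambda>s. (norm (X - Qh X s /\<^sub>R r))\<^sup>2) \<and>
        (LINT s|Mq. (norm (X - Qh X s /\<^sub>R r))\<^sup>2) \<le> (1 - \<delta>)\<^sup>2 * (norm X)\<^sup>2)"

section \<open>The recursion\<close>

text \<open>
  The state is the triple of \<open>X\<^sup>t\<close>, the transformed dual variable and \<open>X\<close>-hat. The samples with
  index \<open>t\<close> are those drawn in the step from \<open>t\<close> to \<open>t + 1\<close>.
\<close>

primrec ticopd ::
    "('n::finite \<Rightarrow> real ^ 'd::finite \<Rightarrow> 'b \<Rightarrow> real) \<Rightarrow> ('n \<times> 'n) set \<Rightarrow> ('c \<Rightarrow> ('n \<times> 'n) set) \<Rightarrow>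
     ((real ^ 'd) ^ 'n \<Rightarrow> 'q \<Rightarrow> (real ^ 'd) ^ 'n) \<Rightarrow> real \<Rightarrow> real \<Rightarrow> real \<Rightarrow> real \<Rightarrow>
     (real ^ 'd) ^ 'n \<Rightarrow> (real ^ 'd) ^ ('n \<times> 'n) \<Rightarrow> (real ^ 'd) ^ 'n \<Rightarrow>
     (nat \<Rightarrow> 'n \<Rightarrow> 'b) \<Rightarrow> (nat \<Rightarrow> 'c) \<Rightarrow> (nat \<Rightarrow> 'q) \<Rightarrow> nat \<Rightarrow>
     ((real ^ 'd) ^ 'n) \<times> ((real ^ 'd) ^ 'n) \<times> ((real ^ 'd) ^ 'n)" where
  "ticopd fs E act Q \<alpha> \<theta> \<eta> \<gamma> X0 dual0 Xh0 xi xa xq 0 =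
     (X0, kron_id (transpose (incidence E)) dual0, Xh0)"
| "ticopd fs E act Q \<alpha> \<theta> \<eta> \<gamma> X0 dual0 Xh0 xi xa xq (Suc t) =
     (case ticopd fs E act Q \<alpha> \<theta> \<eta> \<gamma> X0 dual0 Xh0 xi xa xq t of (X, lt, Xh) \<Rightarrow>
        let D = kron_id (laplacian E (selector (act (xa t)))) Xh;
            X' = X - \<alpha> *\<^sub>R (stoch_grad fs X (xi t) + lt + \<theta> *\<^sub>R D)
        in (X', lt + \<eta> *\<^sub>R D, Xh + \<gamma> *\<^sub>R Q (X' - Xh) (xq t)))"

section \<open>Samples\<close>

text \<open>The library's \<open>indep_var\<close> for random variables with values in different types.\<close>

definition indep_rvs ::
    "'w measure \<Rightarrow> 'x measure \<Rightarrow> ('w \<Rightarrow> 'x) \<Rightarrow> 'y measure \<Rightarrow> ('w \<Rightarrow> 'y) \<Rightarrow> bool" where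
  "indep_rvs M N X K Y \<longleftrightarrow>
     X \<in> M \<rightarrow>\<^sub>M N \<and> Y \<in> M \<rightarrow>\<^sub>M K \<and>
     prob_space.indep_set M {X -` A \<inter> space M | A. A \<in> sets N} {Y -` B \<inter> space M | B. B \<in> sets K}"

text \<open>
  The bundles of all samples of one step are independent over the steps, and within a step the
  compressor randomness is independent of the gradient and edge samples. Nothing is assumed on
  the dependence between the gradient samples and the edge sample of the same step.
\<close>

definition fresh_samples ::
    "'w measure \<Rightarrow> ('n::finite \<Rightarrow> 'b measure) \<Rightarrow> 'c measure \<Rightarrow> 'q measure \<Rightarrow>
     (nat \<Rightarrow> 'n \<Rightarrow> 'w \<Rightarrow> 'b) \<Rightarrow> (nat \<Rightarrow> 'w \<Rightarrow> 'c) \<Rightarrow> (nat \<Rightarrow> 'w \<Rightarrow> 'q) \<Rightarrow> bool" where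
  "fresh_samples M P Pa Mq xi xa xq \<longleftrightarrow>
     prob_space M \<and>
     (\<forall>t. prob_space.indep_vars M P (xi t) UNIV) \<and>
     (\<forall>t i. distr M (P i) (xi t i) = P i) \<and>
     (\<forall>t. xa t \<in> M \<rightarrow>\<^sub>M Pa \<and> distr M Pa (xa t) = Pa) \<and>
     (\<forall>t. xq t \<in> M \<rightarrow>\<^sub>M Mq \<and> distr M Mq (xq t) = Mq) \<and>
     (\<forall>t. indep_rvs M (PiM UNIV P \<Otimes>\<^sub>M Pa) (\<lambda>w. (\<lambda>i. xi t i w, xa t w)) Mq (xq t)) \<and>
     prob_space.indep_vars M (\<lambda>_. (PiM UNIV P \<Otimes>\<^sub>M Pa) \<Otimes>\<^sub>M Mq)
       (\<lambda>t w. ((\<lambda>i. xi t i w, xa t w), xq t w)) UNIV"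

definition uniform_index ::
    "'w measure \<Rightarrow> ('n::finite \<Rightarrow> 'b measure) \<Rightarrow> 'c measure \<Rightarrow> 'q measure \<Rightarrow>
     (nat \<Rightarrow> 'n \<Rightarrow> 'w \<Rightarrow> 'b) \<Rightarrow> (nat \<Rightarrow> 'w \<Rightarrow> 'c) \<Rightarrow> (nat \<Rightarrow> 'w \<Rightarrow> 'q) \<Rightarrow>
     nat \<Rightarrow> ('w \<Rightarrow> nat) \<Rightarrow> bool" where
  "uniform_index M P Pa Mq xi xa xq T R \<longleftrightarrow>
     distr M (count_space UNIV) R = measure_pmf (pmf_of_set {..<T}) \<and>
     indep_rvs M (count_space UNIV) R
       (PiM UNIV (\<lambda>_::nat. (PiM UNIV P \<Otimes>\<^sub>M Pa) \<Otimes>\<^sub>M Mq))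
       (\<lambda>w t. ((\<lambda>i. xi t i w, xa t w), xq t w))"

section \<open>Step sizes\<close>

text \<open>
  The second term of the minimum has \<open>\<sigma>A\<^sup>2\<close> in a denominator; for \<open>\<sigma>A = 0\<close> it is infinite and the
  bound is void, whereas division by zero in HOL would give \<open>0\<close>.
\<close>

definition step_sizes ::
    "nat \<Rightarrow> real \<Rightarrow> real \<Rightarrow> real \<Rightarrow> real \<Rightarrow> real \<Rightarrow> real \<Rightarrow> real \<Rightarrow>
     real \<Rightarrow> real \<Rightarrow> real \<Rightarrow> real \<Rightarrow> real \<Rightarrow> bool" where
  "step_sizes n L \<rho>min \<rho>max \<rho>tmax \<sigma>A \<delta> r a \<alpha> \<theta> \<eta> \<gamma> \<longleftrightarrow>
     0 < a \<and> 0 < \<alpha> \<and> 0 < \<theta> \<and> 0 < \<eta> \<and> 0 < \<gamma> \<and>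
     \<gamma> \<le> 1 / r \<and>
     \<eta> = r * \<gamma> * \<delta> / (8 * \<rho>tmax) \<and>
     \<theta> \<ge> 4 / \<rho>min * Max {2 * L\<^sup>2 / (real n * a), 2048 * \<rho>tmax / (r * \<gamma> * \<delta> * \<rho>min), L\<^sup>2} \<and>
     \<alpha> \<le> r * \<gamma> * \<delta> / (256 * \<theta>) *
       Min {\<rho>min\<^sup>2 / (\<rho>max\<^sup>2 * \<rho>tmax), 1 / (72 * real n * a * \<rho>tmax), \<rho>min / (2 * \<rho>tmax * a)} \<and>
     (\<sigma>A \<noteq> 0 \<longrightarrow> \<alpha> \<le> r * \<gamma> * \<delta> / (256 * \<theta>) * (\<rho>min\<^sup>2 / (\<sigma>A\<^sup>2 * \<rho>max * \<rho>tmax)))"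

text \<open>Parameter choices as functions of the number of iterations, of the exact orders stated.\<close>

definition rate_choice ::
    "nat \<Rightarrow> real \<Rightarrow> real \<Rightarrow> real \<Rightarrow> real \<Rightarrow> real \<Rightarrow> real \<Rightarrow> real \<Rightarrow>
     (nat \<Rightarrow> real) \<Rightarrow> (nat \<Rightarrow> real) \<Rightarrow> (nat \<Rightarrow> real) \<Rightarrow> (nat \<Rightarrow> real) \<Rightarrow> (nat \<Rightarrow> real) \<Rightarrow> bool" where
  "rate_choice n L \<rho>min \<rho>max \<rho>tmax \<sigma>A \<delta> r a \<alpha> \<theta> \<eta> \<gamma> \<longleftrightarrow>
     \<alpha> \<in> \<Theta>(\<lambda>T. real T powr (- 2 / 3)) \<and>
     \<theta> \<in> \<Theta>(\<lambda>T. real T powr (1 / 3)) \<and>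
     a \<in> \<Theta>(\<lambda>T. real T powr (- 1 / 3)) \<and>
     \<gamma> \<in> \<Theta>(\<lambda>T. real T powr (- 1 / 3)) \<and>
     (\<forall>\<^sub>F T in sequentially. step_sizes n L \<rho>min \<rho>max \<rho>tmax \<sigma>A \<delta> r (a T) (\<alpha> T) (\<theta> T) (\<eta> T) (\<gamma> T))"

end

theory Submission
  imports Defs
begin

text \<open>
  The proof is a Lyapunov argument. Write \<open>\<tau> = \<alpha> \<theta>\<close>, \<open>q = r \<gamma> \<delta>\<close> and \<open>\<epsilon> = T\<^bsup>-1/3\<^esup>\<close>, so that \<open>\<tau>\<close>,
  \<open>q\<close>, \<open>\<gamma>\<close> and \<open>\<eta>\<close> are of order \<open>\<epsilon>\<close>, \<open>\<alpha>\<close> is of order \<open>\<epsilon>\<^sup>2\<close> and \<open>\<theta>\<close> of order \<open>1 / \<epsilon>\<close>. Four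
  quantities are tracked: the objective gap at the average, the consensus error \<open>|K X|\<^sup>2\<close>, the
  compression error \<open>|X - Xhat|\<^sup>2\<close>, and \<open>|\<nu>|\<^sup>2\<close> for the vector
  \<open>\<nu> = lambda + c K X + K h\<close> with \<open>c = \<eta> / \<tau>\<close> and \<open>h\<close> the local gradients at the average.

  The compression error is contracted at rate \<open>q\<close> and fed by channel noise of size
  \<open>\<gamma>\<^sup>2 \<sigma>\<xi>\<^sup>2\<close>; hence it settles at order \<open>\<epsilon> \<sigma>\<xi>\<^sup>2\<close>. The consensus error is contracted at rate \<open>\<tau>\<close>
  and follows the compression error. The vector \<open>\<nu>\<close> measures how far the dual variable is from
  cancelling the heterogeneity of the local gradients. With this value of \<open>c\<close> the random
  Laplacian drops out of \<open>lambda + c K X\<close>, so \<open>\<nu>\<close> obeys a contraction of rate \<open>\<eta> / \<theta>\<close>, of order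
  \<open>\<epsilon>\<^sup>2\<close>, with forcing of the same order (lemma \<open>hetero_step\<close>); it stays of the order of
  the gradient terms, and it enters the consensus error only with the factor \<open>\<alpha>\<^sup>2 / \<tau>\<^sup>2 = 1 / \<theta>\<^sup>2\<close>, of order \<open>\<epsilon>\<^sup>2\<close>. The objective decreases
  by \<open>\<alpha> |grad f|\<^sup>2\<close> up to \<open>\<alpha>\<close> times the consensus error.

  A weighted sum \<open>V\<close> of the four quantities therefore satisfies
  \<open>E V' + \<alpha> (|grad f|\<^sup>2 / 8 + |K X|\<^sup>2) \<le> V + noise\<close> for a fixed state (lemmas \<open>drift_combined\<close> and
  \<open>one_step_drift\<close>). Independence of the samples over the steps lets this inequality be
  integrated over the current state and summed over the steps (\<open>process_drift\<close>,
  \<open>telescoped_drift\<close>); all of this takes place among nonnegative integrals, so integrability of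
  the iterates is a consequence and not a prerequisite. Dividing by \<open>\<alpha> T\<close>, of order \<open>1 / \<epsilon>\<close>, leaves
  \<open>O(\<epsilon>)\<close> from the initial state, \<open>O(\<epsilon>)\<close> from the gradient noise and \<open>O(\<epsilon> \<sigma>\<xi>\<^sup>2)\<close> from the
  channel (\<open>bias_bound\<close>).
\<close>

section \<open>Gradients of smooth functions\<close>

lemma gderiv_unique:
  assumes "GDERIV f x :> D" "GDERIV f x :> D'"
  shows "D = D'"
proof -
  have "(\<lambda>h. h \<bullet> D) = (\<lambda>h. h \<bullet> D')"
    using assms unfolding gderiv_def by (rule has_derivative_unique)
  then have "\<And>h. h \<bullet> (D - D') = 0"
    by (simp add: fun_eq_iff inner_diff_right)
  from this[of "D - D'"] show ?thesis by simp
qed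

lemma grad_eqI: "GDERIV f x :> D \<Longrightarrow> grad f x = D"
  unfolding grad_def by (rule the_equality) (auto intro: gderiv_unique)

lemma gderiv_grad:
  fixes f :: "'v::euclidean_space \<Rightarrow> real"
  assumes "f differentiable (at x)"
  shows "GDERIV f x :> grad f x"
proof -
  obtain f' where f': "(f has_derivative f') (at x)"
    using assms by (auto simp: differentiable_def)
  interpret bounded_linear f' using f' by (rule has_derivative_bounded_linear)
  have "f' = (\<lambda>h. h \<bullet> (\<Sum>b\<in>Basis. f' b *\<^sub>R b))"
  proof
    fix h
    have "f' h = f' (\<Sum>b\<in>Basis. (h \<bullet> b) *\<^sub>R b)"
      by (simp add: euclidean_representation)
    also have "\<dots> = (\<Sum>b\<in>Basis. (h \<bullet> b) * f' b)"
      by (simp add: sum scale)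
    finally show "f' h = h \<bullet> (\<Sum>b\<in>Basis. f' b *\<^sub>R b)"
      by (simp add: inner_sum_right mult.commute)
  qed
  then have "GDERIV f x :> (\<Sum>b\<in>Basis. f' b *\<^sub>R b)"
    using f' by (simp add: gderiv_def)
  then show ?thesis by (simp add: grad_eqI)
qed

lemma gderiv_sum:
  assumes "\<And>i. i \<in> I \<Longrightarrow> GDERIV (f i) x :> D i"
  shows "GDERIV (\<lambda>x. \<Sum>i\<in>I. f i x) x :> (\<Sum>i\<in>I. D i)"
  using assms unfolding gderiv_def inner_sum_right by (rule has_derivative_sum)

lemma grad_global_obj:
  fixes fs :: "'n::finite \<Rightarrow> real ^ 'd::finite \<Rightarrow> 'b \<Rightarrow> real"
  assumes "\<And>i. local_obj P fs i differentiable (at x)"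
  shows "GDERIV (global_obj P fs) x :>
    (1 / real CARD('n)) *\<^sub>R (\<Sum>i\<in>UNIV. grad (local_obj P fs i) x)"
proof -
  have "GDERIV (\<lambda>x. \<Sum>i\<in>UNIV. local_obj P fs i x) x :> (\<Sum>i\<in>UNIV. grad (local_obj P fs i) x)"
    by (intro gderiv_sum gderiv_grad assms)
  then show ?thesis
    unfolding gderiv_def global_obj_def[abs_def] inner_scaleR_right
    by (rule has_derivative_mult_right)
qed

text \<open>
  Along the segment from \<open>x\<close> to \<open>y\<close> the difference between \<open>f\<close> and the quadratic model is
  nonincreasing, because the Lipschitz bound controls the change of the directional derivative.
\<close>

lemma descent_lemma:
  fixes f :: "'v::real_inner \<Rightarrow> real"
  assumes der: "\<And>x. GDERIV f x :> g x"
    and lip: "\<And>x y. norm (g x - g y) \<le> L * norm (x - y)"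
  shows "f y \<le> f x + g x \<bullet> (y - x) + L / 2 * (norm (y - x))\<^sup>2"
proof -
  define d where "d = y - x"
  define \<psi> where "\<psi> t = f (x + t *\<^sub>R d) - t * (g x \<bullet> d) - L / 2 * (norm d)\<^sup>2 * t\<^sup>2" for t
  define \<psi>' where "\<psi>' t = g (x + t *\<^sub>R d) \<bullet> d - g x \<bullet> d - L * (norm d)\<^sup>2 * t" for t
  have fd: "((\<lambda>t. f (x + t *\<^sub>R d)) has_real_derivative (g (x + t *\<^sub>R d) \<bullet> d)) (at t)" for t
  proof -
    have 1: "((\<lambda>t. x + t *\<^sub>R d) has_derivative (\<lambda>s. s *\<^sub>R d)) (at t)"
      by (auto intro!: derivative_eq_intros)
    have 2: "(f has_derivative (\<lambda>h. h \<bullet> g (x + t *\<^sub>R d))) (at (x + t *\<^sub>R d))"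
      using der unfolding gderiv_def .
    have "((\<lambda>t. f (x + t *\<^sub>R d)) has_derivative (\<lambda>s. (s *\<^sub>R d) \<bullet> g (x + t *\<^sub>R d))) (at t)"
      using has_derivative_compose[OF 1 2] .
    then show ?thesis
      unfolding has_field_derivative_def
      by (rule has_derivative_eq_rhs) (auto simp: fun_eq_iff inner_commute)
  qed
  have "\<psi> 1 \<le> \<psi> 0"
  proof (rule DERIV_nonpos_imp_nonincreasing[where f = \<psi>])
    fix t :: real assume t: "0 \<le> t" "t \<le> 1"
    have "(g (x + t *\<^sub>R d) - g x) \<bullet> d \<le> norm (g (x + t *\<^sub>R d) - g x) * norm d"
      by (rule norm_cauchy_schwarz)
    also have "\<dots> \<le> (L * norm (x + t *\<^sub>R d - x)) * norm d"
      by (intro mult_right_mono lip) simp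
    also have "\<dots> = L * (norm d)\<^sup>2 * t"
      using t by (simp add: power2_eq_square)
    finally have "\<psi>' t \<le> 0"
      by (simp add: \<psi>'_def inner_diff_left)
    moreover have "(\<psi> has_real_derivative \<psi>' t) (at t)"
      unfolding \<psi>_def[abs_def] \<psi>'_def
      by (auto intro!: derivative_eq_intros fd)
    ultimately show "\<exists>D. (\<psi> has_real_derivative D) (at t) \<and> D \<le> 0" by blast
  qed simp
  then show ?thesis
    by (simp add: \<psi>_def d_def)
qed

section \<open>Consensus and edge differences\<close>

definition stack :: "'a \<Rightarrow> 'a ^ 'n::finite" where
  "stack v = (\<chi> i. v)"

definition centered :: "(real ^ 'd::finite) ^ 'n::finite \<Rightarrow> (real ^ 'd) ^ 'n" where
  "centered X = X - stack (average X)"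

lemma stack_nth [simp]: "stack v $ i = v"
  by (simp add: stack_def)

lemma average_linear:
  "average (X + Y) = average X + average Y"
  "average (X - Y) = average X - average Y"
  "average (c *\<^sub>R X) = c *\<^sub>R average X"
  "average (- X) = - average X"
  by (simp_all add: average_def sum.distrib sum_subtractf scaleR_sum_right sum_negf algebra_simps)

lemma average_stack [simp]: "average (stack v :: (real ^ 'd::finite) ^ 'n::finite) = v"
  by (simp add: average_def sum_constant_scaleR del: sum_constant)

lemma stack_linear:
  fixes u v :: "real ^ 'd::finite"
  shows "stack (u + v) = stack u + stack v" "stack (u - v) = stack u - stack v"
    "stack (c *\<^sub>R u) = c *\<^sub>R stack u" "stack (- u) = - stack u" "stack (0 :: real ^ 'd) = 0"
  by (simp_all add: stack_def vec_eq_iff)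

lemma centered_linear:
  "centered (X + Y) = centered X + centered Y"
  "centered (X - Y) = centered X - centered Y"
  "centered (c *\<^sub>R X) = c *\<^sub>R centered X"
  by (simp_all add: centered_def average_linear stack_linear algebra_simps)

lemma average_centered [simp]: "average (centered X) = 0"
  by (simp add: centered_def average_linear)

lemma centered_eq: "average X = 0 \<Longrightarrow> centered X = X"
  by (simp add: centered_def stack_linear)

lemma inner_stack: "X \<bullet> stack v = real CARD('n) * (average X \<bullet> v)"
  for X :: "(real ^ 'd::finite) ^ 'n::finite"
  by (simp add: inner_vec_def[of X] average_def inner_sum_left)

lemma norm_stack: "(norm (stack v :: (real ^ 'd::finite) ^ 'n::finite))\<^sup>2 = real CARD('n) * (norm v)\<^sup>2"
  by (simp add: power2_norm_eq_inner inner_stack)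

lemma norm_decomposition:
  "(norm X)\<^sup>2 = (norm (centered X))\<^sup>2 + real CARD('n) * (norm (average X))\<^sup>2"
  for X :: "(real ^ 'd::finite) ^ 'n::finite"
proof -
  have "centered X \<bullet> stack (average X) = 0"
    by (simp add: inner_stack)
  moreover have "X = centered X + stack (average X)"
    by (simp add: centered_def)
  ultimately have "(norm X)\<^sup>2 = (norm (centered X))\<^sup>2 + (norm (stack (average X) :: (real ^ 'd) ^ 'n))\<^sup>2"
    by (metis dot_norm add.right_neutral mult_zero_right norm_add_Pythagorean orthogonal_def)
  then show ?thesis by (simp add: norm_stack)
qed

lemma norm_centered_le: "(norm (centered X))\<^sup>2 \<le> (norm X)\<^sup>2"
  by (simp add: norm_decomposition[of X])

lemma norm_average_le: "(norm (average X))\<^sup>2 \<le> (norm X)\<^sup>2 / real CARD('n)"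
  for X :: "(real ^ 'd::finite) ^ 'n::finite"
  using norm_decomposition[of X] by (simp add: field_simps)

lemma kron_id_centering: "kron_id centering X = centered X"
  for X :: "(real ^ 'd::finite) ^ 'n::finite"
proof -
  have "(\<Sum>j\<in>UNIV. ((if i = j then 1 else 0) - 1 / real CARD('n)) * X $ j $ k) =
    X $ i $ k - (\<Sum>j\<in>UNIV. X $ j $ k / real CARD('n))" for i k
  proof -
    have "(\<Sum>j\<in>UNIV. (if i = j then 1 else 0) * X $ j $ k) = X $ i $ k"
      by (subst sum.cong[OF refl, where h = "\<lambda>j. if i = j then X $ j $ k else 0"]) auto
    then show ?thesis
      by (simp add: left_diff_distrib sum_subtractf)
  qed
  then show ?thesis
    by (simp add: vec_eq_iff kron_id_def centering_def centered_def mat_def average_def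
        sum_distrib_left)
qed

lemma sqnorm_centering: "sqnorm centering X = (norm (centered X))\<^sup>2"
  for X :: "(real ^ 'd::finite) ^ 'n::finite"
proof -
  have "X \<bullet> centered X = (centered X + stack (average X)) \<bullet> centered X"
    by (simp add: centered_def)
  also have "\<dots> = (norm (centered X))\<^sup>2"
    by (simp add: inner_add_left inner_commute[of "stack _"] inner_stack power2_norm_eq_inner)
  finally show ?thesis by (simp add: sqnorm_def kron_id_centering)
qed

definition edge_diff :: "(real ^ 'd::finite) ^ 'n::finite \<Rightarrow> 'n \<times> 'n \<Rightarrow> real ^ 'd" where
  "edge_diff X e = X $ fst e - X $ snd e"

lemma kron_id_incidence:
  "kron_id (incidence E) X $ e = (if e \<in> E then edge_diff X e else 0)"
  by (simp add: kron_id_def incidence_def edge_diff_def scaleR_diff_left sum_subtractf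
      of_bool_def if_distrib[of "\<lambda>c. c *\<^sub>R _"] cong: if_cong)

lemma kron_id_mult: "kron_id (A ** B) X = kron_id A (kron_id B X)"
  by (simp add: kron_id_def matrix_matrix_mult_def vec_eq_iff sum_distrib_right sum_distrib_left
      scaleR_sum_left scaleR_sum_right mult.assoc) (auto intro: sum.swap)

lemma inner_kron_id_transpose: "Y \<bullet> kron_id (transpose B) U = kron_id B Y \<bullet> U"
  for B :: "real ^ 'm::finite ^ 'k::finite" and U :: "(real ^ 'd::finite) ^ 'k"
  by (simp add: kron_id_def transpose_def inner_vec_def[of Y] inner_vec_def[of _ U]
      inner_sum_left inner_sum_right) (rule sum.swap)

lemma inner_laplacian:
  "Y \<bullet> kron_id (laplacian E D) X = kron_id (incidence E) Y \<bullet> kron_id D (kron_id (incidence E) X)"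
  by (simp add: laplacian_def kron_id_mult inner_kron_id_transpose)

lemma kron_id_selector: "kron_id (selector S) U $ e = (if e \<in> S then U $ e else 0)"
  by (auto simp: kron_id_def selector_def of_bool_def if_distrib[of "\<lambda>c. c *\<^sub>R _"] cong: if_cong)

lemma inner_laplacian_selector:
  assumes "S \<subseteq> E"
  shows "Y \<bullet> kron_id (laplacian E (selector S)) X = (\<Sum>e\<in>S. edge_diff Y e \<bullet> edge_diff X e)"
proof -
  have "Y \<bullet> kron_id (laplacian E (selector S)) X =
    (\<Sum>e\<in>UNIV. if e \<in> S then edge_diff Y e \<bullet> edge_diff X e else 0)"
    unfolding inner_laplacian
    using assms by (subst inner_vec_def) (auto simp: kron_id_incidence kron_id_selector intro!: sum.cong)
  then show ?thesis by (simp add: sum.If_cases)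
qed

lemma selector_UNIV: "selector UNIV = mat 1"
  by (simp add: selector_def mat_def vec_eq_iff of_bool_def)

lemma sqnorm_laplacian_full: "sqnorm (laplacian E (mat 1)) X = (\<Sum>e\<in>E. (norm (edge_diff X e))\<^sup>2)"
proof -
  have "sqnorm (laplacian E (mat 1)) X =
    (\<Sum>e\<in>UNIV. if e \<in> E then edge_diff X e \<bullet> edge_diff X e else 0)"
    unfolding sqnorm_def inner_laplacian selector_UNIV[symmetric]
    by (subst inner_vec_def) (auto simp: kron_id_incidence kron_id_selector intro!: sum.cong)
  then show ?thesis by (simp add: sum.If_cases power2_norm_eq_inner)
qed

lemma average_transpose_incidence:
  "average (kron_id (transpose (incidence E)) U) = 0"
  for E :: "('n::finite \<times> 'n) set"
proof -
  let ?a = "average (kron_id (transpose (incidence E)) U)"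
  have "kron_id (incidence E) (stack ?a) = 0"
    by (simp add: vec_eq_iff[of "kron_id _ _"] kron_id_incidence edge_diff_def)
  then have "real CARD('n) * (?a \<bullet> ?a) = 0"
    by (simp flip: inner_stack add: inner_commute[of "kron_id _ _"] inner_kron_id_transpose)
  then show ?thesis by simp
qed

lemma average_laplacian: "average (kron_id (laplacian E D) X) = 0"
  by (simp add: laplacian_def kron_id_mult average_transpose_incidence flip: matrix_mul_assoc)

text \<open>
  Selecting fewer edges only decreases the quadratic form, so the spectral bound of the full
  Laplacian controls every realisation in operator norm.
\<close>

lemma norm_laplacian_selector_le:
  fixes X :: "(real ^ 'd::finite) ^ 'n::finite"
  assumes S: "S \<subseteq> E" and "0 < \<rho>"
    and spec: "\<And>X :: (real ^ 'd) ^ 'n. sqnorm (laplacian E (mat 1)) X \<le> \<rho> * sqnorm centering X"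
  shows "(norm (kron_id (laplacian E (selector S)) X))\<^sup>2 \<le> \<rho>\<^sup>2 * (norm (centered X))\<^sup>2"
proof -
  define Y where "Y = kron_id (laplacian E (selector S)) X"
  have sub: "(\<Sum>e\<in>S. (norm (edge_diff Z e))\<^sup>2) \<le> \<rho> * (norm (centered Z))\<^sup>2"
    for Z :: "(real ^ 'd) ^ 'n"
  proof -
    have "(\<Sum>e\<in>S. (norm (edge_diff Z e))\<^sup>2) \<le> (\<Sum>e\<in>E. (norm (edge_diff Z e))\<^sup>2)"
      using S by (intro sum_mono2) auto
    then show ?thesis
      using spec[of Z] by (simp add: sqnorm_laplacian_full sqnorm_centering)
  qed
  have young: "2 * (u \<bullet> v) \<le> (norm u)\<^sup>2 / \<rho> + \<rho> * (norm v)\<^sup>2" for u v :: "real ^ 'd"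
  proof -
    have "0 \<le> (norm (u - \<rho> *\<^sub>R v))\<^sup>2 / \<rho>" using \<open>0 < \<rho>\<close> by simp
    also have "\<dots> = (norm u)\<^sup>2 / \<rho> + \<rho> * (norm v)\<^sup>2 - 2 * (u \<bullet> v)"
      using \<open>0 < \<rho>\<close> unfolding power2_norm_eq_inner
      by (simp add: inner_diff_left inner_diff_right inner_commute field_simps)
    finally show ?thesis by simp
  qed
  have "2 * (norm Y)\<^sup>2 = (\<Sum>e\<in>S. 2 * (edge_diff Y e \<bullet> edge_diff X e))"
    using inner_laplacian_selector[OF S, of Y X]
    by (simp add: Y_def power2_norm_eq_inner sum_distrib_left)
  also have "\<dots> \<le> (\<Sum>e\<in>S. (norm (edge_diff Y e))\<^sup>2 / \<rho> + \<rho> * (norm (edge_diff X e))\<^sup>2)"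
    by (intro sum_mono young)
  also have "\<dots> = (\<Sum>e\<in>S. (norm (edge_diff Y e))\<^sup>2) / \<rho> + \<rho> * (\<Sum>e\<in>S. (norm (edge_diff X e))\<^sup>2)"
    by (simp add: sum.distrib sum_divide_distrib sum_distrib_left)
  also have "\<dots> \<le> (\<rho> * (norm (centered Y))\<^sup>2) / \<rho> + \<rho> * (\<rho> * (norm (centered X))\<^sup>2)"
    using \<open>0 < \<rho>\<close> by (intro add_mono divide_right_mono mult_left_mono sub) auto
  also have "\<dots> \<le> (norm Y)\<^sup>2 + \<rho>\<^sup>2 * (norm (centered X))\<^sup>2"
    using \<open>0 < \<rho>\<close> norm_centered_le[of Y] by (simp add: power2_eq_square)
  finally show ?thesis by (simp add: Y_def)
qed

text \<open>
  The cross term of a random Laplacian with two different vectors is reduced to its quadratic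
  form, because only the quadratic form of the mean Laplacian is controlled by the spectral
  bounds. The term dropped here is the nonnegative form at \<open>Y\<close>.
\<close>

lemma inner_laplacian_selector_ge:
  assumes "S \<subseteq> E"
  shows "sqnorm (laplacian E (selector S)) X - sqnorm (laplacian E (selector S)) (X - Y)
    \<le> 2 * (X \<bullet> kron_id (laplacian E (selector S)) Y)"
proof -
  have "(norm (edge_diff X e))\<^sup>2 - (norm (edge_diff (X - Y) e))\<^sup>2 \<le> 2 * (edge_diff X e \<bullet> edge_diff Y e)" for e
  proof -
    have "edge_diff (X - Y) e = edge_diff X e - edge_diff Y e"
      by (simp add: edge_diff_def)
    then have "(norm (edge_diff (X - Y) e))\<^sup>2 =
        (norm (edge_diff X e))\<^sup>2 - 2 * (edge_diff X e \<bullet> edge_diff Y e) + (norm (edge_diff Y e))\<^sup>2"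
      by (simp add: power2_norm_eq_inner inner_diff_left inner_diff_right inner_commute)
    then show ?thesis by simp
  qed
  then show ?thesis
    unfolding sqnorm_def inner_laplacian_selector[OF assms]
    by (simp add: power2_norm_eq_inner[symmetric] sum_distrib_left sum_subtractf[symmetric] sum_mono)
qed

section \<open>Pathwise estimates for one step\<close>

lemma young_norm:
  fixes a b :: "'v::real_inner"
  assumes "0 < s"
  shows "(norm (a + b))\<^sup>2 \<le> (1 + s) * (norm a)\<^sup>2 + (1 + 1 / s) * (norm b)\<^sup>2"
proof -
  have "0 \<le> (norm (s *\<^sub>R a - b))\<^sup>2 / s" using assms by simp
  also have "\<dots> = s * (norm a)\<^sup>2 + (norm b)\<^sup>2 / s - 2 * (a \<bullet> b)"
    using assms unfolding power2_norm_eq_inner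
    by (simp add: inner_diff_left inner_diff_right inner_commute field_simps)
  finally show ?thesis
    unfolding power2_norm_eq_inner by (simp add: inner_add_left inner_add_right inner_commute algebra_simps)
qed

lemma norm_add2_le: "(norm (a + b))\<^sup>2 \<le> 2 * ((norm a)\<^sup>2 + (norm b)\<^sup>2)" for a b :: "'v::real_inner"
  using young_norm[of 1 a b] by simp

lemma norm_add3_le:
  "(norm (a + b + c))\<^sup>2 \<le> 3 * ((norm a)\<^sup>2 + (norm b)\<^sup>2 + (norm c)\<^sup>2)" for a b c :: "'v::real_inner"
  using young_norm[of "1/2" "a + b" c] norm_add2_le[of a b] by simp

lemma norm_add4_le:
  "(norm (a + b + c + d))\<^sup>2 \<le> 4 * ((norm a)\<^sup>2 + (norm b)\<^sup>2 + (norm c)\<^sup>2 + (norm d)\<^sup>2)"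
  for a b c d :: "'v::real_inner"
  using young_norm[of "1/3" "a + b + c" d] norm_add3_le[of a b c] by simp

lemma norm_add5_le:
  "(norm (a + b + c + d + e))\<^sup>2
    \<le> 5 * ((norm a)\<^sup>2 + (norm b)\<^sup>2 + (norm c)\<^sup>2 + (norm d)\<^sup>2 + (norm e)\<^sup>2)"
  for a b c d e :: "'v::real_inner"
  using young_norm[of "1/4" "a + b + c + d" e] norm_add4_le[of a b c d] by simp

lemma norm_convex_le:
  fixes a b :: "'v::real_inner"
  assumes "0 \<le> t" "t \<le> 1"
  shows "(norm ((1 - t) *\<^sub>R a + t *\<^sub>R b))\<^sup>2 \<le> (1 - t) * (norm a)\<^sup>2 + t * (norm b)\<^sup>2"
proof -
  have "(1 - t) * (norm a)\<^sup>2 + t * (norm b)\<^sup>2 - (norm ((1 - t) *\<^sub>R a + t *\<^sub>R b))\<^sup>2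
      = t * (1 - t) * (norm (a - b))\<^sup>2"
    unfolding power2_norm_eq_inner
    by (simp add: inner_add_left inner_add_right inner_diff_left inner_diff_right inner_commute algebra_simps)
  also have "\<dots> \<ge> 0" using assms by simp
  finally show ?thesis by simp
qed

text \<open>
  The deterministic data: \<open>g i\<close> is the gradient of the objective of agent \<open>i\<close>, \<open>F\<close> the average
  objective and \<open>\<rho>t\<close> the upper spectral bound of the full Laplacian.
\<close>

locale consensus_problem =
  fixes E :: "('n::finite \<times> 'n) set"
    and g :: "'n \<Rightarrow> real ^ 'd::finite \<Rightarrow> real ^ 'd"
    and F :: "real ^ 'd \<Rightarrow> real"
    and L fstar \<rho>min \<rho>max \<rho>t :: real
  assumes smooth: "\<And>i x y. norm (g i x - g i y) \<le> L * norm (x - y)"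
    and F_deriv: "\<And>x. GDERIV F x :> (1 / real CARD('n)) *\<^sub>R (\<Sum>i\<in>UNIV. g i x)"
    and F_lower: "\<And>x. fstar \<le> F x"
    and rho: "0 < \<rho>min" "\<rho>min \<le> \<rho>max" "0 < \<rho>t"
    and spec: "\<And>X :: (real ^ 'd) ^ 'n. sqnorm (laplacian E (mat 1)) X \<le> \<rho>t * sqnorm centering X"
begin

definition gradF :: "(real ^ 'd) ^ 'n \<Rightarrow> (real ^ 'd) ^ 'n" where
  "gradF X = (\<chi> i. g i (X $ i))"

definition meangrad :: "(real ^ 'd) ^ 'n \<Rightarrow> (real ^ 'd) ^ 'n" where
  "meangrad X = gradF (stack (average X))"

text \<open>
  At a stationary point the dual variable cancels the centered local gradients, so for \<open>c = 0\<close>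
  this is the deviation of the dual variable from its ideal value. The term with \<open>c\<close> corrects for
  the part of the dual increment that is visible in \<open>X\<close>.
\<close>

definition hetero :: "real \<Rightarrow> (real ^ 'd) ^ 'n \<Rightarrow> (real ^ 'd) ^ 'n \<Rightarrow> (real ^ 'd) ^ 'n" where
  "hetero c X lt = lt + c *\<^sub>R centered X + centered (meangrad X)"

lemma L_nonneg: "0 \<le> L"
proof -
  obtain k :: 'd where True by simp
  have "norm (g i (axis k 1) - g i 0) \<le> L * norm (axis k (1::real) - 0)" for i by (rule smooth)
  then have "0 \<le> L * norm (axis k (1::real))" by (metis diff_zero norm_ge_zero order_trans)
  then show ?thesis by simp
qed

lemma gradF_lipschitz: "(norm (gradF X - gradF Y))\<^sup>2 \<le> L\<^sup>2 * (norm (X - Y))\<^sup>2"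
proof -
  have "(norm (gradF X - gradF Y))\<^sup>2 = (\<Sum>i\<in>UNIV. (norm (g i (X $ i) - g i (Y $ i)))\<^sup>2)"
    by (simp add: norm_vec_def L2_set_def gradF_def sum_nonneg)
  also have "\<dots> \<le> (\<Sum>i\<in>UNIV. (L * norm (X $ i - Y $ i))\<^sup>2)"
    by (intro sum_mono power_mono smooth) simp
  also have "\<dots> = L\<^sup>2 * (norm (X - Y))\<^sup>2"
    by (simp add: norm_vec_def L2_set_def sum_nonneg power_mult_distrib sum_distrib_left)
  finally show ?thesis .
qed

lemma gradF_meangrad: "(norm (gradF X - meangrad X))\<^sup>2 \<le> L\<^sup>2 * (norm (centered X))\<^sup>2"
  unfolding meangrad_def centered_def by (rule gradF_lipschitz)

lemma F_gderiv: "GDERIV F x :> average (gradF (stack x))"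
  using F_deriv[of x] by (simp add: average_def gradF_def)

lemma grad_F: "grad F (average X) = average (meangrad X)"
  unfolding meangrad_def by (rule grad_eqI[OF F_gderiv])

lemma F_lipschitz:
  "norm (average (gradF (stack x)) - average (gradF (stack y))) \<le> L * norm (x - y)"
proof -
  let ?n = "real CARD('n)"
  have "(norm (average (gradF (stack x) - gradF (stack y))))\<^sup>2
      \<le> (norm (gradF (stack x) - gradF (stack y)))\<^sup>2 / ?n"
    by (rule norm_average_le)
  also have "\<dots> \<le> (L\<^sup>2 * (norm (stack x - stack y :: (real ^ 'd) ^ 'n))\<^sup>2) / ?n"
    by (intro divide_right_mono gradF_lipschitz) simp
  also have "\<dots> = (L * norm (x - y))\<^sup>2"
    by (simp add: norm_stack flip: stack_linear add: power_mult_distrib)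
  finally show ?thesis
    using L_nonneg by (simp add: average_linear abs_le_square_iff[symmetric])
qed

text \<open>
  The update direction splits into gradient noise, the mismatch between gradients at the agents
  and at the average, the dual mismatch, the correction in \<open>hetero\<close>, and the common gradient.
\<close>

lemma direction_bound:
  "(norm (gradF X + \<zeta> + lt))\<^sup>2 \<le> 5 * ((norm \<zeta>)\<^sup>2 + (L\<^sup>2 + c\<^sup>2) * (norm (centered X))\<^sup>2
    + (norm (hetero c X lt))\<^sup>2 + real CARD('n) * (norm (grad F (average X)))\<^sup>2)"
proof -
  have "gradF X + \<zeta> + lt = \<zeta> + (gradF X - meangrad X) + hetero c X lt + (- (c *\<^sub>R centered X))
      + stack (average (meangrad X))"
    unfolding hetero_def centered_def[of "meangrad X"] by simp
  also have "(norm \<dots>)\<^sup>2 \<le> 5 * ((norm \<zeta>)\<^sup>2 + (norm (gradF X - meangrad X))\<^sup>2 + (norm (hetero c X lt))\<^sup>2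
      + (norm (- (c *\<^sub>R centered X)))\<^sup>2 + (norm (stack (average (meangrad X)) :: (real ^ 'd) ^ 'n))\<^sup>2)"
    by (rule norm_add5_le)
  also have "\<dots> \<le> 5 * ((norm \<zeta>)\<^sup>2 + L\<^sup>2 * (norm (centered X))\<^sup>2 + (norm (hetero c X lt))\<^sup>2
      + c\<^sup>2 * (norm (centered X))\<^sup>2 + real CARD('n) * (norm (grad F (average X)))\<^sup>2)"
    using gradF_meangrad[of X] by (simp add: norm_stack grad_F power_mult_distrib)
  finally show ?thesis by (simp add: algebra_simps)
qed

lemma mean_direction_bound:
  "(norm (average (gradF X + \<zeta>)))\<^sup>2 \<le> 3 * ((norm \<zeta>)\<^sup>2 / real CARD('n)
    + L\<^sup>2 * (norm (centered X))\<^sup>2 / real CARD('n) + (norm (grad F (average X)))\<^sup>2)"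
proof -
  have "average (gradF X + \<zeta>) = average \<zeta> + average (gradF X - meangrad X) + grad F (average X)"
    by (simp add: average_linear grad_F)
  also have "(norm \<dots>)\<^sup>2 \<le> 3 * ((norm (average \<zeta>))\<^sup>2 + (norm (average (gradF X - meangrad X)))\<^sup>2
      + (norm (grad F (average X)))\<^sup>2)"
    by (rule norm_add3_le)
  also have "(norm (average (gradF X - meangrad X)))\<^sup>2 \<le> L\<^sup>2 * (norm (centered X))\<^sup>2 / real CARD('n)"
    using norm_average_le[of "gradF X - meangrad X"] gradF_meangrad[of X]
    by (meson divide_right_mono of_nat_0_le_iff order_trans)
  finally show ?thesis using norm_average_le[of \<zeta>] by simp
qed

text \<open>
  One realisation of a step: \<open>\<zeta>\<close> is the gradient noise and \<open>S\<close> the set of active edges.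
\<close>

context
  fixes X lt Xh \<zeta> X' lt' :: "(real ^ 'd) ^ 'n" and S :: "('n \<times> 'n) set" and \<alpha> \<theta> \<eta> :: real
  assumes pos: "0 < \<alpha>" "0 < \<theta>" "0 < \<eta>"
    and S: "S \<subseteq> E"
    and X': "X' = X - \<alpha> *\<^sub>R (gradF X + \<zeta> + lt + \<theta> *\<^sub>R kron_id (laplacian E (selector S)) Xh)"
    and lt': "lt' = lt + \<eta> *\<^sub>R kron_id (laplacian E (selector S)) Xh"
    and lt_avg: "average lt = 0"
begin

private abbreviation "D \<equiv> kron_id (laplacian E (selector S)) Xh"
private abbreviation "dir \<equiv> gradF X + \<zeta> + lt"

private lemma D_centered [simp]: "average D = 0" "centered D = D"
  by (simp_all add: average_laplacian centered_eq)

private lemma norm_D: "(norm D)\<^sup>2 \<le> 2 * \<rho>t\<^sup>2 * ((norm (centered X))\<^sup>2 + (norm (X - Xh))\<^sup>2)"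
proof -
  have "(norm (centered Xh))\<^sup>2 \<le> 2 * ((norm (centered X))\<^sup>2 + (norm (- centered (X - Xh)))\<^sup>2)"
    using norm_add2_le[of "centered X" "- centered (X - Xh)"] by (simp add: centered_linear)
  also have "\<dots> \<le> 2 * ((norm (centered X))\<^sup>2 + (norm (X - Xh))\<^sup>2)"
    using norm_centered_le[of "X - Xh"] by simp
  finally have "\<rho>t\<^sup>2 * (norm (centered Xh))\<^sup>2 \<le> \<rho>t\<^sup>2 * (2 * ((norm (centered X))\<^sup>2 + (norm (X - Xh))\<^sup>2))"
    by (rule mult_left_mono) simp
  also have "\<dots> = 2 * \<rho>t\<^sup>2 * ((norm (centered X))\<^sup>2 + (norm (X - Xh))\<^sup>2)"
    by simp
  finally have "\<rho>t\<^sup>2 * (norm (centered Xh))\<^sup>2 \<le> \<dots>" .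
  moreover have "(norm D)\<^sup>2 \<le> \<rho>t\<^sup>2 * (norm (centered Xh))\<^sup>2"
    using S rho spec by (rule_tac norm_laplacian_selector_le)
  ultimately show ?thesis by linarith
qed

lemma average_step: "average X' = average X - \<alpha> *\<^sub>R average (gradF X + \<zeta>)"
  by (simp add: X' average_linear lt_avg)

text \<open>
  The Laplacian part is kept with its exact first-order term, which gives the contraction in
  expectation; the direction is a perturbation of size \<open>\<alpha>\<close>, and \<open>s\<close> balances the two.
\<close>

lemma consensus_step:
  assumes "0 < s"
  shows "(norm (centered X'))\<^sup>2 \<le> (1 + s) * ((norm (centered X))\<^sup>2
      - \<alpha> * \<theta> * sqnorm (laplacian E (selector S)) X + \<alpha> * \<theta> * sqnorm (laplacian E (selector S)) (X - Xh)
      + 2 * (\<alpha> * \<theta> * \<rho>t)\<^sup>2 * ((norm (centered X))\<^sup>2 + (norm (X - Xh))\<^sup>2))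
    + (1 + 1 / s) * \<alpha>\<^sup>2 * (norm dir)\<^sup>2"
proof -
  let ?\<tau> = "\<alpha> * \<theta>" and ?u = "centered X - (\<alpha> * \<theta>) *\<^sub>R D"
  have "centered X' = ?u + (- \<alpha> *\<^sub>R centered dir)"
    by (simp add: X' centered_linear algebra_simps)
  then have "(norm (centered X'))\<^sup>2 \<le> (1 + s) * (norm ?u)\<^sup>2 + (1 + 1 / s) * (norm (- \<alpha> *\<^sub>R centered dir))\<^sup>2"
    using young_norm[OF assms, of ?u "- \<alpha> *\<^sub>R centered dir"] by simp
  also have "\<dots> \<le> (1 + s) * ((norm (centered X))\<^sup>2 - ?\<tau> * (sqnorm (laplacian E (selector S)) X
      - sqnorm (laplacian E (selector S)) (X - Xh))
      + ?\<tau>\<^sup>2 * (2 * \<rho>t\<^sup>2 * ((norm (centered X))\<^sup>2 + (norm (X - Xh))\<^sup>2)))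
    + (1 + 1 / s) * (\<alpha>\<^sup>2 * (norm dir)\<^sup>2)"
  proof (intro add_mono mult_left_mono)
    have "(norm ?u)\<^sup>2 = (norm (centered X))\<^sup>2 - ?\<tau> * (2 * (centered X \<bullet> D)) + ?\<tau>\<^sup>2 * (norm D)\<^sup>2"
      unfolding power2_norm_eq_inner power2_eq_square[of "_ * _"]
      by (simp add: inner_diff_left inner_diff_right inner_commute algebra_simps)
    also have "centered X \<bullet> D = X \<bullet> D"
      by (simp add: centered_def inner_diff_left inner_commute[of "stack _"] inner_stack)
    also have "(norm (centered X))\<^sup>2 - ?\<tau> * (2 * (X \<bullet> D)) + ?\<tau>\<^sup>2 * (norm D)\<^sup>2
      \<le> (norm (centered X))\<^sup>2 - ?\<tau> * (sqnorm (laplacian E (selector S)) X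
      - sqnorm (laplacian E (selector S)) (X - Xh))
      + ?\<tau>\<^sup>2 * (2 * \<rho>t\<^sup>2 * ((norm (centered X))\<^sup>2 + (norm (X - Xh))\<^sup>2))"
      using pos norm_D inner_laplacian_selector_ge[OF S, of X Xh]
      by (intro add_mono diff_mono mult_left_mono) auto
    finally show "(norm ?u)\<^sup>2 \<le> \<dots>" .
  qed (use assms norm_centered_le[of dir] in \<open>auto simp: power_mult_distrib mult_left_mono\<close>)
  finally show ?thesis by (simp add: power_mult_distrib algebra_simps)
qed

text \<open>
  The quantity that is compressed exceeds the previous compression error only by the move of
  \<open>X\<close>. The fraction \<open>q / 4\<close> given away here is less than what the compressor contracts.
\<close>

lemma innovation_step:
  assumes "0 < q" "q \<le> 1"
  shows "(norm (X' - Xh))\<^sup>2 \<le> (1 + q / 4) * (norm (X - Xh))\<^sup>2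
    + 5 / q * (4 * (\<alpha> * \<theta> * \<rho>t)\<^sup>2 * ((norm (centered X))\<^sup>2 + (norm (X - Xh))\<^sup>2)
      + 2 * \<alpha>\<^sup>2 * (norm dir)\<^sup>2)"
proof -
  let ?v = "- (\<alpha> * \<theta>) *\<^sub>R D + (- \<alpha>) *\<^sub>R dir"
  have v: "(norm ?v)\<^sup>2 \<le> 4 * (\<alpha> * \<theta> * \<rho>t)\<^sup>2 * ((norm (centered X))\<^sup>2 + (norm (X - Xh))\<^sup>2)
      + 2 * \<alpha>\<^sup>2 * (norm dir)\<^sup>2"
  proof -
    have "(norm ?v)\<^sup>2 \<le> 2 * ((norm (- (\<alpha> * \<theta>) *\<^sub>R D))\<^sup>2 + (norm ((- \<alpha>) *\<^sub>R dir))\<^sup>2)"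
      by (rule norm_add2_le)
    also have "\<dots> = 2 * ((\<alpha> * \<theta>)\<^sup>2 * (norm D)\<^sup>2) + 2 * \<alpha>\<^sup>2 * (norm dir)\<^sup>2"
      by (simp add: power_mult_distrib distrib_left)
    also have "(\<alpha> * \<theta>)\<^sup>2 * (norm D)\<^sup>2 \<le> (\<alpha> * \<theta>)\<^sup>2 * (2 * \<rho>t\<^sup>2 * ((norm (centered X))\<^sup>2 + (norm (X - Xh))\<^sup>2))"
      by (intro mult_left_mono norm_D) simp
    finally show ?thesis by (simp add: power_mult_distrib algebra_simps)
  qed
  \<comment> \<open>Young's inequality with parameter \<open>q / 4\<close>; \<open>1 + 4 / q \<le> 5 / q\<close> because \<open>q \<le> 1\<close>\<close>
  have "X' - Xh = (X - Xh) + ?v" by (simp add: X' algebra_simps)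
  then have "(norm (X' - Xh))\<^sup>2 \<le> (1 + q / 4) * (norm (X - Xh))\<^sup>2 + (1 + 1 / (q / 4)) * (norm ?v)\<^sup>2"
    using young_norm[of "q / 4" "X - Xh" ?v] assms by (simp only:)
  also have "(1 + 1 / (q / 4)) * (norm ?v)\<^sup>2 \<le> 5 / q * (norm ?v)\<^sup>2"
    using assms by (intro mult_right_mono) (auto simp: field_simps)
  also have "\<dots> \<le> 5 / q * (4 * (\<alpha> * \<theta> * \<rho>t)\<^sup>2 * ((norm (centered X))\<^sup>2 + (norm (X - Xh))\<^sup>2)
      + 2 * \<alpha>\<^sup>2 * (norm dir)\<^sup>2)"
    using v assms by (intro mult_left_mono) auto
  finally show ?thesis by simp
qed

text \<open>
  Since \<open>c \<alpha> \<theta> = \<eta>\<close>, the increments \<open>\<eta> D\<close> of the dual variable and \<open>- c \<alpha> \<theta> D\<close> of \<open>c X\<close> cancel,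
  whatever the active edges are. What remains is a convex combination, with weight \<open>\<eta> / \<theta>\<close>, of the
  old value and a forcing term; the drift of the local gradients at the average is part of the
  forcing because the average moves by only \<open>\<alpha>\<close>, which is \<open>\<eta> / \<theta>\<close> up to the factor \<open>c\<close>.
\<close>

lemma hetero_step:
  fixes c :: real
  assumes c: "c = \<eta> / (\<alpha> * \<theta>)" and b: "\<eta> / \<theta> \<le> 1"
  shows "(norm (hetero c X' lt'))\<^sup>2 \<le> (1 - \<eta> / \<theta>) * (norm (hetero c X lt))\<^sup>2
    + \<eta> / \<theta> * (4 * ((L\<^sup>2 + c\<^sup>2) * (norm (centered X))\<^sup>2 + (norm \<zeta>)\<^sup>2
      + 3 * L\<^sup>2 / c\<^sup>2 * ((norm \<zeta>)\<^sup>2 + L\<^sup>2 * (norm (centered X))\<^sup>2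
        + real CARD('n) * (norm (grad F (average X)))\<^sup>2)))"
proof -
  let ?\<beta> = "\<eta> / \<theta>" and ?n = "real CARD('n)"
  have \<beta>: "0 < ?\<beta>" and c0: "0 < c" using pos by (simp_all add: c)
  have c\<alpha>: "c * \<alpha> = ?\<beta>" and c\<tau>: "c * (\<alpha> * \<theta>) = \<eta>" using pos by (simp_all add: c)
  define w where "w = c *\<^sub>R centered X + (- centered (gradF X - meangrad X)) + (- centered \<zeta>)
    + (1 / ?\<beta>) *\<^sub>R centered (meangrad X' - meangrad X)"
  have cX': "c *\<^sub>R centered X' = c *\<^sub>R centered X - ?\<beta> *\<^sub>R (centered (gradF X + \<zeta>) + lt) - \<eta> *\<^sub>R D"
  proof -
    have "centered X' = centered X - \<alpha> *\<^sub>R (centered (gradF X + \<zeta>) + lt) - (\<alpha> * \<theta>) *\<^sub>R D"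
      using centered_eq[OF lt_avg] by (simp add: X' centered_linear algebra_simps)
    then show ?thesis
      by (simp only: scaleR_diff_right scaleR_scaleR c\<alpha> c\<tau>)
  qed
  have "?\<beta> *\<^sub>R w = ?\<beta> *\<^sub>R (c *\<^sub>R centered X - centered (gradF X - meangrad X) - centered \<zeta>)
      + centered (meangrad X' - meangrad X)"
    using pos by (simp add: w_def scaleR_add_right scaleR_diff_right)
  then have "hetero c X' lt' = (1 - ?\<beta>) *\<^sub>R hetero c X lt + ?\<beta> *\<^sub>R w"
    unfolding hetero_def cX' lt' by (simp add: centered_linear algebra_simps)
  then have "(norm (hetero c X' lt'))\<^sup>2 \<le> (1 - ?\<beta>) * (norm (hetero c X lt))\<^sup>2 + ?\<beta> * (norm w)\<^sup>2"
    using norm_convex_le[of ?\<beta> "hetero c X lt" w] \<beta> b by simp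
  note 1 = this
  have "(norm w)\<^sup>2 \<le> 4 * (c\<^sup>2 * (norm (centered X))\<^sup>2 + L\<^sup>2 * (norm (centered X))\<^sup>2 + (norm \<zeta>)\<^sup>2
      + 3 * L\<^sup>2 / c\<^sup>2 * ((norm \<zeta>)\<^sup>2 + L\<^sup>2 * (norm (centered X))\<^sup>2 + ?n * (norm (grad F (average X)))\<^sup>2))"
      (is "_ \<le> ?w")
  proof -
  have "(norm w)\<^sup>2 \<le> 4 * ((norm (c *\<^sub>R centered X))\<^sup>2 + (norm (- centered (gradF X - meangrad X)))\<^sup>2
      + (norm (- centered \<zeta>))\<^sup>2 + (norm ((1 / ?\<beta>) *\<^sub>R centered (meangrad X' - meangrad X)))\<^sup>2)"
    unfolding w_def by (rule norm_add4_le)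
  also have "\<dots> \<le> 4 * (c\<^sup>2 * (norm (centered X))\<^sup>2 + L\<^sup>2 * (norm (centered X))\<^sup>2 + (norm \<zeta>)\<^sup>2
      + 3 * L\<^sup>2 / c\<^sup>2 * ((norm \<zeta>)\<^sup>2 + L\<^sup>2 * (norm (centered X))\<^sup>2 + ?n * (norm (grad F (average X)))\<^sup>2))"
  proof (intro mult_left_mono add_mono)
    show "(norm (- centered (gradF X - meangrad X)))\<^sup>2 \<le> L\<^sup>2 * (norm (centered X))\<^sup>2"
      using norm_centered_le[of "gradF X - meangrad X"] gradF_meangrad[of X]
      unfolding norm_minus_cancel by (rule order_trans)
    have "(norm (meangrad X' - meangrad X))\<^sup>2
        \<le> L\<^sup>2 * (norm (stack (average X') - stack (average X) :: (real ^ 'd) ^ 'n))\<^sup>2"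
      unfolding meangrad_def by (rule gradF_lipschitz)
    also have "\<dots> = L\<^sup>2 * \<alpha>\<^sup>2 * (?n * (norm (average (gradF X + \<zeta>)))\<^sup>2)"
      by (simp add: average_step norm_stack power_mult_distrib flip: stack_linear)
    also have "\<dots> \<le> L\<^sup>2 * \<alpha>\<^sup>2 * (?n * (3 * ((norm \<zeta>)\<^sup>2 / ?n + L\<^sup>2 * (norm (centered X))\<^sup>2 / ?n
        + (norm (grad F (average X)))\<^sup>2)))"
      by (intro mult_left_mono mean_direction_bound) auto
    also have "\<dots> = L\<^sup>2 * \<alpha>\<^sup>2 * (3 * ((norm \<zeta>)\<^sup>2 + L\<^sup>2 * (norm (centered X))\<^sup>2
        + ?n * (norm (grad F (average X)))\<^sup>2))"
      by (simp add: distrib_left)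
    finally have *: "(norm (meangrad X' - meangrad X))\<^sup>2 \<le> L\<^sup>2 * \<alpha>\<^sup>2 * (3 * ((norm \<zeta>)\<^sup>2
        + L\<^sup>2 * (norm (centered X))\<^sup>2 + ?n * (norm (grad F (average X)))\<^sup>2))" .
    have "(norm ((1 / ?\<beta>) *\<^sub>R centered (meangrad X' - meangrad X)))\<^sup>2
        \<le> (1 / ?\<beta>)\<^sup>2 * (L\<^sup>2 * \<alpha>\<^sup>2 * (3 * ((norm \<zeta>)\<^sup>2
        + L\<^sup>2 * (norm (centered X))\<^sup>2 + ?n * (norm (grad F (average X)))\<^sup>2)))"
      unfolding norm_scaleR power_mult_distrib power2_abs
      by (intro mult_left_mono order_trans[OF norm_centered_le *]) simp
    also have "\<dots> = ((1 / ?\<beta>)\<^sup>2 * \<alpha>\<^sup>2) * (3 * L\<^sup>2 * ((norm \<zeta>)\<^sup>2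
        + L\<^sup>2 * (norm (centered X))\<^sup>2 + ?n * (norm (grad F (average X)))\<^sup>2))"
      by (simp add: mult.left_commute mult.assoc)
    also have "(1 / ?\<beta>)\<^sup>2 * \<alpha>\<^sup>2 = 1 / c\<^sup>2"
      using pos by (simp add: c power_divide power_mult_distrib)
    finally show "(norm ((1 / ?\<beta>) *\<^sub>R centered (meangrad X' - meangrad X)))\<^sup>2 \<le>
      3 * L\<^sup>2 / c\<^sup>2 * ((norm \<zeta>)\<^sup>2 + L\<^sup>2 * (norm (centered X))\<^sup>2 + ?n * (norm (grad F (average X)))\<^sup>2)"
      by simp
  qed (use norm_centered_le[of \<zeta>] in \<open>auto simp: power_mult_distrib\<close>)
  finally show ?thesis .
  qed
  then have 2: "?\<beta> * (norm w)\<^sup>2 \<le> ?\<beta> * ?w"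
    using \<beta> by (intro mult_left_mono) auto
  have 3: "?w = 4 * ((L\<^sup>2 + c\<^sup>2) * (norm (centered X))\<^sup>2 + (norm \<zeta>)\<^sup>2
      + 3 * L\<^sup>2 / c\<^sup>2 * ((norm \<zeta>)\<^sup>2 + L\<^sup>2 * (norm (centered X))\<^sup>2 + ?n * (norm (grad F (average X)))\<^sup>2))"
    by (simp only: distrib_right) simp
  show ?thesis using 1 2 unfolding 3 by linarith
qed

text \<open>
  The average moves along the mean of the local gradients only, since Laplacian and dual terms
  have average zero. The inner product with the noise is kept for its expectation to vanish.
\<close>

lemma objective_step:
  "F (average X') \<le> F (average X) - \<alpha> * (grad F (average X) \<bullet> average \<zeta>)
    - \<alpha> / 2 * (norm (grad F (average X)))\<^sup>2 + \<alpha> * L\<^sup>2 / (2 * real CARD('n)) * (norm (centered X))\<^sup>2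
    + 3 * L * \<alpha>\<^sup>2 / 2 * ((norm \<zeta>)\<^sup>2 / real CARD('n)
    + L\<^sup>2 * (norm (centered X))\<^sup>2 / real CARD('n) + (norm (grad F (average X)))\<^sup>2)"
proof -
  let ?n = "real CARD('n)" and ?G = "grad F (average X)" and ?m = "average (gradF X)"
  have "F (average X') \<le> F (average X) + average (gradF (stack (average X))) \<bullet> (average X' - average X)
      + L / 2 * (norm (average X' - average X))\<^sup>2"
    by (rule descent_lemma[OF F_gderiv F_lipschitz])
  also have "\<dots> = F (average X) - \<alpha> * (?G \<bullet> average \<zeta>) - \<alpha> * (?G \<bullet> ?m)
      + L / 2 * \<alpha>\<^sup>2 * (norm (average (gradF X + \<zeta>)))\<^sup>2"
    by (simp add: average_step grad_F flip: meangrad_def)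
      (simp add: average_linear power_mult_distrib inner_add_right algebra_simps)
  finally have 1: "F (average X') \<le> F (average X) - \<alpha> * (?G \<bullet> average \<zeta>) - \<alpha> * (?G \<bullet> ?m)
      + L / 2 * \<alpha>\<^sup>2 * (norm (average (gradF X + \<zeta>)))\<^sup>2" .
  have 2: "\<alpha> * (?G \<bullet> ?m) \<ge> \<alpha> / 2 * (norm ?G)\<^sup>2 - \<alpha> / 2 * (L\<^sup>2 * (norm (centered X))\<^sup>2 / ?n)"
  proof -
    have "(norm (?m - ?G))\<^sup>2 \<le> L\<^sup>2 * (norm (centered X))\<^sup>2 / ?n"
    proof -
      have "(norm (average (gradF X - meangrad X)))\<^sup>2 \<le> (norm (gradF X - meangrad X))\<^sup>2 / ?n"
        by (rule norm_average_le)
      also have "\<dots> \<le> L\<^sup>2 * (norm (centered X))\<^sup>2 / ?n"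
        by (intro divide_right_mono gradF_meangrad) simp
      finally show ?thesis by (simp add: average_linear grad_F)
    qed
    moreover have "(norm (?m - ?G))\<^sup>2 = (norm ?m)\<^sup>2 + (norm ?G)\<^sup>2 - 2 * (?G \<bullet> ?m)"
      unfolding power2_norm_eq_inner by (simp add: inner_diff_left inner_diff_right inner_commute)
    ultimately have "(norm ?G)\<^sup>2 - L\<^sup>2 * (norm (centered X))\<^sup>2 / ?n \<le> 2 * (?G \<bullet> ?m)"
      using zero_le_power2[of "norm ?m"] by linarith
    then have "\<alpha> / 2 * ((norm ?G)\<^sup>2 - L\<^sup>2 * (norm (centered X))\<^sup>2 / ?n) \<le> \<alpha> / 2 * (2 * (?G \<bullet> ?m))"
      using pos by (intro mult_left_mono) auto
    then show ?thesis by (simp add: algebra_simps)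
  qed
  have 3: "L / 2 * \<alpha>\<^sup>2 * (norm (average (gradF X + \<zeta>)))\<^sup>2 \<le> L / 2 * \<alpha>\<^sup>2 * (3 * ((norm \<zeta>)\<^sup>2 / ?n
      + L\<^sup>2 * (norm (centered X))\<^sup>2 / ?n + (norm ?G)\<^sup>2))"
    using L_nonneg by (intro mult_left_mono mean_direction_bound) auto
  have "L / 2 * \<alpha>\<^sup>2 * (3 * y) = 3 * L * \<alpha>\<^sup>2 / 2 * y" for y by simp
  from this[of "(norm \<zeta>)\<^sup>2 / ?n + L\<^sup>2 * (norm (centered X))\<^sup>2 / ?n + (norm ?G)\<^sup>2"]
  have "F (average X') \<le> F (average X) - \<alpha> * (?G \<bullet> average \<zeta>)
    - (\<alpha> / 2 * (norm ?G)\<^sup>2 - \<alpha> / 2 * (L\<^sup>2 * (norm (centered X))\<^sup>2 / ?n))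
    + 3 * L * \<alpha>\<^sup>2 / 2 * ((norm \<zeta>)\<^sup>2 / ?n + L\<^sup>2 * (norm (centered X))\<^sup>2 / ?n + (norm ?G)\<^sup>2)"
    using 1 2 3 by linarith
  then show ?thesis by simp
qed

end

end

section \<open>The compressor contracts\<close>

lemma nn_integral_le_integralI:
  fixes f :: "'a \<Rightarrow> real"
  assumes "\<And>x. x \<in> space M \<Longrightarrow> f x \<le> ennreal (h x)" "\<And>x. x \<in> space M \<Longrightarrow> 0 \<le> h x" "integrable M h"
    "integral\<^sup>L M h \<le> b"
  shows "(\<integral>\<^sup>+x. f x \<partial>M) \<le> ennreal b"
proof -
  have "(\<integral>\<^sup>+x. f x \<partial>M) \<le> (\<integral>\<^sup>+x. ennreal (h x) \<partial>M)"
    using assms(1) by (rule nn_integral_mono)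
  also have "\<dots> = ennreal (integral\<^sup>L M h)"
    using assms(2,3) by (intro nn_integral_eq_integral) auto
  also have "\<dots> \<le> ennreal b" by (intro ennreal_leI assms)
  finally show ?thesis .
qed

text \<open>
  A convex combination of the identity and of the relative compression error contracts. The
  channel noise \<open>W\<close> has mean zero, so it is uncorrelated with \<open>u\<close>, and its correlation with the
  compression error carries the factor \<open>r \<gamma>\<^sup>2\<close>. Half of the contraction absorbs this, and the
  noise enters with \<open>\<gamma>\<^sup>2\<close> rather than with \<open>\<gamma>\<close>.
\<close>

lemma compressor_step:
  fixes Q :: "'v::euclidean_space \<Rightarrow> 'q \<Rightarrow> 'v"
  assumes compr: "noisy_compressor \<delta> r \<sigma> Mq Q"
    and \<delta>: "0 < \<delta>" "\<delta> \<le> 1" and r: "0 < r" and \<gamma>: "0 < \<gamma>" "\<gamma> \<le> 1" "r * \<gamma> \<le> 1"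
  shows "(\<integral>\<^sup>+s. ennreal ((norm (u - \<gamma> *\<^sub>R Q u s))\<^sup>2) \<partial>Mq)
    \<le> ennreal ((1 - r * \<gamma> * \<delta> / 2) * (norm u)\<^sup>2 + \<gamma>\<^sup>2 * (1 + 2 * r / \<delta>) * \<sigma>\<^sup>2)"
proof -
  interpret prob_space Mq using compr by (simp add: noisy_compressor_def)
  from compr obtain Qh W where
    Q: "\<And>s. s \<in> space Mq \<Longrightarrow> Q u s = Qh u s + W u s"
    and W0: "has_bochner_integral Mq (W u) 0"
    and W2: "integrable Mq (\<lambda>s. (norm (W u s))\<^sup>2)" "(LINT s|Mq. (norm (W u s))\<^sup>2) \<le> \<sigma>\<^sup>2"
    and V2: "integrable Mq (\<lambda>s. (norm (u - Qh u s /\<^sub>R r))\<^sup>2)"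
      "(LINT s|Mq. (norm (u - Qh u s /\<^sub>R r))\<^sup>2) \<le> (1 - \<delta>)\<^sup>2 * (norm u)\<^sup>2"
    unfolding noisy_compressor_def by blast
  define v where "v s = u - Qh u s /\<^sub>R r" for s
  define h where "h s = (1 - r * \<gamma>) * (norm u)\<^sup>2 + r * \<gamma> * (norm (v s))\<^sup>2
      - 2 * \<gamma> * (1 - r * \<gamma>) * (u \<bullet> W u s)
      + r * \<gamma>\<^sup>2 * (\<delta> / 2 * (norm (v s))\<^sup>2 + 2 / \<delta> * (norm (W u s))\<^sup>2) + \<gamma>\<^sup>2 * (norm (W u s))\<^sup>2" for s
  have le: "(norm (u - \<gamma> *\<^sub>R Q u s))\<^sup>2 \<le> h s" if s: "s \<in> space Mq" for s
  proof -
    define p where "p = (1 - r * \<gamma>) *\<^sub>R u + (r * \<gamma>) *\<^sub>R v s"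
    have "u - \<gamma> *\<^sub>R Q u s = p - \<gamma> *\<^sub>R W u s"
    proof -
      have "(r * \<gamma>) *\<^sub>R v s = (r * \<gamma>) *\<^sub>R u - \<gamma> *\<^sub>R Qh u s"
        using r by (simp add: v_def scaleR_diff_right)
      then show ?thesis by (simp add: p_def Q[OF s] algebra_simps)
    qed
    moreover have "(norm (p - \<gamma> *\<^sub>R W u s))\<^sup>2 = (norm p)\<^sup>2 - 2 * \<gamma> * (p \<bullet> W u s) + \<gamma>\<^sup>2 * (norm (W u s))\<^sup>2"
      unfolding power2_norm_eq_inner power2_eq_square[of \<gamma>]
      by (simp add: inner_diff_left inner_diff_right inner_commute algebra_simps)
    moreover have "(norm p)\<^sup>2 \<le> (1 - r * \<gamma>) * (norm u)\<^sup>2 + r * \<gamma> * (norm (v s))\<^sup>2"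
      unfolding p_def using r \<gamma> by (intro norm_convex_le) auto
    moreover have "- (2 * \<gamma> * (p \<bullet> W u s)) =
        - 2 * \<gamma> * (1 - r * \<gamma>) * (u \<bullet> W u s) + r * \<gamma>\<^sup>2 * (- 2 * (v s \<bullet> W u s))"
      by (simp add: p_def inner_add_left power2_eq_square algebra_simps)
    moreover have "r * \<gamma>\<^sup>2 * (- 2 * (v s \<bullet> W u s))
        \<le> r * \<gamma>\<^sup>2 * (\<delta> / 2 * (norm (v s))\<^sup>2 + 2 / \<delta> * (norm (W u s))\<^sup>2)"
    proof (rule mult_left_mono)
      have "0 \<le> (norm ((\<delta> / 2) *\<^sub>R v s + W u s))\<^sup>2 * (2 / \<delta>)" using \<delta> by simp
      also have "\<dots> = \<delta> / 2 * (norm (v s))\<^sup>2 + 2 / \<delta> * (norm (W u s))\<^sup>2 + 2 * (v s \<bullet> W u s)"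
        using \<delta> unfolding power2_norm_eq_inner
        by (simp add: inner_add_left inner_add_right inner_commute field_simps)
      finally show "- 2 * (v s \<bullet> W u s) \<le> \<delta> / 2 * (norm (v s))\<^sup>2 + 2 / \<delta> * (norm (W u s))\<^sup>2" by simp
    qed (use r in simp)
    ultimately show ?thesis unfolding h_def by simp
  qed
  have uW: "integrable Mq (\<lambda>s. u \<bullet> W u s)" "(LINT s|Mq. u \<bullet> W u s) = 0"
    using has_bochner_integral_inner_right[of u Mq "W u" 0] W0
    by (auto simp: has_bochner_integral_iff)
  have v2: "integrable Mq (\<lambda>s. (norm (v s))\<^sup>2)" "(LINT s|Mq. (norm (v s))\<^sup>2) \<le> (1 - \<delta>)\<^sup>2 * (norm u)\<^sup>2"
    using V2 by (simp_all add: v_def)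
  have "integral\<^sup>L Mq h = (1 - r * \<gamma>) * (norm u)\<^sup>2 + (r * \<gamma> + r * \<gamma>\<^sup>2 * \<delta> / 2) * (LINT s|Mq. (norm (v s))\<^sup>2)
      + (r * \<gamma>\<^sup>2 * 2 / \<delta> + \<gamma>\<^sup>2) * (LINT s|Mq. (norm (W u s))\<^sup>2)"
    unfolding h_def using uW v2 W2 by (simp add: prob_space algebra_simps)
  also have "\<dots> \<le> (1 - r * \<gamma>) * (norm u)\<^sup>2 + (r * \<gamma> + r * \<gamma>\<^sup>2 * \<delta> / 2) * ((1 - \<delta>)\<^sup>2 * (norm u)\<^sup>2)
      + (r * \<gamma>\<^sup>2 * 2 / \<delta> + \<gamma>\<^sup>2) * \<sigma>\<^sup>2"
    using v2 W2 r \<gamma> \<delta> by (intro add_mono mult_left_mono) auto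
  also have "\<dots> \<le> (1 - r * \<gamma> * \<delta> / 2) * (norm u)\<^sup>2 + \<gamma>\<^sup>2 * (1 + 2 * r / \<delta>) * \<sigma>\<^sup>2"
  proof -
    have "(1 + \<gamma> * \<delta> / 2) * (1 - \<delta>)\<^sup>2 \<le> (1 + \<delta> / 2) * (1 - \<delta>)"
    proof (rule mult_mono)
      show "1 + \<gamma> * \<delta> / 2 \<le> 1 + \<delta> / 2" using \<gamma> \<delta> by (simp add: mult_left_le_one_le)
      show "(1 - \<delta>)\<^sup>2 \<le> 1 - \<delta>" using \<delta> by (simp add: power2_eq_square mult_left_le_one_le)
    qed (use \<delta> in auto)
    also have "\<dots> \<le> 1 - \<delta> / 2" by (simp add: algebra_simps)
    finally have "r * \<gamma> * ((1 + \<gamma> * \<delta> / 2) * (1 - \<delta>)\<^sup>2) \<le> r * \<gamma> * (1 - \<delta> / 2)"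
      using r \<gamma> by (intro mult_left_mono) auto
    moreover have "(r * \<gamma> + r * \<gamma>\<^sup>2 * \<delta> / 2) * k = r * \<gamma> * ((1 + \<gamma> * \<delta> / 2) * k)" for k
      by (simp add: power2_eq_square algebra_simps)
    note this[of "(1 - \<delta>)\<^sup>2"]
    moreover have "r * \<gamma> * (1 - \<delta> / 2) = r * \<gamma> - r * \<gamma> * \<delta> / 2"
      by (simp add: right_diff_distrib)
    ultimately have "(1 - r * \<gamma>) + (r * \<gamma> + r * \<gamma>\<^sup>2 * \<delta> / 2) * (1 - \<delta>)\<^sup>2 \<le> 1 - r * \<gamma> * \<delta> / 2"
      by linarith
    from mult_right_mono[OF this, of "(norm u)\<^sup>2"]
    show ?thesis by (simp add: algebra_simps)
  qed
  finally have int: "integral\<^sup>L Mq h \<le> (1 - r * \<gamma> * \<delta> / 2) * (norm u)\<^sup>2 + \<gamma>\<^sup>2 * (1 + 2 * r / \<delta>) * \<sigma>\<^sup>2" .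
  show ?thesis
  proof (rule nn_integral_le_integralI[OF _ _ _ int])
    show "integrable Mq h" unfolding h_def using uW v2 W2 by auto
    show "0 \<le> h s" if "s \<in> space Mq" for s using le[OF that] zero_le_power2 order_trans by blast
  qed (use le in \<open>auto intro: ennreal_leI\<close>)
qed

section \<open>The drift of the Lyapunov function\<close>

text \<open>
  \<open>M\<close>, \<open>M2\<close> and \<open>M3\<close> are bounds that do not depend on the step sizes as long as \<open>c\<close> stays bounded:
  \<open>M\<close> bounds the coefficients in the squared direction and in the forcing of \<open>hetero\<close>, \<open>M2\<close>
  the effect of the squared direction on consensus and compression errors, and \<open>M3\<close> what is
  left of it once the dual mismatch has been absorbed. The assumption \<open>\<tau>_le\<close> makes the
  feedback loop between consensus and compression errors stable; the two errors have
  comparable rates, so this needs a fixed ratio and not only small step sizes.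
\<close>

locale tuned_problem = consensus_problem E g F L fstar \<rho>min \<rho>max \<rho>t
  for E :: "('n::finite \<times> 'n) set" and g :: "'n \<Rightarrow> real ^ 'd::finite \<Rightarrow> real ^ 'd"
    and F :: "real ^ 'd \<Rightarrow> real" and L fstar \<rho>min \<rho>max \<rho>t :: real +
  fixes \<alpha> \<theta> \<eta> q c M M2 M3 :: real
  assumes pos: "0 < \<alpha>" "0 < \<theta>" "0 < q" "q \<le> 1"
    and \<eta>_eq: "\<eta> = q / (8 * \<rho>t)"
    and c_eq: "c = \<eta> / (\<alpha> * \<theta>)"
    and \<beta>_le: "\<eta> / \<theta> \<le> 1"
    and M_ge: "5 * (1 + L\<^sup>2 + c\<^sup>2) + 12 * (L\<^sup>2 + L ^ 4) \<le> M"
    and M2_eq: "M2 = 8 / \<rho>min + \<rho>max / \<rho>t\<^sup>2"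
    and M3_eq: "M3 = M2 * M * (1 + 2 * M)"
    and \<tau>_le: "\<alpha> * \<theta> * \<rho>t \<le> q / 256 * (\<rho>min / \<rho>max)\<^sup>2"
    and small: "8 * (\<alpha> * \<theta>) * \<rho>t\<^sup>2 \<le> \<rho>min" "\<alpha> * \<theta> * \<rho>min \<le> 1" "6 * L * \<alpha> \<le> 1"
    and large: "8 * M3 \<le> \<rho>min * \<theta>\<^sup>2" "64 * (L\<^sup>2 + 1) * M3 * real CARD('n) \<le> \<rho>min * \<theta>\<^sup>2"
begin

text \<open>
  The weights solve the problem from the inside out: \<open>wB\<close> makes the contraction of the
  compression error, \<open>wB q / 8\<close>, twice its effect \<open>2 \<tau> \<rho>max\<close> on the consensus error; \<open>wD\<close> makes the
  contraction of the dual mismatch twice its effect on these two; and \<open>wF\<close> makes the contraction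
  of the consensus error exceed its effect \<open>\<alpha> L\<^sup>2\<close> on the objective by \<open>\<alpha>\<close>.
\<close>

abbreviation "\<tau> \<equiv> \<alpha> * \<theta>"
abbreviation "wB \<equiv> 32 * \<tau> * \<rho>max / q"
abbreviation "wD \<equiv> 2 * M2 * M / (c * \<theta>)"
abbreviation "wF \<equiv> 8 * (L\<^sup>2 + 1) / (\<theta> * \<rho>min)"
abbreviation "s\<tau> \<equiv> \<tau> * \<rho>min / 4"

lemma \<tau>_pos: "0 < \<tau>" and \<eta>_pos: "0 < \<eta>" and c_pos: "0 < c" and \<rho>max_pos: "0 < \<rho>max"
  using pos rho by (simp_all add: \<eta>_eq c_eq)

lemma ratio_le: "(\<rho>min / \<rho>max)\<^sup>2 \<le> 1" "(\<rho>min / \<rho>max)\<^sup>2 \<le> \<rho>min / \<rho>max"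
proof -
  have "k\<^sup>2 \<le> 1 \<and> k\<^sup>2 \<le> k" if "0 \<le> k" "k \<le> 1" for k :: real
    using that by (auto simp: power2_eq_square mult_le_one mult_left_le_one_le)
  from this[of "\<rho>min / \<rho>max"]
  show "(\<rho>min / \<rho>max)\<^sup>2 \<le> 1" "(\<rho>min / \<rho>max)\<^sup>2 \<le> \<rho>min / \<rho>max"
    using rho by auto
qed

lemma \<tau>_le': "\<tau> * \<rho>t \<le> q / 256"
  using \<tau>_le mult_left_mono[OF ratio_le(1), of "q / 256"] pos by linarith

lemma c_ge: "1 \<le> c"
proof -
  have "8 * (\<tau> * \<rho>t) \<le> q" using \<tau>_le' pos by linarith
  then have "\<tau> \<le> q / (8 * \<rho>t)" using rho by (simp add: field_simps)
  then show ?thesis using \<tau>_pos unfolding c_eq \<eta>_eq by (simp only: le_divide_eq_1_pos)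
qed

lemma constants_pos: "1 \<le> M" "0 < M2" "0 < M3"
proof -
  have "0 \<le> L\<^sup>2" "0 \<le> c\<^sup>2" "0 \<le> L ^ 4" by auto
  then show "1 \<le> M" using M_ge by argo
  moreover show "0 < M2" using rho by (simp add: M2_eq add_pos_nonneg)
  ultimately show "0 < M3" by (simp add: M3_eq)
qed

lemma weights_pos: "0 < wB" "0 < wD" "0 < wF"
proof -
  have "0 < L\<^sup>2 + 1" by (simp add: add_nonneg_pos)
  then show "0 < wB" "0 < wD" "0 < wF"
    using pos \<rho>max_pos c_pos constants_pos rho by simp_all
qed

text \<open>
  In expectation \<open>y2\<close> is at least \<open>\<rho>min x\<close> and \<open>y3\<close> at most \<open>\<rho>max e\<close>. Keeping the two deviations as
  separate terms allows the estimate to be used before expectations are taken.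
\<close>

lemma drift_consensus:
  assumes nn: "0 \<le> x" "0 \<le> e" "0 \<le> \<Gamma>"
    and x': "x' \<le> (1 + s\<tau>) * (x - \<tau> * y2 + \<tau> * y3 + 2 * (\<tau> * \<rho>t)\<^sup>2 * (x + e)) + (1 + 1 / s\<tau>) * \<alpha>\<^sup>2 * \<Gamma>"
  shows "x' \<le> (1 - \<tau> * \<rho>min / 2) * x + 2 * \<tau> * \<rho>max * e + 8 / \<rho>min * (\<alpha> / \<theta>) * \<Gamma>
    - (1 + s\<tau>) * \<tau> * (y2 - \<rho>min * x) + (1 + s\<tau>) * \<tau> * (y3 - \<rho>max * e)"
proof -
  have s: "0 < s\<tau>" "s\<tau> \<le> 1 / 4" using \<tau>_pos rho small by auto
  have t2: "2 * (\<tau> * \<rho>t)\<^sup>2 \<le> s\<tau>"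
  proof -
    have "2 * (\<tau> * \<rho>t)\<^sup>2 = \<tau> * (8 * \<tau> * \<rho>t\<^sup>2) / 4" by (simp add: power2_eq_square)
    also have "\<dots> \<le> \<tau> * \<rho>min / 4" using small \<tau>_pos by (intro divide_right_mono mult_left_mono) auto
    finally show ?thesis .
  qed
  have \<tau>\<rho>: "\<tau> * \<rho>min \<le> \<tau> * \<rho>max" using pos rho by simp
  have a: "(1 + s\<tau>) * (1 - \<tau> * \<rho>min + 2 * (\<tau> * \<rho>t)\<^sup>2) \<le> 1 - \<tau> * \<rho>min / 2"
  proof -
    have "(1 + s\<tau>) * (1 - \<tau> * \<rho>min + 2 * (\<tau> * \<rho>t)\<^sup>2) \<le> (1 + s\<tau>) * (1 - 3 * s\<tau>)"
      using t2 s by (intro mult_left_mono) auto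
    also have "\<dots> = 1 - \<tau> * \<rho>min / 2 - 3 * s\<tau>\<^sup>2" by (simp add: power2_eq_square algebra_simps)
    finally show ?thesis using zero_le_power2[of s\<tau>] by linarith
  qed
  have b: "(1 + s\<tau>) * (\<tau> * \<rho>max + 2 * (\<tau> * \<rho>t)\<^sup>2) \<le> 2 * \<tau> * \<rho>max"
  proof -
    have "(1 + s\<tau>) * (\<tau> * \<rho>max + 2 * (\<tau> * \<rho>t)\<^sup>2) \<le> (1 + 1 / 4) * (5 / 4 * (\<tau> * \<rho>max))"
    proof (rule mult_mono)
      show "\<tau> * \<rho>max + 2 * (\<tau> * \<rho>t)\<^sup>2 \<le> 5 / 4 * (\<tau> * \<rho>max)" using t2 \<tau>\<rho> by linarith
      show "0 \<le> \<tau> * \<rho>max + 2 * (\<tau> * \<rho>t)\<^sup>2" using pos \<rho>max_pos by simp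
    qed (use s in linarith)+
    also have "\<dots> \<le> 2 * (\<tau> * \<rho>max)" using pos \<rho>max_pos by simp
    finally show ?thesis by simp
  qed
  have g: "(1 + 1 / s\<tau>) * \<alpha>\<^sup>2 \<le> 8 / \<rho>min * (\<alpha> / \<theta>)"
  proof -
    have "(1 + 1 / s\<tau>) * \<alpha>\<^sup>2 \<le> (2 / s\<tau>) * \<alpha>\<^sup>2"
      using s by (intro mult_right_mono) (auto simp: field_simps)
    also have "\<dots> = 8 / \<rho>min * (\<alpha> / \<theta>)" using pos rho by (simp add: field_simps power2_eq_square)
    finally show ?thesis .
  qed
  have "(1 + s\<tau>) * (x - \<tau> * y2 + \<tau> * y3 + 2 * (\<tau> * \<rho>t)\<^sup>2 * (x + e)) =
    (1 + s\<tau>) * (1 - \<tau> * \<rho>min + 2 * (\<tau> * \<rho>t)\<^sup>2) * x + (1 + s\<tau>) * (\<tau> * \<rho>max + 2 * (\<tau> * \<rho>t)\<^sup>2) * e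
    - (1 + s\<tau>) * \<tau> * (y2 - \<rho>min * x) + (1 + s\<tau>) * \<tau> * (y3 - \<rho>max * e)"
  proof -
    have "k * (x - t * y2 + t * y3 + w * (x + e)) = k * (1 - t * m + w) * x + k * (t * m' + w) * e
      - k * t * (y2 - m * x) + k * t * (y3 - m' * e)" for k t w m m'
      by (simp add: algebra_simps)
    then show ?thesis .
  qed
  with x' mult_right_mono[OF a nn(1)] mult_right_mono[OF b nn(2)] mult_right_mono[OF g nn(3)]
  show ?thesis by linarith
qed

text \<open>
  The second-order term \<open>(\<tau> \<rho>t)\<^sup>2 / q\<close> is small against \<open>q\<close> by the factor \<open>(\<rho>min / \<rho>max)\<^sup>2\<close>, which
  compensates the ratio \<open>\<rho>max / \<rho>min\<close> that the weight \<open>wB\<close> carries.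
\<close>

lemma drift_compression:
  assumes nn: "0 \<le> x" "0 \<le> e" "0 \<le> \<Gamma>"
    and u: "u \<le> (1 + q / 4) * e + 5 / q * (4 * (\<tau> * \<rho>t)\<^sup>2 * (x + e) + 2 * \<alpha>\<^sup>2 * \<Gamma>)"
  shows "wB * ((1 - q / 2) * u) \<le> wB * e - 4 * \<tau> * \<rho>max * e + \<tau> * \<rho>min / 4 * x
    + \<rho>max / \<rho>t\<^sup>2 * (\<alpha> / \<theta>) * \<Gamma>"
proof -
  let ?k = "20 * (\<tau> * \<rho>t)\<^sup>2 / q"
  have k0: "0 \<le> ?k" using pos by simp
  have sq: "(\<tau> * \<rho>t)\<^sup>2 \<le> (q / 256)\<^sup>2 * (\<rho>min / \<rho>max)\<^sup>2"
  proof -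
    have "(\<tau> * \<rho>t)\<^sup>2 \<le> (q / 256 * (\<rho>min / \<rho>max)\<^sup>2)\<^sup>2"
      using \<tau>_pos rho by (intro power_mono \<tau>_le) auto
    also have "\<dots> = (q / 256)\<^sup>2 * ((\<rho>min / \<rho>max)\<^sup>2 * (\<rho>min / \<rho>max)\<^sup>2)"
      by (simp only: power_mult_distrib power2_eq_square[of "(\<rho>min / \<rho>max)\<^sup>2"])
    also have "\<dots> \<le> (q / 256)\<^sup>2 * (1 * (\<rho>min / \<rho>max)\<^sup>2)"
      using ratio_le by (intro mult_left_mono mult_right_mono) auto
    finally show ?thesis by simp
  qed
  have k1: "?k \<le> q / 2048 * (\<rho>min / \<rho>max)\<^sup>2"
  proof -
    have "?k \<le> 20 * ((q / 256)\<^sup>2 * (\<rho>min / \<rho>max)\<^sup>2) / q"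
      using sq pos by (intro divide_right_mono mult_left_mono) auto
    also have "\<dots> = 20 / 65536 * q * (\<rho>min / \<rho>max)\<^sup>2" using pos by (simp add: power2_eq_square)
    also have "\<dots> \<le> q / 2048 * (\<rho>min / \<rho>max)\<^sup>2" using pos by (intro mult_right_mono) auto
    finally show ?thesis .
  qed
  have k2: "?k \<le> q / 2048"
    using k1 mult_left_mono[OF ratio_le(1), of "q / 2048"] pos by linarith
  have a: "wB * ((1 - q / 2) * (1 + q / 4 + ?k)) \<le> wB - 4 * \<tau> * \<rho>max"
  proof -
    have "(1 - q / 2) * (1 + q / 4 + ?k) \<le> (1 - q / 2) * (1 + q / 4 + q / 2048)"
      using k2 pos by (intro mult_left_mono) auto
    also have "\<dots> \<le> 1 - q / 8"
    proof -
      have "0 \<le> q * q" using pos by simp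
      then show ?thesis using pos by (simp add: algebra_simps)
    qed
    finally have "wB * ((1 - q / 2) * (1 + q / 4 + ?k)) \<le> wB * (1 - q / 8)"
      using weights_pos by (intro mult_left_mono) auto
    also have "\<dots> = wB - 4 * \<tau> * \<rho>max" using pos by (simp add: field_simps)
    finally show ?thesis .
  qed
  have b: "wB * ((1 - q / 2) * ?k) \<le> \<tau> * \<rho>min / 4"
  proof -
    have "wB * ((1 - q / 2) * ?k) \<le> wB * (1 * (q / 2048 * (\<rho>min / \<rho>max)\<^sup>2))"
      using k0 k1 pos weights_pos by (intro mult_left_mono mult_mono) auto
    also have "\<dots> = \<tau> * \<rho>max / 64 * (\<rho>min / \<rho>max)\<^sup>2" using pos by simp
    also have "\<dots> \<le> \<tau> * \<rho>max / 64 * (\<rho>min / \<rho>max)"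
      using ratio_le \<tau>_pos \<rho>max_pos by (intro mult_left_mono) auto
    also have "\<dots> = \<tau> * \<rho>min / 64" using \<rho>max_pos by simp
    also have "\<dots> \<le> \<tau> * \<rho>min / 4" using pos rho by simp
    finally show ?thesis .
  qed
  have d: "wB * ((1 - q / 2) * (10 / q * \<alpha>\<^sup>2)) \<le> \<rho>max / \<rho>t\<^sup>2 * (\<alpha> / \<theta>)"
  proof -
    have "wB * ((1 - q / 2) * (10 / q * \<alpha>\<^sup>2)) \<le> wB * (1 * (10 / q * \<alpha>\<^sup>2))"
      using pos weights_pos by (intro mult_left_mono mult_right_mono) auto
    also have "\<dots> = 320 * (\<rho>max / \<rho>t\<^sup>2) * (\<alpha> / \<theta>) * ((\<tau> * \<rho>t)\<^sup>2 / q\<^sup>2)"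
      using pos rho by (simp add: field_simps power2_eq_square)
    also have "\<dots> \<le> 320 * (\<rho>max / \<rho>t\<^sup>2) * (\<alpha> / \<theta>) * ((q / 256)\<^sup>2 / q\<^sup>2)"
      using pos rho \<tau>_pos \<rho>max_pos by (intro mult_left_mono divide_right_mono power_mono \<tau>_le') auto
    also have "\<dots> = 320 / 65536 * (\<rho>max / \<rho>t\<^sup>2 * (\<alpha> / \<theta>))"
      using pos by (simp add: power_divide mult_ac)
    also have "\<dots> \<le> 1 * (\<rho>max / \<rho>t\<^sup>2 * (\<alpha> / \<theta>))"
      using pos \<rho>max_pos by (intro mult_right_mono) auto
    finally show ?thesis by simp
  qed
  have "wB * ((1 - q / 2) * u) \<le> wB * ((1 - q / 2) * ((1 + q / 4) * e + 5 / q * (4 * (\<tau> * \<rho>t)\<^sup>2 * (x + e) + 2 * \<alpha>\<^sup>2 * \<Gamma>)))"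
    using u pos weights_pos by (intro mult_left_mono) auto
  also have "\<dots> = wB * ((1 - q / 2) * (1 + q / 4 + ?k)) * e + wB * ((1 - q / 2) * ?k) * x
      + wB * ((1 - q / 2) * (10 / q * \<alpha>\<^sup>2)) * \<Gamma>"
  proof -
    have "(1 + q / 4) * e + 5 / q * (4 * (\<tau> * \<rho>t)\<^sup>2 * (x + e) + 2 * \<alpha>\<^sup>2 * \<Gamma>)
      = (1 + q / 4 + ?k) * e + ?k * x + (10 / q * \<alpha>\<^sup>2) * \<Gamma>"
      using pos by (simp add: field_simps)
    moreover have "b * (p * (k1 * e + k2 * x + k3 * \<Gamma>)) = b * (p * k1) * e + b * (p * k2) * x + b * (p * k3) * \<Gamma>"
      for b p k1 k2 k3 by (simp add: algebra_simps)
    ultimately show ?thesis by (simp only:)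
  qed
  also have "\<dots> \<le> (wB - 4 * \<tau> * \<rho>max) * e + \<tau> * \<rho>min / 4 * x + \<rho>max / \<rho>t\<^sup>2 * (\<alpha> / \<theta>) * \<Gamma>"
    by (intro add_mono mult_right_mono a b d nn)
  finally show ?thesis by (simp add: left_diff_distrib)
qed

lemma drift_hetero:
  assumes nn: "0 \<le> x" "0 \<le> y1" "0 \<le> G"
    and h: "h' \<le> (1 - \<eta> / \<theta>) * h + \<eta> / \<theta> * (4 * ((L\<^sup>2 + c\<^sup>2) * x + y1
      + 3 * L\<^sup>2 / c\<^sup>2 * (y1 + L\<^sup>2 * x + real CARD('n) * G)))"
  shows "wD * h' \<le> wD * h - 2 * M2 * M * (\<alpha> / \<theta>) * h
    + 2 * M2 * M * (\<alpha> / \<theta>) * (M * (y1 + x + real CARD('n) * G))"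
proof -
  let ?G = "real CARD('n) * G"
  have G: "0 \<le> ?G" using nn by simp
  have "3 * L\<^sup>2 / c\<^sup>2 \<le> 3 * L\<^sup>2"
    using c_ge by (intro divide_le_eq[THEN iffD2]) (auto simp: mult_le_cancel_left1 one_le_power)
  then have "3 * L\<^sup>2 / c\<^sup>2 * (y1 + L\<^sup>2 * x + ?G) \<le> 3 * L\<^sup>2 * (y1 + L\<^sup>2 * x + ?G)"
    using nn by (intro mult_right_mono) auto
  then have "4 * ((L\<^sup>2 + c\<^sup>2) * x + y1 + 3 * L\<^sup>2 / c\<^sup>2 * (y1 + L\<^sup>2 * x + ?G))
      \<le> 4 * ((L\<^sup>2 + c\<^sup>2) * x + y1 + 3 * L\<^sup>2 * (y1 + L\<^sup>2 * x + ?G))"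
    by (intro mult_left_mono add_left_mono) auto
  also have "4 * ((L\<^sup>2 + c\<^sup>2) * x + y1 + 3 * L\<^sup>2 * (y1 + L\<^sup>2 * x + ?G))
      = (4 * (L\<^sup>2 + c\<^sup>2) + 12 * L ^ 4) * x + (4 + 12 * L\<^sup>2) * y1 + 12 * L\<^sup>2 * ?G"
    by (simp add: algebra_simps power_numeral_reduce power2_eq_square)
  also have "\<dots> \<le> M * x + M * y1 + M * ?G"
  proof (intro add_mono mult_right_mono nn G)
    have "0 \<le> L\<^sup>2" "0 \<le> c\<^sup>2" "0 \<le> L ^ 4" by auto
    then show "4 * (L\<^sup>2 + c\<^sup>2) + 12 * L ^ 4 \<le> M" "4 + 12 * L\<^sup>2 \<le> M" "12 * L\<^sup>2 \<le> M"
      using M_ge by argo+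
  qed
  finally have "\<eta> / \<theta> * (4 * ((L\<^sup>2 + c\<^sup>2) * x + y1 + 3 * L\<^sup>2 / c\<^sup>2 * (y1 + L\<^sup>2 * x + ?G)))
      \<le> \<eta> / \<theta> * (M * x + M * y1 + M * ?G)"
    using \<eta>_pos pos by (intro mult_left_mono) auto
  with h have "h' \<le> h + \<eta> / \<theta> * (M * (y1 + x + ?G) - h)"
    by (simp add: algebra_simps)
  then have "wD * h' \<le> wD * (h + \<eta> / \<theta> * (M * (y1 + x + ?G) - h))"
    using weights_pos by (intro mult_left_mono) auto
  also have "\<dots> = wD * h + wD * (\<eta> / \<theta>) * (M * (y1 + x + ?G) - h)"
    by (simp only: distrib_left mult.assoc)
  also have "wD * (\<eta> / \<theta>) = 2 * M2 * M * (\<alpha> / \<theta>)"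
    using pos \<eta>_pos by (simp add: c_eq)
  finally show ?thesis by (simp only: right_diff_distrib)
qed

lemma drift_objective:
  assumes nn: "0 \<le> x" "0 \<le> y1" "0 \<le> G"
    and f: "f' \<le> f - y4 - \<alpha> / 2 * G + \<alpha> * L\<^sup>2 / (2 * real CARD('n)) * x
      + 3 * L * \<alpha>\<^sup>2 / 2 * (y1 / real CARD('n) + L\<^sup>2 * x / real CARD('n) + G)"
  shows "f' \<le> f - y4 - \<alpha> / 4 * G + \<alpha> * L\<^sup>2 * x + 3 * L * \<alpha>\<^sup>2 / 2 * y1"
proof -
  let ?n = "real CARD('n)"
  have n: "1 \<le> ?n" by (simp add: Suc_leI)
  have le: "y / ?n \<le> y" if "0 \<le> y" for y using that n by (simp add: divide_le_eq mult_le_cancel_left1)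
  have k: "3 * L * \<alpha>\<^sup>2 / 2 \<le> \<alpha> / 4" "0 \<le> 3 * L * \<alpha>\<^sup>2 / 2"
    using mult_right_mono[OF small(3), of \<alpha>] pos L_nonneg by (simp_all add: power2_eq_square mult.assoc)
  have x: "0 \<le> L\<^sup>2 * x" using nn by simp
  have "\<alpha> * L\<^sup>2 / (2 * ?n) * x = \<alpha> / 2 * (L\<^sup>2 * x / ?n)" by simp
  also have "\<dots> \<le> \<alpha> / 2 * (L\<^sup>2 * x)" using le[OF x] pos by (intro mult_left_mono) auto
  finally have 1: "\<alpha> * L\<^sup>2 / (2 * ?n) * x \<le> \<alpha> / 2 * (L\<^sup>2 * x)" .
  have "3 * L * \<alpha>\<^sup>2 / 2 * (y1 / ?n + L\<^sup>2 * x / ?n + G) \<le> 3 * L * \<alpha>\<^sup>2 / 2 * (y1 + L\<^sup>2 * x + G)"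
    using le[OF x] le[OF nn(2)] k by (intro mult_left_mono add_mono) auto
  also have "\<dots> = 3 * L * \<alpha>\<^sup>2 / 2 * y1 + 3 * L * \<alpha>\<^sup>2 / 2 * (L\<^sup>2 * x) + 3 * L * \<alpha>\<^sup>2 / 2 * G"
    by (simp add: distrib_left)
  also have "\<dots> \<le> 3 * L * \<alpha>\<^sup>2 / 2 * y1 + \<alpha> / 4 * (L\<^sup>2 * x) + \<alpha> / 4 * G"
    using mult_right_mono[OF k(1) x] mult_right_mono[OF k(1) nn(3)] by (intro add_mono order_refl)
  finally have 2: "3 * L * \<alpha>\<^sup>2 / 2 * (y1 / ?n + L\<^sup>2 * x / ?n + G)
    \<le> 3 * L * \<alpha>\<^sup>2 / 2 * y1 + \<alpha> / 4 * (L\<^sup>2 * x) + \<alpha> / 4 * G" .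
  have "f' \<le> f - y4 - \<alpha> / 2 * G + \<alpha> / 2 * (L\<^sup>2 * x)
      + (3 * L * \<alpha>\<^sup>2 / 2 * y1 + \<alpha> / 4 * (L\<^sup>2 * x) + \<alpha> / 4 * G)"
    using f 1 2 by linarith
  moreover have "0 \<le> \<alpha> * (L\<^sup>2 * x)" using x pos by simp
  ultimately show ?thesis by (simp add: algebra_simps)
qed

text \<open>
  The effects that run against the order of the weights, of the consensus error on the dual
  mismatch and of the gradient on both, carry the factor \<open>\<alpha> / \<theta> = \<tau> / \<theta>\<^sup>2\<close>; largeness of \<open>\<theta>\<close> absorbs them.
\<close>

lemma drift_combined:
  assumes nn: "0 \<le> x" "0 \<le> e" "0 \<le> h" "0 \<le> y1" "0 \<le> G"
    and \<Gamma>: "0 \<le> \<Gamma>" "\<Gamma> \<le> 5 * (y1 + (L\<^sup>2 + c\<^sup>2) * x + h + real CARD('n) * G)"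
    and x': "x' \<le> (1 + s\<tau>) * (x - \<tau> * y2 + \<tau> * y3 + 2 * (\<tau> * \<rho>t)\<^sup>2 * (x + e)) + (1 + 1 / s\<tau>) * \<alpha>\<^sup>2 * \<Gamma>"
    and u: "u \<le> (1 + q / 4) * e + 5 / q * (4 * (\<tau> * \<rho>t)\<^sup>2 * (x + e) + 2 * \<alpha>\<^sup>2 * \<Gamma>)"
    and h': "h' \<le> (1 - \<eta> / \<theta>) * h + \<eta> / \<theta> * (4 * ((L\<^sup>2 + c\<^sup>2) * x + y1
      + 3 * L\<^sup>2 / c\<^sup>2 * (y1 + L\<^sup>2 * x + real CARD('n) * G)))"
    and f': "f' \<le> f - y4 - \<alpha> / 2 * G + \<alpha> * L\<^sup>2 / (2 * real CARD('n)) * x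
      + 3 * L * \<alpha>\<^sup>2 / 2 * (y1 / real CARD('n) + L\<^sup>2 * x / real CARD('n) + G)"
  shows "f' + wF * (x' + wB * ((1 - q / 2) * u) + wD * h')
    \<le> f + wF * (x + wB * e + wD * h) - \<alpha> / 8 * G - \<alpha> * x
      + (3 * L * \<alpha>\<^sup>2 / 2 + wF * (\<alpha> / \<theta>) * M3) * y1 - y4
      - wF * (1 + s\<tau>) * \<tau> * (y2 - \<rho>min * x) + wF * (1 + s\<tau>) * \<tau> * (y3 - \<rho>max * e)"
proof -
  let ?G = "real CARD('n) * G" and ?a = "\<alpha> / \<theta>"
  have a: "0 < ?a" using pos by simp
  have G: "0 \<le> ?G" using nn by simp
  have "\<Gamma> \<le> M * (y1 + x + h + ?G)"
  proof -
    have "0 \<le> L\<^sup>2" "0 \<le> c\<^sup>2" "0 \<le> L ^ 4" by auto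
    then have "5 * (L\<^sup>2 + c\<^sup>2) \<le> M" "5 \<le> M" using M_ge by argo+
    then have "5 * (L\<^sup>2 + c\<^sup>2) * x + 5 * y1 + 5 * h + 5 * ?G \<le> M * x + M * y1 + M * h + M * ?G"
      using nn G by (intro add_mono mult_right_mono) auto
    moreover have "5 * (y1 + (L\<^sup>2 + c\<^sup>2) * x + h + ?G) = 5 * (L\<^sup>2 + c\<^sup>2) * x + 5 * y1 + 5 * h + 5 * ?G"
      "M * (y1 + x + h + ?G) = M * x + M * y1 + M * h + M * ?G"
      by (simp_all add: algebra_simps)
    ultimately show ?thesis using \<Gamma>(2) by linarith
  qed
  then have "?a * M2 * \<Gamma> \<le> ?a * M2 * (M * (y1 + x + h + ?G))"
    using pos constants_pos by (intro mult_left_mono) auto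
  moreover have "8 / \<rho>min * ?a * \<Gamma> + \<rho>max / \<rho>t\<^sup>2 * ?a * \<Gamma> = ?a * M2 * \<Gamma>"
    by (simp add: M2_eq algebra_simps)
  ultimately have g: "8 / \<rho>min * ?a * \<Gamma> + \<rho>max / \<rho>t\<^sup>2 * ?a * \<Gamma> \<le> ?a * M2 * (M * (y1 + x + h + ?G))"
    by simp
  have "x' + wB * ((1 - q / 2) * u) + wD * h' \<le> (x + wB * e + wD * h) - \<tau> * \<rho>min / 4 * x
      + (?a * M2 * (M * (y1 + x + h + ?G)) - 2 * M2 * M * ?a * h + 2 * M2 * M * ?a * (M * (y1 + x + ?G)))
      - (1 + s\<tau>) * \<tau> * (y2 - \<rho>min * x) + (1 + s\<tau>) * \<tau> * (y3 - \<rho>max * e)"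
  proof -
    have "0 \<le> \<tau> * \<rho>max * e" using \<tau>_pos \<rho>max_pos nn by simp
    moreover have "(1 - \<tau> * \<rho>min / 2) * x = x - 2 * (\<tau> * \<rho>min / 4 * x)" by (simp add: left_diff_distrib)
    ultimately show ?thesis
      using drift_consensus[OF nn(1,2) \<Gamma>(1) x'] drift_compression[OF nn(1,2) \<Gamma>(1) u]
        drift_hetero[OF nn(1,4,5) h'] g by linarith
  qed
  also have "?a * M2 * (M * (y1 + x + h + ?G)) - 2 * M2 * M * ?a * h + 2 * M2 * M * ?a * (M * (y1 + x + ?G))
    \<le> ?a * M3 * (y1 + x + ?G)"
  proof -
    have "?a * M2 * (M * (y1 + x + h + ?G)) - 2 * M2 * M * ?a * h + 2 * M2 * M * ?a * (M * (y1 + x + ?G))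
      = ?a * M3 * (y1 + x + ?G) - M2 * M * ?a * h"
      unfolding M3_eq by (simp only: distrib_left distrib_right mult_ac) simp
    moreover have "0 \<le> M2 * M * ?a * h" using pos constants_pos nn by simp
    ultimately show ?thesis by linarith
  qed
  also have "?a * M3 * (y1 + x + ?G) \<le> ?a * M3 * y1 + \<tau> * \<rho>min / 8 * x + ?a * M3 * ?G"
  proof -
    have "?a * M3 = \<alpha> / (8 * \<theta>) * (8 * M3)" by simp
    also have "\<dots> \<le> \<alpha> / (8 * \<theta>) * (\<rho>min * \<theta>\<^sup>2)" using pos by (intro mult_left_mono large) auto
    also have "\<dots> = \<tau> * \<rho>min / 8" using pos by (simp add: power2_eq_square)
    finally have "?a * M3 \<le> \<tau> * \<rho>min / 8" .
    from mult_right_mono[OF this nn(1)] show ?thesis by (simp only: distrib_left)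
  qed
  finally have "x' + wB * ((1 - q / 2) * u) + wD * h' \<le> (x + wB * e + wD * h) - \<tau> * \<rho>min / 8 * x
      + ?a * M3 * y1 + ?a * M3 * ?G
      - (1 + s\<tau>) * \<tau> * (y2 - \<rho>min * x) + (1 + s\<tau>) * \<tau> * (y3 - \<rho>max * e)"
    by linarith
  from mult_left_mono[OF this less_imp_le[OF weights_pos(3)]]
  have "wF * (x' + wB * ((1 - q / 2) * u) + wD * h') \<le> wF * ((x + wB * e + wD * h) - \<tau> * \<rho>min / 8 * x
      + ?a * M3 * y1 + ?a * M3 * ?G
      - (1 + s\<tau>) * \<tau> * (y2 - \<rho>min * x) + (1 + s\<tau>) * \<tau> * (y3 - \<rho>max * e))" .
  also have "\<dots> = wF * (x + wB * e + wD * h)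
      - wF * (\<tau> * \<rho>min / 8) * x + wF * ?a * M3 * y1 + wF * ?a * M3 * ?G
      - wF * (1 + s\<tau>) * \<tau> * (y2 - \<rho>min * x) + wF * (1 + s\<tau>) * \<tau> * (y3 - \<rho>max * e)"
  proof -
    have "w * (b - k1 * x + a * m * y1 + a * m * z - s * t * u + s * t * v)
      = w * b - w * k1 * x + w * a * m * y1 + w * a * m * z - w * s * t * u + w * s * t * v"
      for w b k1 a m z s t u v by (simp add: algebra_simps)
    then show ?thesis .
  qed
  finally have "wF * (x' + wB * ((1 - q / 2) * u) + wD * h') \<le> \<dots>" .
  moreover have "wF * (\<tau> * \<rho>min / 8) * x = \<alpha> * L\<^sup>2 * x + \<alpha> * x"
  proof -
    have "wF * (\<tau> * \<rho>min / 8) = \<alpha> * (L\<^sup>2 + 1)" using pos rho by simp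
    then show ?thesis by (simp only:) (simp add: algebra_simps)
  qed
  moreover have "wF * ?a * M3 * ?G \<le> \<alpha> / 8 * G"
  proof -
    have "wF * ?a * M3 * ?G = \<alpha> / (8 * (\<rho>min * \<theta>\<^sup>2)) * (64 * (L\<^sup>2 + 1) * M3 * real CARD('n)) * G"
      using pos rho by (simp add: field_simps power2_eq_square)
    also have "\<dots> \<le> \<alpha> / (8 * (\<rho>min * \<theta>\<^sup>2)) * (\<rho>min * \<theta>\<^sup>2) * G"
      using pos rho nn by (intro mult_right_mono mult_left_mono large) auto
    also have "\<dots> = \<alpha> / 8 * G" using pos rho by simp
    finally show ?thesis .
  qed
  moreover note drift_objective[OF nn(1,4,5) f']
  moreover have "(3 * L * \<alpha>\<^sup>2 / 2 + wF * ?a * M3) * y1 = 3 * L * \<alpha>\<^sup>2 / 2 * y1 + wF * ?a * M3 * y1"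
    by (rule distrib_right)
  ultimately show ?thesis by linarith
qed

end

section \<open>One step in expectation\<close>

text \<open>
  Linearity in the edge matrix is what turns the mean of the random quadratic form into the
  quadratic form of the mean selector.
\<close>

lemma linear_sqnorm_laplacian: "linear (\<lambda>D. sqnorm (laplacian E D) X)"
proof -
  have "sqnorm (laplacian E D) X =
    (\<Sum>e\<in>UNIV. \<Sum>e'\<in>UNIV. D $ e $ e' * (kron_id (incidence E) X $ e \<bullet> kron_id (incidence E) X $ e'))" for D
    unfolding sqnorm_def inner_laplacian
    by (simp add: inner_vec_def[of "kron_id _ _"] kron_id_def[of D] inner_sum_right)
  then show ?thesis
    by (simp add: linear_iff distrib_right sum.distrib sum_distrib_left mult.assoc)
qed

lemma integral_sqnorm_selector:
  fixes act :: "'c \<Rightarrow> ('n::finite \<times> 'n) set"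
  assumes "prob_space N" and meas: "(\<lambda>s. selector (act s)) \<in> borel_measurable N"
  shows "integrable N (\<lambda>s. sqnorm (laplacian E (selector (act s))) X)"
    "(LINT s|N. sqnorm (laplacian E (selector (act s))) X)
      = sqnorm (laplacian E (LINT s|N. selector (act s))) X"
proof -
  interpret prob_space N by fact
  define b where "b = Max (norm ` range (selector :: ('n \<times> 'n) set \<Rightarrow> _))"
  have "norm (selector S :: real ^ ('n \<times> 'n) ^ ('n \<times> 'n)) \<le> b" for S
    unfolding b_def by (intro Max_ge) auto
  then have int: "integrable N (\<lambda>s. selector (act s))"
    using meas by (intro integrable_const_bound[where B = b]) auto
  have bl: "bounded_linear (\<lambda>D. sqnorm (laplacian E D) X)"
    using linear_sqnorm_laplacian by (simp add: linear_conv_bounded_linear)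
  show "integrable N (\<lambda>s. sqnorm (laplacian E (selector (act s))) X)"
    using integrable_bounded_linear[OF bl int] .
  show "(LINT s|N. sqnorm (laplacian E (selector (act s))) X)
      = sqnorm (laplacian E (LINT s|N. selector (act s))) X"
    using integral_bounded_linear[OF bl int] .
qed

lemma nn_integral_affine_le:
  fixes f :: "'a \<Rightarrow> real"
  assumes "prob_space N" "f \<in> borel_measurable N" "\<And>x. 0 \<le> f x" "0 \<le> A" "0 \<le> k" "0 \<le> b"
    "(\<integral>\<^sup>+x. ennreal (f x) \<partial>N) \<le> ennreal b"
  shows "(\<integral>\<^sup>+x. ennreal (A + k * f x) \<partial>N) \<le> ennreal (A + k * b)"
proof -
  interpret prob_space N by fact
  have "(\<integral>\<^sup>+x. ennreal (A + k * f x) \<partial>N) = (\<integral>\<^sup>+x. ennreal A + ennreal k * ennreal (f x) \<partial>N)"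
    using assms by (simp add: ennreal_plus ennreal_mult)
  also have "\<dots> = ennreal A + ennreal k * (\<integral>\<^sup>+x. ennreal (f x) \<partial>N)"
    using assms by (simp add: nn_integral_add nn_integral_cmult emeasure_space_1)
  also have "\<dots> \<le> ennreal A + ennreal k * ennreal b"
    using assms by (intro add_left_mono mult_left_mono) auto
  also have "\<dots> = ennreal (A + k * b)"
    using assms by (simp add: ennreal_plus ennreal_mult)
  finally show ?thesis .
qed

definition ticopd_step ::
  "('n::finite \<Rightarrow> real ^ 'd::finite \<Rightarrow> 'b \<Rightarrow> real) \<Rightarrow> ('n \<times> 'n) set \<Rightarrow> ('c \<Rightarrow> ('n \<times> 'n) set) \<Rightarrow>
   ((real ^ 'd) ^ 'n \<Rightarrow> 'q \<Rightarrow> (real ^ 'd) ^ 'n) \<Rightarrow> real \<Rightarrow> real \<Rightarrow> real \<Rightarrow> real \<Rightarrow>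
   (((real ^ 'd) ^ 'n) \<times> ((real ^ 'd) ^ 'n) \<times> ((real ^ 'd) ^ 'n)) \<Rightarrow> (('n \<Rightarrow> 'b) \<times> 'c) \<times> 'q \<Rightarrow>
   (((real ^ 'd) ^ 'n) \<times> ((real ^ 'd) ^ 'n) \<times> ((real ^ 'd) ^ 'n))" where
  "ticopd_step fs E act Q \<alpha> \<theta> \<eta> \<gamma> u b =
     (case u of (X, lt, Xh) \<Rightarrow> case b of ((xi, a), s) \<Rightarrow>
        let D = kron_id (laplacian E (selector (act a))) Xh;
            X' = X - \<alpha> *\<^sub>R (stoch_grad fs X xi + lt + \<theta> *\<^sub>R D)
        in (X', lt + \<eta> *\<^sub>R D, Xh + \<gamma> *\<^sub>R Q (X' - Xh) s))"

lemma average_ticopd_step: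
  "average (fst (snd (ticopd_step fs E act Q \<alpha> \<theta> \<eta> \<gamma> u b))) = average (fst (snd u))"
  by (simp add: ticopd_step_def Let_def average_linear average_laplacian split: prod.split)

locale stochastic_problem = consensus_problem E g F L fstar \<rho>min \<rho>max \<rho>t
  for E :: "('n::finite \<times> 'n) set" and g :: "'n \<Rightarrow> real ^ 'd::finite \<Rightarrow> real ^ 'd"
    and F :: "real ^ 'd \<Rightarrow> real" and L fstar \<rho>min \<rho>max \<rho>t :: real +
  fixes P :: "'n \<Rightarrow> 'b measure" and Pa :: "'c measure" and act :: "'c \<Rightarrow> ('n \<times> 'n) set"
    and R :: "real ^ ('n \<times> 'n) ^ ('n \<times> 'n)"
    and fs :: "'n \<Rightarrow> real ^ 'd \<Rightarrow> 'b \<Rightarrow> real" and \<sigma> :: "'n \<Rightarrow> real"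
    and \<delta> r :: real
  assumes sample_law: "\<And>i. prob_space (P i)" and edge_law: "prob_space Pa"
    and active: "(\<lambda>s. selector (act s)) \<in> borel_measurable Pa" "\<And>s. s \<in> space Pa \<Longrightarrow> act s \<subseteq> E"
    and R_eq: "R = (LINT s|Pa. selector (act s))"
    and fs_meas: "\<And>i. (\<lambda>(x, s). grad (\<lambda>y. fs i y s) x) \<in> borel_measurable (borel \<Otimes>\<^sub>M P i)"
    and unbiased: "\<And>i x. has_bochner_integral (P i) (\<lambda>s. grad (\<lambda>y. fs i y s) x) (g i x)"
    and var_int: "\<And>i y. integrable (P i) (\<lambda>s. (norm (grad (\<lambda>z. fs i z s) y - g i y))\<^sup>2)"
    and var: "\<And>i y. (LINT s|P i. (norm (grad (\<lambda>z. fs i z s) y - g i y))\<^sup>2) \<le> (\<sigma> i)\<^sup>2"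
    and spec_R: "\<And>X :: (real ^ 'd) ^ 'n. \<rho>min * sqnorm centering X \<le> sqnorm (laplacian E R) X"
      "\<And>X :: (real ^ 'd) ^ 'n. sqnorm (laplacian E R) X \<le> \<rho>max * sqnorm centering X"
    and contraction: "0 < \<delta>" "\<delta> \<le> 1" "0 < r"

locale sampled_problem = tuned_problem E g F L fstar \<rho>min \<rho>max \<rho>t \<alpha> \<theta> \<eta> q c M M2 M3
    + stochastic_problem E g F L fstar \<rho>min \<rho>max \<rho>t P Pa act R fs \<sigma> \<delta> r
  for E :: "('n::finite \<times> 'n) set" and g :: "'n \<Rightarrow> real ^ 'd::finite \<Rightarrow> real ^ 'd"
    and F :: "real ^ 'd \<Rightarrow> real" and L fstar \<rho>min \<rho>max \<rho>t \<alpha> \<theta> \<eta> q c M M2 M3 :: real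
    and P :: "'n \<Rightarrow> 'b measure" and Pa :: "'c measure" and act :: "'c \<Rightarrow> ('n \<times> 'n) set"
    and R :: "real ^ ('n \<times> 'n) ^ ('n \<times> 'n)"
    and fs :: "'n \<Rightarrow> real ^ 'd \<Rightarrow> 'b \<Rightarrow> real" and \<sigma> :: "'n \<Rightarrow> real"
    and \<delta> r :: real +
  fixes \<gamma> :: real
  assumes \<gamma>: "0 < \<gamma>" "\<gamma> \<le> 1" "r * \<gamma> \<le> 1"
    and q_eq: "q = r * \<gamma> * \<delta>"
begin

lemmas compr = contraction \<gamma>

definition S2 :: real where "S2 = (\<Sum>i\<in>UNIV. (\<sigma> i)\<^sup>2)"

definition lyapunov :: "((real ^ 'd) ^ 'n) \<times> ((real ^ 'd) ^ 'n) \<times> ((real ^ 'd) ^ 'n) \<Rightarrow> real" where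
  "lyapunov = (\<lambda>(X, lt, Xh). F (average X) - fstar
     + wF * ((norm (centered X))\<^sup>2 + wB * (norm (X - Xh))\<^sup>2 + wD * (norm (hetero c X lt))\<^sup>2))"

definition residual :: "(real ^ 'd) ^ 'n \<Rightarrow> real" where
  "residual X = \<alpha> / 8 * (norm (grad F (average X)))\<^sup>2 + \<alpha> * (norm (centered X))\<^sup>2"

definition noise_level :: "real \<Rightarrow> real" where
  "noise_level \<sigma>\<xi> = (3 * L * \<alpha>\<^sup>2 / 2 + wF * (\<alpha> / \<theta>) * M3) * S2
     + wF * wB * (\<gamma>\<^sup>2 * (1 + 2 * r / \<delta>) * \<sigma>\<xi>\<^sup>2)"

lemma lyapunov_nonneg: "0 \<le> lyapunov u"
proof (cases u)
  case (fields X lt Xh)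
  show ?thesis
    unfolding fields lyapunov_def prod.case using F_lower[of "average X"]
    by (intro add_nonneg_nonneg mult_nonneg_nonneg less_imp_le[OF weights_pos(1)]
        less_imp_le[OF weights_pos(2)] less_imp_le[OF weights_pos(3)] zero_le_power2) simp
qed

lemma residual_nonneg: "0 \<le> residual X"
  using pos by (simp add: residual_def)

lemma noise_level_nonneg: "0 \<le> noise_level \<sigma>\<xi>"
  using weights_pos pos L_nonneg constants_pos compr unfolding noise_level_def S2_def
  by (intro add_nonneg_nonneg mult_nonneg_nonneg sum_nonneg) auto

text \<open>
  The compressor randomness is integrated first, for a fixed realisation of the other samples.
  The resulting bound is affine in the squared gradient noise, in one inner product with the
  gradient noise, and in the quadratic forms of the random Laplacian. Each of these depends on one
  marginal law only, so gradient and edge samples may be dependent.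
\<close>

lemma one_step_drift:
  fixes Q :: "(real ^ 'd) ^ 'n \<Rightarrow> 'q \<Rightarrow> (real ^ 'd) ^ 'n"
  assumes N: "prob_space N" "sets N = sets (PiM UNIV P \<Otimes>\<^sub>M Pa)"
      "\<And>i. distr N (P i) (\<lambda>z. fst z i) = P i" "distr N Pa snd = Pa"
    and Q: "noisy_compressor \<delta> r \<sigma>\<xi> Mq Q"
    and avg: "average lt = 0"
  shows "(\<integral>\<^sup>+z. \<integral>\<^sup>+s. ennreal (lyapunov (ticopd_step fs E act Q \<alpha> \<theta> \<eta> \<gamma> (X, lt, Xh) (z, s))) \<partial>Mq \<partial>N)
      + ennreal (residual X) \<le> ennreal (lyapunov (X, lt, Xh) + noise_level \<sigma>\<xi>)"
proof -
  interpret N: prob_space N by fact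
  interpret Mq: prob_space Mq using Q by (simp add: noisy_compressor_def)
  define \<zeta> where "\<zeta> z = stoch_grad fs X (fst z) - gradF X" for z :: "('n \<Rightarrow> 'b) \<times> 'c"
  define y2 where "y2 z = sqnorm (laplacian E (selector (act (snd z)))) X" for z :: "('n \<Rightarrow> 'b) \<times> 'c"
  define y3 where "y3 z = sqnorm (laplacian E (selector (act (snd z)))) (X - Xh)" for z :: "('n \<Rightarrow> 'b) \<times> 'c"
  define x where "x = (norm (centered X))\<^sup>2"
  define e where "e = (norm (X - Xh))\<^sup>2"
  define G where "G = grad F (average X)"
  define k where "k = wF * (1 + s\<tau>) * \<tau>"
  define C where "C = wF * wB * (\<gamma>\<^sup>2 * (1 + 2 * r / \<delta>) * \<sigma>\<xi>\<^sup>2)"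
  define k1 where "k1 = 3 * L * \<alpha>\<^sup>2 / 2 + wF * (\<alpha> / \<theta>) * M3"
  define H where "H z = lyapunov (X, lt, Xh) - residual X + k1 * (norm (\<zeta> z))\<^sup>2 - \<alpha> * (G \<bullet> average (\<zeta> z))
      - k * (y2 z - \<rho>min * x) + k * (y3 z - \<rho>max * e) + C" for z
  have k: "0 \<le> k" "0 \<le> k1"
    using weights_pos pos rho L_nonneg constants_pos by (simp_all add: k_def k1_def)
  have fst_meas: "(\<lambda>z. fst z i) \<in> N \<rightarrow>\<^sub>M P i" for i
    using N(2) by (subst measurable_cong_sets[OF N(2) refl]) measurable
  have snd_meas: "snd \<in> N \<rightarrow>\<^sub>M Pa"
    by (subst measurable_cong_sets[OF N(2) refl]) measurable

  have step: "(\<integral>\<^sup>+s. ennreal (lyapunov (ticopd_step fs E act Q \<alpha> \<theta> \<eta> \<gamma> (X, lt, Xh) (z, s))) \<partial>Mq)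
      \<le> ennreal (H z) \<and> 0 \<le> H z" if z: "z \<in> space N" for z
  proof -
    obtain xi a where z_eq: "z = (xi, a)" by (cases z)
    have "a \<in> space Pa" using measurable_space[OF snd_meas z] by (simp add: z_eq)
    then have S: "act a \<subseteq> E" by (rule active)
    define D where "D = kron_id (laplacian E (selector (act a))) Xh"
    define X' where "X' = X - \<alpha> *\<^sub>R (stoch_grad fs X xi + lt + \<theta> *\<^sub>R D)"
    define lt' where "lt' = lt + \<eta> *\<^sub>R D"
    have X': "X' = X - \<alpha> *\<^sub>R (gradF X + \<zeta> z + lt + \<theta> *\<^sub>R kron_id (laplacian E (selector (act a))) Xh)"
      by (simp add: X'_def D_def \<zeta>_def z_eq)
    have lt': "lt' = lt + \<eta> *\<^sub>R kron_id (laplacian E (selector (act a))) Xh"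
      by (simp add: lt'_def D_def)
    note ctx = pos(1,2) \<eta>_pos S X' lt' avg
    let ?u = "(norm (X' - Xh))\<^sup>2" and ?b = "\<gamma>\<^sup>2 * (1 + 2 * r / \<delta>) * \<sigma>\<xi>\<^sup>2"
    let ?A = "F (average X') - fstar + wF * ((norm (centered X'))\<^sup>2 + wD * (norm (hetero c X' lt'))\<^sup>2)"
    have b0: "0 \<le> (1 - q / 2) * ?u + ?b" using pos compr by simp
    have A0: "0 \<le> ?A"
      using F_lower[of "average X'"]
      by (intro add_nonneg_nonneg mult_nonneg_nonneg less_imp_le[OF weights_pos(2)]
          less_imp_le[OF weights_pos(3)] zero_le_power2) simp
    have w0: "0 \<le> wF * wB"
      by (intro mult_nonneg_nonneg less_imp_le[OF weights_pos(1)] less_imp_le[OF weights_pos(3)])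
    have "lyapunov (ticopd_step fs E act Q \<alpha> \<theta> \<eta> \<gamma> (X, lt, Xh) (z, s))
        = ?A + wF * wB * (norm ((X' - Xh) - \<gamma> *\<^sub>R Q (X' - Xh) s))\<^sup>2" for s
    proof -
      have "ticopd_step fs E act Q \<alpha> \<theta> \<eta> \<gamma> (X, lt, Xh) (z, s) = (X', lt', Xh + \<gamma> *\<^sub>R Q (X' - Xh) s)"
        by (simp add: ticopd_step_def z_eq Let_def X'_def lt'_def D_def)
      then show ?thesis
        by (simp only: lyapunov_def prod.case diff_diff_eq[symmetric]) (simp only: distrib_left mult.assoc add_ac)
    qed
    then have "(\<integral>\<^sup>+s. ennreal (lyapunov (ticopd_step fs E act Q \<alpha> \<theta> \<eta> \<gamma> (X, lt, Xh) (z, s))) \<partial>Mq)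
        = (\<integral>\<^sup>+s. ennreal (?A + wF * wB * (norm ((X' - Xh) - \<gamma> *\<^sub>R Q (X' - Xh) s))\<^sup>2) \<partial>Mq)"
      by (simp only:)
    also have "\<dots> \<le> ennreal (?A + wF * wB * ((1 - q / 2) * ?u + ?b))"
    proof (rule nn_integral_affine_le)
      have "(\<lambda>(X, s). Q X s) \<in> borel_measurable (borel \<Otimes>\<^sub>M Mq)"
        using Q by (simp add: noisy_compressor_def)
      from measurable_compose[OF measurable_Pair1'[of "X' - Xh" borel Mq] this]
      have "Q (X' - Xh) \<in> borel_measurable Mq" by simp
      then show "(\<lambda>s. (norm (X' - Xh - \<gamma> *\<^sub>R Q (X' - Xh) s))\<^sup>2) \<in> borel_measurable Mq"
        by measurable
      show "(\<integral>\<^sup>+s. ennreal ((norm (X' - Xh - \<gamma> *\<^sub>R Q (X' - Xh) s))\<^sup>2) \<partial>Mq) \<le> ennreal ((1 - q / 2) * ?u + ?b)"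
        unfolding q_eq using compressor_step[OF Q compr] .
    qed (use w0 A0 b0 Mq.prob_space_axioms in simp_all)
    finally have 1: "(\<integral>\<^sup>+s. ennreal (lyapunov (ticopd_step fs E act Q \<alpha> \<theta> \<eta> \<gamma> (X, lt, Xh) (z, s))) \<partial>Mq)
      \<le> ennreal (?A + wF * wB * ((1 - q / 2) * ?u + ?b))" .
    have 2: "?A + wF * wB * ((1 - q / 2) * ?u + ?b) \<le> H z"
    proof -
      have s: "0 < s\<tau>" using pos rho by simp
      have "F (average X') + wF * ((norm (centered X'))\<^sup>2 + wB * ((1 - q / 2) * ?u) + wD * (norm (hetero c X' lt'))\<^sup>2)
        \<le> F (average X) + wF * (x + wB * e + wD * (norm (hetero c X lt))\<^sup>2) - \<alpha> / 8 * (norm G)\<^sup>2 - \<alpha> * x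
        + k1 * (norm (\<zeta> z))\<^sup>2 - \<alpha> * (G \<bullet> average (\<zeta> z))
        - wF * (1 + s\<tau>) * \<tau> * (y2 z - \<rho>min * x) + wF * (1 + s\<tau>) * \<tau> * (y3 z - \<rho>max * e)"
        unfolding x_def e_def G_def y2_def y3_def k1_def z_eq snd_conv
        using consensus_step[OF ctx s] innovation_step[OF ctx pos(3,4)]
          hetero_step[OF ctx c_eq \<beta>_le] objective_step[OF ctx] direction_bound[of X "\<zeta> z" lt c]
        unfolding z_eq
        by (intro drift_combined[where \<Gamma> = "(norm (gradF X + \<zeta> (xi, a) + lt))\<^sup>2"]) (simp_all only: zero_le_power2)
      moreover have "w * (a + d) + w * b * (u + n) = w * (a + b * u + d) + w * b * n" for w a b d u n :: real
        by (simp add: algebra_simps)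
      note this[of wF "(norm (centered X'))\<^sup>2" "wD * (norm (hetero c X' lt'))\<^sup>2" wB "(1 - q / 2) * ?u" ?b]
      ultimately show ?thesis
        unfolding H_def lyapunov_def residual_def C_def k_def G_def[symmetric] x_def[symmetric]
          e_def[symmetric] prod.case
        by linarith
    qed
    have "0 \<le> ?A + wF * wB * ((1 - q / 2) * ?u + ?b)"
      by (intro add_nonneg_nonneg[OF A0] mult_nonneg_nonneg[OF w0] b0)
    then show ?thesis using 1 2 by (meson ennreal_leI order_trans)
  qed

  have i1: "integrable N (\<lambda>z. (norm (\<zeta> z))\<^sup>2)" "(LINT z|N. (norm (\<zeta> z))\<^sup>2) \<le> S2"
  proof -
    define h where "h i s = (norm (grad (\<lambda>y. fs i y s) (X $ i) - g i (X $ i)))\<^sup>2" for i s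
    have h: "(norm (\<zeta> z))\<^sup>2 = (\<Sum>i\<in>UNIV. h i (fst z i))" for z
      by (simp add: norm_vec_def L2_set_def sum_nonneg \<zeta>_def h_def gradF_def stoch_grad_def)
    have hi: "integrable (P i) (h i)" "integral\<^sup>L (P i) (h i) \<le> (\<sigma> i)\<^sup>2" for i
      unfolding h_def using var_int var by auto
    have int: "integrable N (\<lambda>z. h i (fst z i))" for i
      using integrable_distr[OF fst_meas[of i], where f = "h i"] hi N(3) by simp
    have eq: "(LINT z|N. h i (fst z i)) = integral\<^sup>L (P i) (h i)" for i
      using integral_distr[OF fst_meas[of i], where f = "h i"] hi N(3) by simp
    show "integrable N (\<lambda>z. (norm (\<zeta> z))\<^sup>2)" unfolding h using int by auto
    show "(LINT z|N. (norm (\<zeta> z))\<^sup>2) \<le> S2"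
      unfolding h S2_def using int by (simp add: eq sum_mono hi)
  qed
  have i4: "integrable N (\<lambda>z. G \<bullet> average (\<zeta> z))" "(LINT z|N. G \<bullet> average (\<zeta> z)) = 0"
  proof -
    define h where "h i s = G \<bullet> (grad (\<lambda>y. fs i y s) (X $ i) - g i (X $ i))" for i s
    have h: "G \<bullet> average (\<zeta> z) = (1 / real CARD('n)) * (\<Sum>i\<in>UNIV. h i (fst z i))" for z
      by (simp add: average_def \<zeta>_def h_def gradF_def stoch_grad_def inner_sum_right)
    have "has_bochner_integral (P i) (h i) 0" for i
    proof -
      interpret prob_space "P i" by (rule sample_law)
      have "has_bochner_integral (P i) (\<lambda>s. grad (\<lambda>y. fs i y s) (X $ i) - g i (X $ i)) (g i (X $ i) - g i (X $ i))"
        using unbiased[of i "X $ i"]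
        by (intro has_bochner_integral_diff) (auto simp: has_bochner_integral_iff prob_space)
      from has_bochner_integral_inner_right[of G _ _ _, OF this]
      show ?thesis by (simp add: h_def[abs_def])
    qed
    then have hi: "integrable (P i) (h i)" "integral\<^sup>L (P i) (h i) = 0" for i
      by (auto simp: has_bochner_integral_iff)
    have int: "integrable N (\<lambda>z. h i (fst z i))" for i
      using integrable_distr[OF fst_meas[of i], where f = "h i"] hi N(3) by simp
    have eq: "(LINT z|N. h i (fst z i)) = integral\<^sup>L (P i) (h i)" for i
      using integral_distr[OF fst_meas[of i], where f = "h i"] hi N(3) by simp
    show "integrable N (\<lambda>z. G \<bullet> average (\<zeta> z))" unfolding h using int by auto
    show "(LINT z|N. G \<bullet> average (\<zeta> z)) = 0"
      unfolding h using int by (simp add: eq hi)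
  qed
  have iy: "integrable N (\<lambda>z. sqnorm (laplacian E (selector (act (snd z)))) Y)"
    "(LINT z|N. sqnorm (laplacian E (selector (act (snd z)))) Y) = sqnorm (laplacian E R) Y" for Y :: "(real ^ 'd) ^ 'n"
  proof -
    note int = integral_sqnorm_selector[OF edge_law active(1), of E Y]
    show "integrable N (\<lambda>z. sqnorm (laplacian E (selector (act (snd z)))) Y)"
      using integrable_distr[OF snd_meas, where f = "\<lambda>a. sqnorm (laplacian E (selector (act a))) Y"] int N(4) by simp
    show "(LINT z|N. sqnorm (laplacian E (selector (act (snd z)))) Y) = sqnorm (laplacian E R) Y"
      using integral_distr[OF snd_meas, where f = "\<lambda>a. sqnorm (laplacian E (selector (act a))) Y"] int N(4)
      by (simp add: R_eq)
  qed
  have i2: "integrable N y2" "\<rho>min * x \<le> integral\<^sup>L N y2"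
    unfolding y2_def[abs_def] x_def using iy spec_R(1)[of X] by (simp_all add: sqnorm_centering)
  have i3: "integrable N y3" "integral\<^sup>L N y3 \<le> \<rho>max * e"
  proof -
    have "sqnorm (laplacian E R) (X - Xh) \<le> \<rho>max * (norm (centered (X - Xh)))\<^sup>2"
      using spec_R(2)[of "X - Xh"] by (simp only: sqnorm_centering)
    also have "\<dots> \<le> \<rho>max * e"
      unfolding e_def using \<rho>max_pos by (intro mult_left_mono norm_centered_le) auto
    finally show "integral\<^sup>L N y3 \<le> \<rho>max * e" "integrable N y3"
      unfolding y3_def[abs_def] using iy by simp_all
  qed
  have H_int: "integrable N H"
    unfolding H_def[abs_def] using i1 i2 i3 i4 by auto
  have H_le: "integral\<^sup>L N H \<le> lyapunov (X, lt, Xh) - residual X + noise_level \<sigma>\<xi>"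
  proof -
    have "integral\<^sup>L N H = lyapunov (X, lt, Xh) - residual X + k1 * (LINT z|N. (norm (\<zeta> z))\<^sup>2)
      - k * (integral\<^sup>L N y2 - \<rho>min * x) + k * (integral\<^sup>L N y3 - \<rho>max * e) + C"
      unfolding H_def[abs_def] using i1(1) i2(1) i3(1) i4 by (simp add: N.prob_space)
    moreover have "k1 * (LINT z|N. (norm (\<zeta> z))\<^sup>2) \<le> k1 * S2" using i1 k by (intro mult_left_mono)
    moreover have "0 \<le> k * (integral\<^sup>L N y2 - \<rho>min * x)" using i2 k by simp
    moreover have "k * (integral\<^sup>L N y3 - \<rho>max * e) \<le> 0" using i3 k by (simp add: mult_nonneg_nonpos)
    ultimately show ?thesis unfolding noise_level_def C_def k1_def by linarith
  qed
  have "(\<integral>\<^sup>+z. \<integral>\<^sup>+s. ennreal (lyapunov (ticopd_step fs E act Q \<alpha> \<theta> \<eta> \<gamma> (X, lt, Xh) (z, s))) \<partial>Mq \<partial>N)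
      \<le> (\<integral>\<^sup>+z. ennreal (H z) \<partial>N)"
    using step by (intro nn_integral_mono) blast
  also have "\<dots> = ennreal (integral\<^sup>L N H)"
    using step H_int by (intro nn_integral_eq_integral) auto
  finally have "(\<integral>\<^sup>+z. \<integral>\<^sup>+s. ennreal (lyapunov (ticopd_step fs E act Q \<alpha> \<theta> \<eta> \<gamma> (X, lt, Xh) (z, s))) \<partial>Mq \<partial>N)
      + ennreal (residual X) \<le> ennreal (integral\<^sup>L N H) + ennreal (residual X)"
    by (rule add_right_mono)
  also have "\<dots> = ennreal (integral\<^sup>L N H + residual X)"
    using step by (intro ennreal_plus[symmetric] Bochner_Integration.integral_nonneg_AE residual_nonneg AE_I2) blast
  also have "\<dots> \<le> ennreal (lyapunov (X, lt, Xh) + noise_level \<sigma>\<xi>)"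
    using H_le by (intro ennreal_leI) simp
  finally show ?thesis .
qed

end

section \<open>Fresh samples\<close>

lemma indep_rvs_distr:
  assumes "prob_space M" and indep: "indep_rvs M N X K Y"
  shows "distr M (N \<Otimes>\<^sub>M K) (\<lambda>w. (X w, Y w)) = distr M N X \<Otimes>\<^sub>M distr M K Y"
proof (rule pair_measure_eqI[symmetric])
  interpret prob_space M by fact
  have X [measurable]: "X \<in> M \<rightarrow>\<^sub>M N" and Y [measurable]: "Y \<in> M \<rightarrow>\<^sub>M K"
    and ind: "indep_set {X -` A \<inter> space M | A. A \<in> sets N} {Y -` B \<inter> space M | B. B \<in> sets K}"
    using indep by (auto simp: indep_rvs_def)
  show "sigma_finite_measure (distr M N X)" "sigma_finite_measure (distr M K Y)"
    by (intro prob_space_imp_sigma_finite prob_space_distr X Y)+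
  show "sets (distr M N X \<Otimes>\<^sub>M distr M K Y) = sets (distr M (N \<Otimes>\<^sub>M K) (\<lambda>w. (X w, Y w)))"
    by simp
  fix A B assume "A \<in> sets (distr M N X)" "B \<in> sets (distr M K Y)"
  then have AB [measurable]: "A \<in> sets N" "B \<in> sets K" by simp_all
  have "prob ((X -` A \<inter> space M) \<inter> (Y -` B \<inter> space M)) = prob (X -` A \<inter> space M) * prob (Y -` B \<inter> space M)"
    by (rule indep_setD[OF ind]) (use AB in blast)+
  moreover have "(X -` A \<inter> space M) \<inter> (Y -` B \<inter> space M) = (\<lambda>w. (X w, Y w)) -` (A \<times> B) \<inter> space M"
    by auto
  ultimately show "emeasure (distr M N X) A * emeasure (distr M K Y) B =
      emeasure (distr M (N \<Otimes>\<^sub>M K) (\<lambda>w. (X w, Y w))) (A \<times> B)"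
    by (simp add: emeasure_distr emeasure_eq_measure ennreal_mult)
qed

lemma borel_measurable_vec_lambda:
  fixes f :: "'a \<Rightarrow> 'i::finite \<Rightarrow> 'v::euclidean_space"
  assumes "\<And>i. (\<lambda>w. f w i) \<in> borel_measurable M"
  shows "(\<lambda>w. \<chi> i. f w i) \<in> borel_measurable M"
proof (rule iffD2[OF borel_measurable_euclidean_space], rule ballI)
  fix b :: "'v ^ 'i" assume "b \<in> Basis"
  then obtain i u where "b = axis i u" "u \<in> Basis" by (auto simp: Basis_vec_def)
  then show "(\<lambda>w. (\<chi> i. f w i) \<bullet> b) \<in> borel_measurable M"
    using assms[of i] by (simp add: inner_axis)
qed

lemma borel_measurable_vec_nth:
  fixes f :: "'a \<Rightarrow> ('v::euclidean_space) ^ 'i::finite"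
  assumes "f \<in> borel_measurable M"
  shows "(\<lambda>w. f w $ i) \<in> borel_measurable M"
proof -
  have "continuous_on UNIV (\<lambda>x :: 'v ^ 'i. x $ i)"
    by (intro linear_continuous_on bounded_linear_vec_nth)
  from borel_measurable_continuous_on[OF this assms] show ?thesis .
qed

lemma borel_measurable_laplacian:
  fixes act :: "'c \<Rightarrow> ('n::finite \<times> 'n) set"
  assumes act: "(\<lambda>s. selector (act s)) \<in> borel_measurable Pa"
    and a: "a \<in> M \<rightarrow>\<^sub>M Pa" and Y: "Y \<in> borel_measurable M"
  shows "(\<lambda>w. kron_id (laplacian E (selector (act (a w)))) (Y w :: (real ^ 'd::finite) ^ 'n))
    \<in> borel_measurable M"
proof -
  have sel: "(\<lambda>w. selector (act (a w))) \<in> borel_measurable M"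
    by (rule measurable_compose[OF a act])
  have B: "(\<lambda>w. laplacian E (selector (act (a w)))) \<in> borel_measurable M"
    unfolding laplacian_def matrix_matrix_mult_def
    by (intro borel_measurable_vec_lambda borel_measurable_sum borel_measurable_times
        borel_measurable_const borel_measurable_vec_nth sel)
  show ?thesis
    unfolding kron_id_def
    by (intro borel_measurable_vec_lambda borel_measurable_sum borel_measurable_scaleR
        borel_measurable_vec_nth B Y)
qed

lemma borel_measurable_step:
  fixes fs :: "'n::finite \<Rightarrow> real ^ 'd::finite \<Rightarrow> 'b \<Rightarrow> real"
  assumes act: "(\<lambda>s. selector (act s)) \<in> borel_measurable Pa"
    and fs: "\<And>i. (\<lambda>(x, s). grad (\<lambda>y. fs i y s) x) \<in> borel_measurable (borel \<Otimes>\<^sub>M P i)"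
    and Q: "(\<lambda>(X, s). Q X s) \<in> borel_measurable (borel \<Otimes>\<^sub>M Mq)"
    and u: "u \<in> borel_measurable M" and b: "b \<in> M \<rightarrow>\<^sub>M ((PiM UNIV P \<Otimes>\<^sub>M Pa) \<Otimes>\<^sub>M Mq)"
  shows "(\<lambda>w. ticopd_step fs E act Q \<alpha> \<theta> \<eta> \<gamma> (u w) (b w)) \<in> borel_measurable M"
proof -
  note b [measurable]
  have fst': "(\<lambda>w. fst (f w)) \<in> borel_measurable M" if "f \<in> borel_measurable M"
    for f :: "_ \<Rightarrow> 'x::euclidean_space \<times> 'y::euclidean_space"
    by (rule borel_measurable_continuous_on[OF _ that]) (intro continuous_intros)
  have snd': "(\<lambda>w. snd (f w)) \<in> borel_measurable M" if "f \<in> borel_measurable M"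
    for f :: "_ \<Rightarrow> 'x::euclidean_space \<times> 'y::euclidean_space"
    by (rule borel_measurable_continuous_on[OF _ that]) (intro continuous_intros)
  define X where "X w = fst (u w)" for w
  define lt where "lt w = fst (snd (u w))" for w
  define Xh where "Xh w = snd (snd (u w))" for w
  have [measurable]: "X \<in> borel_measurable M" "lt \<in> borel_measurable M" "Xh \<in> borel_measurable M"
    unfolding X_def lt_def Xh_def by (intro fst' snd' u)+
  define xi where "xi w = fst (fst (b w))" for w
  define a where "a w = snd (fst (b w))" for w
  define s where "s w = snd (b w)" for w
  have [measurable]: "xi \<in> M \<rightarrow>\<^sub>M PiM UNIV P" "a \<in> M \<rightarrow>\<^sub>M Pa" "s \<in> M \<rightarrow>\<^sub>M Mq"
    unfolding xi_def a_def s_def by measurable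
  have [measurable]: "(\<lambda>w. stoch_grad fs (X w) (xi w)) \<in> borel_measurable M"
    unfolding stoch_grad_def
  proof (rule borel_measurable_vec_lambda)
    fix i
    have "(\<lambda>w. X w $ i) \<in> borel_measurable M" by (rule borel_measurable_vec_nth) measurable
    moreover have "(\<lambda>w. xi w i) \<in> M \<rightarrow>\<^sub>M P i"
      by (rule measurable_compose[OF _ measurable_component_singleton[of i UNIV P]]) measurable
    ultimately have "(\<lambda>w. (X w $ i, xi w i)) \<in> M \<rightarrow>\<^sub>M (borel \<Otimes>\<^sub>M P i)" by (rule measurable_Pair)
    from measurable_compose[OF this fs[of i]]
    show "(\<lambda>w. grad (\<lambda>y. fs i y (xi w i)) (X w $ i)) \<in> borel_measurable M" by simp
  qed
  define D where "D w = kron_id (laplacian E (selector (act (a w)))) (Xh w)" for w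
  have [measurable]: "D \<in> borel_measurable M"
    unfolding D_def by (rule borel_measurable_laplacian[OF act]) measurable
  define X' where "X' w = X w - \<alpha> *\<^sub>R (stoch_grad fs (X w) (xi w) + lt w + \<theta> *\<^sub>R D w)" for w
  have [measurable]: "X' \<in> borel_measurable M" unfolding X'_def by measurable
  have "(\<lambda>w. (X' w - Xh w, s w)) \<in> M \<rightarrow>\<^sub>M (borel \<Otimes>\<^sub>M Mq)" by measurable
  from measurable_compose[OF this Q]
  have [measurable]: "(\<lambda>w. Q (X' w - Xh w) (s w)) \<in> borel_measurable M" by simp
  have "ticopd_step fs E act Q \<alpha> \<theta> \<eta> \<gamma> (u w) (b w) =
      (X' w, lt w + \<eta> *\<^sub>R D w, Xh w + \<gamma> *\<^sub>R Q (X' w - Xh w) (s w))" for w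
    by (simp add: ticopd_step_def Let_def X'_def X_def lt_def Xh_def xi_def a_def s_def D_def split: prod.split)
  then show ?thesis
    by (simp only:) (intro borel_measurable_Pair; measurable)
qed

context sampled_problem
begin

lemma continuous_gradF: "continuous_on UNIV gradF"
proof (rule continuous_onI)
  fix X :: "(real ^ 'd) ^ 'n" and e :: real assume "0 < e"
  have "dist (gradF Y) (gradF X) \<le> L * dist Y X" for Y
  proof -
    have "(dist (gradF Y) (gradF X))\<^sup>2 \<le> (L * dist Y X)\<^sup>2"
      using gradF_lipschitz[of Y X] by (simp add: dist_norm power_mult_distrib)
    then show ?thesis using L_nonneg by (simp add: abs_le_square_iff[symmetric])
  qed
  moreover have "L * d < e" if "d < e / (L + 1)" "0 \<le> d" for d
  proof -
    have "(L + 1) * d < e" using that L_nonneg by (simp add: pos_less_divide_eq mult.commute)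
    then show ?thesis using that by (simp add: algebra_simps)
  qed
  ultimately have "\<forall>Y\<in>UNIV. dist Y X < e / (L + 1) \<longrightarrow> dist (gradF Y) (gradF X) \<le> e"
    by (meson less_imp_le order_trans zero_le_dist)
  then show "\<exists>d>0. \<forall>Y\<in>UNIV. dist Y X < d \<longrightarrow> dist (gradF Y) (gradF X) \<le> e"
    using L_nonneg \<open>0 < e\<close> by (intro exI[of _ "e / (L + 1)"]) auto
qed

lemma continuous_average: "continuous_on UNIV (average :: (real ^ 'd) ^ 'n \<Rightarrow> _)"
  unfolding average_def[abs_def] by (intro continuous_intros)

lemma continuous_centered: "continuous_on UNIV (centered :: (real ^ 'd) ^ 'n \<Rightarrow> _)"
  unfolding centered_def[abs_def] stack_def
  by (intro continuous_intros continuous_on_subset[OF continuous_average]) auto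

lemma continuous_meangrad: "continuous_on UNIV meangrad"
  unfolding meangrad_def[abs_def] stack_def
  by (rule continuous_on_compose2[OF continuous_gradF])
    (auto intro!: continuous_intros continuous_on_subset[OF continuous_average])

lemma continuous_F: "continuous_on UNIV F"
  by (rule continuous_at_imp_continuous_on)
    (use F_gderiv in \<open>auto simp: gderiv_def intro: has_derivative_continuous\<close>)

lemma measurable_average [measurable]: "average \<in> borel_measurable (borel :: ((real ^ 'd) ^ 'n) measure)"
  by (intro borel_measurable_continuous_onI continuous_average)

lemma measurable_centered [measurable]: "centered \<in> borel_measurable (borel :: ((real ^ 'd) ^ 'n) measure)"
  by (intro borel_measurable_continuous_onI continuous_centered)

lemma measurable_meangrad [measurable]: "meangrad \<in> borel_measurable borel"
  by (intro borel_measurable_continuous_onI continuous_meangrad)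

lemma measurable_F [measurable]: "F \<in> borel_measurable borel"
  by (intro borel_measurable_continuous_onI continuous_F)

lemma measurable_grad_F [measurable]:
  "(\<lambda>X :: (real ^ 'd) ^ 'n. grad F (average X)) \<in> borel_measurable borel"
  unfolding grad_F by measurable

lemma measurable_residual [measurable]: "residual \<in> borel_measurable borel"
  unfolding residual_def[abs_def] by measurable

lemma measurable_lyapunov [measurable]: "lyapunov \<in> borel_measurable borel"
proof -
  have [measurable]: "(\<lambda>u :: ((real ^ 'd) ^ 'n) \<times> ((real ^ 'd) ^ 'n) \<times> ((real ^ 'd) ^ 'n). fst u) \<in> borel_measurable borel"
    "(\<lambda>u :: ((real ^ 'd) ^ 'n) \<times> ((real ^ 'd) ^ 'n) \<times> ((real ^ 'd) ^ 'n). fst (snd u)) \<in> borel_measurable borel"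
    "(\<lambda>u :: ((real ^ 'd) ^ 'n) \<times> ((real ^ 'd) ^ 'n) \<times> ((real ^ 'd) ^ 'n). snd (snd u)) \<in> borel_measurable borel"
    by (intro borel_measurable_continuous_onI continuous_intros)+
  have "lyapunov = (\<lambda>u. F (average (fst u)) - fstar
     + wF * ((norm (centered (fst u)))\<^sup>2 + wB * (norm (fst u - snd (snd u)))\<^sup>2
       + wD * (norm (fst (snd u) + c *\<^sub>R centered (fst u) + centered (meangrad (fst u))))\<^sup>2))"
    by (simp add: lyapunov_def hetero_def fun_eq_iff)
  moreover have "\<dots> \<in> borel_measurable borel" by measurable
  ultimately show ?thesis by simp
qed

end

locale ticopd_process = sampled_problem E g F L fstar \<rho>min \<rho>max \<rho>t \<alpha> \<theta> \<eta> q c M1 M2 M3 P Pa act R fs \<sigma> \<delta> r \<gamma>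
  for E :: "('n::finite \<times> 'n) set" and g :: "'n \<Rightarrow> real ^ 'd::finite \<Rightarrow> real ^ 'd"
    and F :: "real ^ 'd \<Rightarrow> real" and L fstar \<rho>min \<rho>max \<rho>t \<alpha> \<theta> \<eta> q c M1 M2 M3 :: real
    and P :: "'n \<Rightarrow> 'b measure" and Pa :: "'c measure" and act :: "'c \<Rightarrow> ('n \<times> 'n) set"
    and R :: "real ^ ('n \<times> 'n) ^ ('n \<times> 'n)"
    and fs :: "'n \<Rightarrow> real ^ 'd \<Rightarrow> 'b \<Rightarrow> real" and \<sigma> :: "'n \<Rightarrow> real"
    and \<delta> r \<gamma> :: real +
  fixes Mq :: "'q measure" and Q :: "(real ^ 'd) ^ 'n \<Rightarrow> 'q \<Rightarrow> (real ^ 'd) ^ 'n" and \<sigma>\<xi> :: real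
    and M :: "'w measure" and xi :: "nat \<Rightarrow> 'n \<Rightarrow> 'w \<Rightarrow> 'b" and xa :: "nat \<Rightarrow> 'w \<Rightarrow> 'c" and xq :: "nat \<Rightarrow> 'w \<Rightarrow> 'q"
    and X0 Xh0 :: "(real ^ 'd) ^ 'n" and dual0 :: "(real ^ 'd) ^ ('n \<times> 'n)"
  assumes Q: "noisy_compressor \<delta> r \<sigma>\<xi> Mq Q"
    and fresh: "fresh_samples M P Pa Mq xi xa xq"
begin

abbreviation "bundle_space \<equiv> (PiM UNIV P \<Otimes>\<^sub>M Pa) \<Otimes>\<^sub>M Mq"

definition samples :: "'w \<Rightarrow> nat \<Rightarrow> (('n \<Rightarrow> 'b) \<times> 'c) \<times> 'q" where
  "samples w t = ((\<lambda>i. xi t i w, xa t w), xq t w)"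

primrec run :: "nat \<Rightarrow> (nat \<Rightarrow> (('n \<Rightarrow> 'b) \<times> 'c) \<times> 'q) \<Rightarrow>
    ((real ^ 'd) ^ 'n) \<times> ((real ^ 'd) ^ 'n) \<times> ((real ^ 'd) ^ 'n)" where
  "run 0 b = (X0, kron_id (transpose (incidence E)) dual0, Xh0)"
| "run (Suc t) b = ticopd_step fs E act Q \<alpha> \<theta> \<eta> \<gamma> (run t b) (b t)"

lemma ticopd_run:
  "ticopd fs E act Q \<alpha> \<theta> \<eta> \<gamma> X0 dual0 Xh0 (\<lambda>t i. xi t i w) (\<lambda>t. xa t w) (\<lambda>t. xq t w) t = run t (samples w)"
  by (induction t) (simp_all add: ticopd_step_def samples_def Let_def split: prod.split)

lemma run_cong: "(\<And>k. k < t \<Longrightarrow> b k = b' k) \<Longrightarrow> run t b = run t b'"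
  by (induction t) simp_all

lemma average_run: "average (fst (snd (run t b))) = 0"
  by (induction t) (simp_all add: average_transpose_incidence average_ticopd_step)

lemma measurable_step:
  assumes "u \<in> borel_measurable N" "b \<in> N \<rightarrow>\<^sub>M bundle_space"
  shows "(\<lambda>w. ticopd_step fs E act Q \<alpha> \<theta> \<eta> \<gamma> (u w) (b w)) \<in> borel_measurable N"
proof -
  have "(\<lambda>(X, s). Q X s) \<in> borel_measurable (borel \<Otimes>\<^sub>M Mq)"
    using Q by (simp add: noisy_compressor_def)
  then show ?thesis
    by (rule borel_measurable_step[where P = P, OF active(1) fs_meas _ assms])
qed

lemma measurable_run:
  "{..<t} \<subseteq> I \<Longrightarrow> run t \<in> borel_measurable (PiM I (\<lambda>_. bundle_space))"
proof (induction t)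
  case 0
  have "run 0 = (\<lambda>b. (X0, kron_id (transpose (incidence E)) dual0, Xh0))"
    by (simp add: fun_eq_iff)
  then show ?case by simp
next
  case (Suc t)
  then have "(\<lambda>b. b t) \<in> PiM I (\<lambda>_. bundle_space) \<rightarrow>\<^sub>M bundle_space"
    by (intro measurable_component_singleton) auto
  moreover have "run t \<in> borel_measurable (PiM I (\<lambda>_. bundle_space))"
    using Suc by (simp add: lessThan_Suc)
  ultimately show ?case by (simp add: measurable_step)
qed

sublocale M: prob_space M
  using fresh by (simp add: fresh_samples_def)

lemma sample_indep: "M.indep_vars (\<lambda>_. bundle_space) (\<lambda>t w. samples w t) UNIV"
  using fresh by (simp add: fresh_samples_def samples_def)

lemma measurable_samples [measurable]: "(\<lambda>w. samples w t) \<in> M \<rightarrow>\<^sub>M bundle_space"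
  using sample_indep by (simp add: M.indep_vars_def)

lemma one_step_drift_samples:
  assumes "average lt = 0"
  shows "(\<integral>\<^sup>+w. ennreal (lyapunov (ticopd_step fs E act Q \<alpha> \<theta> \<eta> \<gamma> (X, lt, Xh) (samples w t))) \<partial>M)
    + ennreal (residual X) \<le> ennreal (lyapunov (X, lt, Xh) + noise_level \<sigma>\<xi>)"
proof -
  define Z where "Z w = (\<lambda>i. xi t i w, xa t w)" for w
  define N where "N = distr M (PiM UNIV P \<Otimes>\<^sub>M Pa) Z"
  have indep: "indep_rvs M (PiM UNIV P \<Otimes>\<^sub>M Pa) Z Mq (xq t)"
    and xi: "M.indep_vars P (xi t) UNIV" "\<And>i. distr M (P i) (xi t i) = P i"
    and xa: "xa t \<in> M \<rightarrow>\<^sub>M Pa" "distr M Pa (xa t) = Pa"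
    and xq: "xq t \<in> M \<rightarrow>\<^sub>M Mq" "distr M Mq (xq t) = Mq"
    using fresh by (auto simp: fresh_samples_def Z_def[abs_def])
  interpret Mq: prob_space Mq using Q by (simp add: noisy_compressor_def)
  have Z: "Z \<in> M \<rightarrow>\<^sub>M PiM UNIV P \<Otimes>\<^sub>M Pa" using indep by (simp add: indep_rvs_def)
  have marg: "distr N (P i) (\<lambda>z. fst z i) = P i" "distr N Pa snd = Pa" for i
    unfolding N_def by (subst distr_distr[OF _ Z]; simp add: comp_def Z_def xi xa)+
  have prod: "distr M bundle_space (\<lambda>w. samples w t) = N \<Otimes>\<^sub>M Mq"
    using indep_rvs_distr[OF M.prob_space_axioms indep] by (simp add: samples_def Z_def N_def xq)
  have meas: "(\<lambda>b. ennreal (lyapunov (ticopd_step fs E act Q \<alpha> \<theta> \<eta> \<gamma> (X, lt, Xh) b))) \<in> borel_measurable bundle_space"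
  proof -
    have [measurable]: "(\<lambda>b. ticopd_step fs E act Q \<alpha> \<theta> \<eta> \<gamma> (X, lt, Xh) b) \<in> borel_measurable bundle_space"
      by (rule measurable_step) simp_all
    show ?thesis by measurable
  qed
  have "(\<integral>\<^sup>+w. ennreal (lyapunov (ticopd_step fs E act Q \<alpha> \<theta> \<eta> \<gamma> (X, lt, Xh) (samples w t))) \<partial>M)
    = (\<integral>\<^sup>+b. ennreal (lyapunov (ticopd_step fs E act Q \<alpha> \<theta> \<eta> \<gamma> (X, lt, Xh) b)) \<partial>(N \<Otimes>\<^sub>M Mq))"
    unfolding prod[symmetric] using meas by (intro nn_integral_distr[symmetric]) simp_all
  also have "\<dots> = (\<integral>\<^sup>+z. \<integral>\<^sup>+s. ennreal (lyapunov (ticopd_step fs E act Q \<alpha> \<theta> \<eta> \<gamma> (X, lt, Xh) (z, s))) \<partial>Mq \<partial>N)"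
    using meas by (intro Mq.nn_integral_fst[symmetric]) (simp add: N_def cong: measurable_cong_sets)
  finally show ?thesis
    using one_step_drift[OF _ _ marg Q assms, of X Xh] M.prob_space_distr[OF Z] by (simp add: N_def)
qed

text \<open>
  The state at time \<open>t\<close> is a function of the samples before \<open>t\<close>, hence independent of the samples
  of step \<open>t\<close>, and Fubini applies with the state held fixed.
\<close>

lemma process_drift:
  "(\<integral>\<^sup>+w. ennreal (lyapunov (run (Suc t) (samples w))) \<partial>M)
    + (\<integral>\<^sup>+w. ennreal (residual (fst (run t (samples w)))) \<partial>M)
    \<le> (\<integral>\<^sup>+w. ennreal (lyapunov (run t (samples w))) \<partial>M) + ennreal (noise_level \<sigma>\<xi>)"
proof -
  define past where "past w = restrict (samples w) {..<t}" for w
  define now where "now w = restrict (samples w) {t}" for w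
  let ?A = "PiM {..<t} (\<lambda>_. bundle_space)" and ?B = "PiM {t} (\<lambda>_. bundle_space)"
  have "M.indep_var ?A past ?B now"
    unfolding past_def[abs_def] now_def[abs_def] by (rule M.indep_var_restrict[OF sample_indep]) auto
  then have past: "past \<in> M \<rightarrow>\<^sub>M ?A" and now: "now \<in> M \<rightarrow>\<^sub>M ?B"
    and prod: "distr M ?A past \<Otimes>\<^sub>M distr M ?B now = distr M (?A \<Otimes>\<^sub>M ?B) (\<lambda>w. (past w, now w))"
    unfolding M.indep_var_distribution_eq by blast+
  interpret A: prob_space "distr M ?A past" by (rule M.prob_space_distr[OF past])
  interpret B: prob_space "distr M ?B now" by (rule M.prob_space_distr[OF now])
  have run_past: "run t (samples w) = run t (past w)" for w
    by (rule run_cong) (simp add: past_def)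
  have run: "run t \<in> borel_measurable ?A" by (rule measurable_run) simp
  define \<phi> where "\<phi> = (\<lambda>p. ennreal (lyapunov (ticopd_step fs E act Q \<alpha> \<theta> \<eta> \<gamma> (run t (fst p)) (snd p t))))"
  have \<phi>: "\<phi> \<in> borel_measurable (?A \<Otimes>\<^sub>M ?B)"
  proof -
    have "(\<lambda>p. run t (fst p)) \<in> borel_measurable (?A \<Otimes>\<^sub>M ?B)"
      by (rule measurable_compose[OF measurable_fst run])
    moreover have "(\<lambda>p. snd p t) \<in> ?A \<Otimes>\<^sub>M ?B \<rightarrow>\<^sub>M bundle_space"
      by (rule measurable_compose[OF measurable_snd measurable_component_singleton]) simp
    ultimately have "(\<lambda>p. ticopd_step fs E act Q \<alpha> \<theta> \<eta> \<gamma> (run t (fst p)) (snd p t)) \<in> borel_measurable (?A \<Otimes>\<^sub>M ?B)"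
      by (rule measurable_step)
    from measurable_compose[OF measurable_compose[OF this measurable_lyapunov] measurable_ennreal]
    show ?thesis by (simp only: \<phi>_def)
  qed
  then have \<phi>': "\<phi> \<in> borel_measurable (distr M ?A past \<Otimes>\<^sub>M distr M ?B now)"
    by (simp cong: measurable_cong_sets)
  have inner: "(\<integral>\<^sup>+h. \<phi> (f, h) \<partial>distr M ?B now) + ennreal (residual (fst (run t f)))
      \<le> ennreal (lyapunov (run t f)) + ennreal (noise_level \<sigma>\<xi>)" if f: "f \<in> space ?A" for f
  proof -
    have "(\<lambda>h. \<phi> (f, h)) \<in> borel_measurable (distr M ?B now)"
      using measurable_compose[OF measurable_Pair1'[OF f] \<phi>] by simp
    then have "(\<integral>\<^sup>+h. \<phi> (f, h) \<partial>distr M ?B now) = (\<integral>\<^sup>+w. \<phi> (f, now w) \<partial>M)"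
      by (rule nn_integral_distr[OF now])
    also have "\<dots> = (\<integral>\<^sup>+w. ennreal (lyapunov (ticopd_step fs E act Q \<alpha> \<theta> \<eta> \<gamma> (run t f) (samples w t))) \<partial>M)"
      by (simp add: \<phi>_def now_def)
    finally have "(\<integral>\<^sup>+h. \<phi> (f, h) \<partial>distr M ?B now) + ennreal (residual (fst (run t f)))
        \<le> ennreal (lyapunov (run t f) + noise_level \<sigma>\<xi>)"
      using one_step_drift_samples[of "fst (snd (run t f))" "fst (run t f)" "snd (snd (run t f))" t] average_run[of t f]
      by simp
    then show ?thesis by (simp add: ennreal_plus lyapunov_nonneg noise_level_nonneg)
  qed
  have 1: "(\<integral>\<^sup>+w. ennreal (lyapunov (run (Suc t) (samples w))) \<partial>M)
      = (\<integral>\<^sup>+f. \<integral>\<^sup>+h. \<phi> (f, h) \<partial>distr M ?B now \<partial>distr M ?A past)"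
  proof -
    have "(\<integral>\<^sup>+w. ennreal (lyapunov (run (Suc t) (samples w))) \<partial>M) = (\<integral>\<^sup>+w. \<phi> (past w, now w) \<partial>M)"
      by (simp add: \<phi>_def run_past now_def)
    also have "\<dots> = (\<integral>\<^sup>+p. \<phi> p \<partial>(distr M ?A past \<Otimes>\<^sub>M distr M ?B now))"
      unfolding prod using \<phi> by (intro nn_integral_distr[symmetric] measurable_Pair past now) simp
    also have "\<dots> = (\<integral>\<^sup>+f. \<integral>\<^sup>+h. \<phi> (f, h) \<partial>distr M ?B now \<partial>distr M ?A past)"
      by (rule B.nn_integral_fst[symmetric, OF \<phi>'])
    finally show ?thesis .
  qed
  have run_h: "(\<lambda>f. ennreal (h (run t f))) \<in> borel_measurable (distr M ?A past)"
    if "h \<in> borel_measurable borel" for h :: "_ \<Rightarrow> real"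
    using measurable_compose[OF measurable_compose[OF run that] measurable_ennreal] by simp
  have 2: "(\<integral>\<^sup>+w. ennreal (h (run t (samples w))) \<partial>M) = (\<integral>\<^sup>+f. ennreal (h (run t f)) \<partial>distr M ?A past)"
    if "h \<in> borel_measurable borel" for h :: "_ \<Rightarrow> real"
    unfolding run_past by (rule nn_integral_distr[OF past run_h[OF that], symmetric])
  have res: "(\<lambda>u. residual (fst u)) \<in> borel_measurable
      (borel :: (((real ^ 'd) ^ 'n) \<times> ((real ^ 'd) ^ 'n) \<times> ((real ^ 'd) ^ 'n)) measure)"
    by (rule measurable_compose[OF _ measurable_residual])
      (intro borel_measurable_continuous_onI continuous_intros)
  have "(\<integral>\<^sup>+w. ennreal (lyapunov (run (Suc t) (samples w))) \<partial>M)
      + (\<integral>\<^sup>+w. ennreal (residual (fst (run t (samples w)))) \<partial>M)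
      = (\<integral>\<^sup>+f. (\<integral>\<^sup>+h. \<phi> (f, h) \<partial>distr M ?B now) + ennreal (residual (fst (run t f))) \<partial>distr M ?A past)"
    unfolding 1 2[OF res]
    by (rule nn_integral_add[symmetric, OF B.borel_measurable_nn_integral_fst[OF \<phi>'] run_h[OF res]])
  also have "\<dots> \<le> (\<integral>\<^sup>+f. ennreal (lyapunov (run t f)) + ennreal (noise_level \<sigma>\<xi>) \<partial>distr M ?A past)"
    by (rule nn_integral_mono, rule inner) simp
  also have "\<dots> = (\<integral>\<^sup>+f. ennreal (lyapunov (run t f)) \<partial>distr M ?A past) + ennreal (noise_level \<sigma>\<xi>)"
    by (subst nn_integral_add[OF run_h[OF measurable_lyapunov]]) (simp_all add: A.emeasure_space_1[simplified])
  also have "(\<integral>\<^sup>+f. ennreal (lyapunov (run t f)) \<partial>distr M ?A past) = (\<integral>\<^sup>+w. ennreal (lyapunov (run t (samples w))) \<partial>M)"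
    by (rule 2[OF measurable_lyapunov, symmetric])
  finally show ?thesis .
qed

text \<open>
  The initial state ignores the samples, hence \<open>undefined\<close> as their value.
\<close>

lemma telescoped_drift:
  "(\<integral>\<^sup>+w. ennreal (lyapunov (run T (samples w))) \<partial>M)
    + (\<Sum>t<T. \<integral>\<^sup>+w. ennreal (residual (fst (run t (samples w)))) \<partial>M)
    \<le> ennreal (lyapunov (run 0 undefined) + real T * noise_level \<sigma>\<xi>)"
proof (induction T)
  case 0
  then show ?case by (simp add: M.emeasure_space_1)
next
  case (Suc T)
  let ?V = "\<lambda>T. \<integral>\<^sup>+w. ennreal (lyapunov (run T (samples w))) \<partial>M"
  let ?G = "\<lambda>t. \<integral>\<^sup>+w. ennreal (residual (fst (run t (samples w)))) \<partial>M"
  have "?V (Suc T) + (\<Sum>t<Suc T. ?G t) = (?V (Suc T) + ?G T) + (\<Sum>t<T. ?G t)"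
    by (simp add: add_ac)
  also have "\<dots> \<le> (?V T + ennreal (noise_level \<sigma>\<xi>)) + (\<Sum>t<T. ?G t)"
    by (intro add_right_mono process_drift)
  also have "\<dots> = (?V T + (\<Sum>t<T. ?G t)) + ennreal (noise_level \<sigma>\<xi>)"
    by (simp add: add_ac)
  also have "\<dots> \<le> ennreal (lyapunov (run 0 undefined) + real T * noise_level \<sigma>\<xi>) + ennreal (noise_level \<sigma>\<xi>)"
    by (intro add_right_mono Suc.IH)
  also have "\<dots> = ennreal (lyapunov (run 0 undefined) + real (Suc T) * noise_level \<sigma>\<xi>)"
    by (subst ennreal_plus[symmetric])
      (auto simp: lyapunov_nonneg noise_level_nonneg algebra_simps intro!: add_nonneg_nonneg mult_nonneg_nonneg simp del: run.simps)
  finally show ?case .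
qed

text \<open>
  The index is independent of the whole sequence of samples, and every iterate is a function of
  that sequence.
\<close>

lemma random_index:
  assumes idx: "uniform_index M P Pa Mq xi xa xq T idx" and T: "0 < T"
    and h: "h \<in> borel_measurable borel"
  shows "(\<lambda>w. h (fst (run (idx w) (samples w)))) \<in> borel_measurable M"
    and "(\<integral>\<^sup>+w. ennreal (h (fst (run (idx w) (samples w)))) \<partial>M)
      = (\<Sum>t<T. \<integral>\<^sup>+w. ennreal (h (fst (run t (samples w)))) \<partial>M) / T"
proof -
  let ?K = "PiM UNIV (\<lambda>_::nat. bundle_space)"
  have law: "distr M (count_space UNIV) idx = measure_pmf (pmf_of_set {..<T})"
    and indep: "indep_rvs M (count_space UNIV) idx ?K samples"
    using idx by (auto simp: uniform_index_def samples_def[abs_def])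
  have idx_meas: "idx \<in> M \<rightarrow>\<^sub>M count_space UNIV" and samples: "samples \<in> M \<rightarrow>\<^sub>M ?K"
    using indep by (auto simp: indep_rvs_def)
  interpret D: prob_space "distr M ?K samples" by (rule M.prob_space_distr[OF samples])
  define \<phi> where "\<phi> = (\<lambda>(t, b). h (fst (run t b)))"
  have hrun [measurable]: "(\<lambda>b. h (fst (run t b))) \<in> borel_measurable ?K" for t
    by (rule measurable_compose[OF _ h], rule borel_measurable_continuous_on[OF _ measurable_run])
      (intro continuous_intros, simp)
  have \<phi>: "\<phi> \<in> borel_measurable (count_space UNIV \<Otimes>\<^sub>M ?K)"
    unfolding \<phi>_def by (rule measurable_pair_measure_countable1) (auto simp: hrun)
  have pair: "(\<lambda>w. (idx w, samples w)) \<in> M \<rightarrow>\<^sub>M count_space UNIV \<Otimes>\<^sub>M ?K"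
    using idx_meas samples by (rule measurable_Pair)
  from measurable_compose[OF pair \<phi>]
  show "(\<lambda>w. h (fst (run (idx w) (samples w)))) \<in> borel_measurable M" by (simp add: \<phi>_def)
  have "(\<integral>\<^sup>+w. ennreal (h (fst (run (idx w) (samples w)))) \<partial>M)
      = (\<integral>\<^sup>+p. ennreal (\<phi> p) \<partial>distr M (count_space UNIV \<Otimes>\<^sub>M ?K) (\<lambda>w. (idx w, samples w)))"
    using \<phi> by (subst nn_integral_distr[OF pair]) (simp_all add: \<phi>_def)
  also have "\<dots> = (\<integral>\<^sup>+t. \<integral>\<^sup>+b. ennreal (\<phi> (t, b)) \<partial>distr M ?K samples \<partial>distr M (count_space UNIV) idx)"
    unfolding indep_rvs_distr[OF M.prob_space_axioms indep]
    using \<phi> by (intro D.nn_integral_fst[symmetric]) (simp cong: measurable_cong_sets)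
  also have "\<dots> = (\<Sum>t<T. \<integral>\<^sup>+b. ennreal (\<phi> (t, b)) \<partial>distr M ?K samples) / T"
    unfolding law using T by (subst nn_integral_pmf_of_set) auto
  finally have "(\<integral>\<^sup>+w. ennreal (h (fst (run (idx w) (samples w)))) \<partial>M)
      = (\<Sum>t<T. \<integral>\<^sup>+b. ennreal (\<phi> (t, b)) \<partial>distr M ?K samples) / T" .
  moreover have "(\<integral>\<^sup>+b. ennreal (\<phi> (t, b)) \<partial>distr M ?K samples) = (\<integral>\<^sup>+w. ennreal (h (fst (run t (samples w)))) \<partial>M)" for t
    unfolding \<phi>_def prod.case by (subst nn_integral_distr[OF samples]) (simp_all add: hrun)
  ultimately show "(\<integral>\<^sup>+w. ennreal (h (fst (run (idx w) (samples w)))) \<partial>M)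
      = (\<Sum>t<T. \<integral>\<^sup>+w. ennreal (h (fst (run t (samples w)))) \<partial>M) / T"
    by simp
qed

lemma random_iterate_bound:
  assumes idx: "uniform_index M P Pa Mq xi xa xq T idx" and T: "0 < T"
  defines "X \<equiv> \<lambda>w. fst (run (idx w) (samples w))"
    and "b \<equiv> lyapunov (X0, kron_id (transpose (incidence E)) dual0, Xh0) / (\<alpha> * real T) + noise_level \<sigma>\<xi> / \<alpha>"
  shows "integrable M (\<lambda>w. (norm (grad F (average (X w))))\<^sup>2)"
    and "integrable M (\<lambda>w. sqnorm centering (X w))"
    and "(LINT w|M. (norm (grad F (average (X w))))\<^sup>2) \<le> 8 * b"
    and "(LINT w|M. sqnorm centering (X w)) \<le> b"
proof -
  let ?V = "lyapunov (X0, kron_id (transpose (incidence E)) dual0, Xh0)"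
  have V: "0 \<le> ?V" "0 \<le> noise_level \<sigma>\<xi>" by (rule lyapunov_nonneg noise_level_nonneg)+
  have b: "\<alpha> * b = (?V + real T * noise_level \<sigma>\<xi>) / real T"
    using pos T by (simp add: b_def field_simps)
  have b0: "0 \<le> b" using V pos by (simp add: b_def)
  have X_meas: "(\<lambda>w. h (X w)) \<in> borel_measurable M" if "h \<in> borel_measurable borel" for h :: "_ \<Rightarrow> real"
    unfolding X_def by (rule random_index(1)[OF idx T that])
  have "(\<integral>\<^sup>+w. ennreal (residual (X w)) \<partial>M)
      = (\<Sum>t<T. \<integral>\<^sup>+w. ennreal (residual (fst (run t (samples w)))) \<partial>M) / T"
    unfolding X_def by (rule random_index(2)[OF idx T measurable_residual])
  also have "\<dots> \<le> ennreal (?V + real T * noise_level \<sigma>\<xi>) / T"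
  proof (rule divide_right_mono_ennreal)
    have "(\<Sum>t<T. \<integral>\<^sup>+w. ennreal (residual (fst (run t (samples w)))) \<partial>M)
        \<le> (\<integral>\<^sup>+w. ennreal (lyapunov (run T (samples w))) \<partial>M)
          + (\<Sum>t<T. \<integral>\<^sup>+w. ennreal (residual (fst (run t (samples w)))) \<partial>M)"
      by (rule add_increasing) simp_all
    also have "\<dots> \<le> ennreal (?V + real T * noise_level \<sigma>\<xi>)"
      using telescoped_drift[of T] by (simp only: run.simps)
    finally show "(\<Sum>t<T. \<integral>\<^sup>+w. ennreal (residual (fst (run t (samples w)))) \<partial>M) \<le> \<dots>" .
  qed
  also have "\<dots> = ennreal (\<alpha> * b)"
    unfolding b ennreal_of_nat_eq_real_of_nat
    using T V by (intro divide_ennreal add_nonneg_nonneg mult_nonneg_nonneg) simp_all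
  finally have res: "(\<integral>\<^sup>+w. ennreal (residual (X w)) \<partial>M) \<le> ennreal (\<alpha> * b)" .
  have bound: "integrable M (\<lambda>w. h (X w)) \<and> (LINT w|M. h (X w)) \<le> k * b"
    if h: "h \<in> borel_measurable borel" "\<And>Y. 0 \<le> h Y" "\<And>Y. \<alpha> * h Y \<le> k * residual Y" and k: "0 \<le> k"
    for h :: "(real ^ 'd) ^ 'n \<Rightarrow> real" and k :: real
  proof -
    have "(\<integral>\<^sup>+w. ennreal (h (X w)) \<partial>M) \<le> (\<integral>\<^sup>+w. ennreal (k / \<alpha>) * ennreal (residual (X w)) \<partial>M)"
    proof (rule nn_integral_mono)
      fix w
      have "h (X w) \<le> (k / \<alpha>) * residual (X w)"
        using h(3)[of "X w"] pos by (simp add: field_simps)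
      then show "ennreal (h (X w)) \<le> ennreal (k / \<alpha>) * ennreal (residual (X w))"
        using k pos by (subst ennreal_mult[symmetric]) (auto simp: residual_nonneg intro!: ennreal_leI)
    qed
    also have "\<dots> = ennreal (k / \<alpha>) * (\<integral>\<^sup>+w. ennreal (residual (X w)) \<partial>M)"
      using X_meas[OF measurable_residual] by (intro nn_integral_cmult) simp
    also have "\<dots> \<le> ennreal (k / \<alpha>) * ennreal (\<alpha> * b)"
      using res by (rule mult_left_mono) simp
    also have "\<dots> = ennreal (k * b)"
      using k pos b0 by (subst ennreal_mult[symmetric]) auto
    finally have le: "(\<integral>\<^sup>+w. ennreal (h (X w)) \<partial>M) \<le> ennreal (k * b)" .
    have int: "integrable M (\<lambda>w. h (X w))"
      using le X_meas[OF h(1)] h(2)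
      by (intro integrableI_nonneg) (auto intro: le_less_trans)
    moreover have "ennreal (LINT w|M. h (X w)) \<le> ennreal (k * b)"
      using le int h(2) by (subst nn_integral_eq_integral[symmetric]) auto
    ultimately show ?thesis using k b0 by (simp add: ennreal_le_iff)
  qed
  have "integrable M (\<lambda>w. (norm (grad F (average (X w))))\<^sup>2) \<and> (LINT w|M. (norm (grad F (average (X w))))\<^sup>2) \<le> 8 * b"
    using pos by (intro bound[of "\<lambda>Y. (norm (grad F (average Y)))\<^sup>2"]) (auto simp: residual_def)
  then show "integrable M (\<lambda>w. (norm (grad F (average (X w))))\<^sup>2)"
    "(LINT w|M. (norm (grad F (average (X w))))\<^sup>2) \<le> 8 * b" by auto
  have "integrable M (\<lambda>w. sqnorm centering (X w)) \<and> (LINT w|M. sqnorm centering (X w)) \<le> 1 * b"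
    unfolding sqnorm_centering
    using pos by (intro bound[of "\<lambda>Y. (norm (centered Y))\<^sup>2"]) (auto simp: residual_def)
  then show "integrable M (\<lambda>w. sqnorm centering (X w))" "(LINT w|M. sqnorm centering (X w)) \<le> b" by auto
qed

end

section \<open>Orders of magnitude\<close>

lemma bigtheta_bounds:
  fixes f h :: "nat \<Rightarrow> real"
  assumes "f \<in> \<Theta>(h)" "\<forall>\<^sub>F T in sequentially. 0 < f T" "\<forall>\<^sub>F T in sequentially. 0 < h T"
  obtains k1 k2 where "0 < k1" "0 < k2" "\<forall>\<^sub>F T in sequentially. k1 * h T \<le> f T \<and> f T \<le> k2 * h T"
proof -
  have "f \<in> O(h)" "f \<in> \<Omega>(h)" using assms(1) by (simp_all add: bigtheta_def)
  then obtain k1 k2 where k: "0 < k1" "0 < k2"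
    "\<forall>\<^sub>F T in sequentially. norm (f T) \<le> k2 * norm (h T)"
    "\<forall>\<^sub>F T in sequentially. k1 * norm (h T) \<le> norm (f T)"
    by (auto elim!: landau_o.bigE landau_omega.bigE)
  have "\<forall>\<^sub>F T in sequentially. k1 * h T \<le> f T \<and> f T \<le> k2 * h T"
    using k(3,4) assms(2,3) by eventually_elim auto
  with k(1,2) show ?thesis by (rule that)
qed

lemma powr_thirds:
  fixes x :: real
  assumes "0 < x"
  shows "x powr (- 2 / 3) = (x powr (- 1 / 3))\<^sup>2" "x powr (1 / 3) = 1 / x powr (- 1 / 3)"
    "x * (x powr (- 1 / 3)) ^ 3 = 1"
proof -
  show "x powr (- 2 / 3) = (x powr (- 1 / 3))\<^sup>2"
    using assms by (simp add: powr_power)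
  show "x powr (1 / 3) = 1 / x powr (- 1 / 3)"
    by (simp add: powr_minus_divide[of x "- 1 / 3", simplified])
  have "(x powr (- 1 / 3)) ^ 3 = x powr (- 1)"
    using assms by (simp add: powr_power)
  then show "x * (x powr (- 1 / 3)) ^ 3 = 1"
    using assms by (simp add: powr_minus_divide)
qed

lemma eventually_scale_small:
  assumes "0 < b"
  shows "\<forall>\<^sub>F T in sequentially. k * real T powr (- 1 / 3) \<le> b"
proof -
  have "((\<lambda>T. real T powr (- 1 / 3)) \<longlongrightarrow> 0) sequentially"
    by (rule tendsto_neg_powr) (auto intro: filterlim_real_sequentially)
  then have "((\<lambda>T. k * real T powr (- 1 / 3)) \<longlongrightarrow> k * 0) sequentially"
    by (intro tendsto_mult tendsto_const)
  then have "\<forall>\<^sub>F T in sequentially. k * real T powr (- 1 / 3) < b"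
    using assms by (intro order_tendstoD(2)) auto
  then show ?thesis by eventually_elim simp
qed

text \<open>
  All four parameters are constant multiples of powers of \<open>\<epsilon>\<close>. The constant \<open>t\<close> replaces the
  maximum in the condition on \<open>\<theta>\<close> by a sum, and \<open>m\<close> bounds the minimum in the condition on \<open>\<alpha>\<close> from
  below using \<open>\<epsilon> \<le> 1\<close>.
\<close>

lemma rate_choice_exists:
  assumes n: "0 < n" and rho: "0 < \<rho>min" "0 < \<rho>max" "0 < \<rho>t" and \<delta>: "0 < \<delta>" and r: "0 < r"
  shows "\<exists>a \<alpha> \<theta> \<eta> \<gamma>. rate_choice n L \<rho>min \<rho>max \<rho>t \<sigma>A \<delta> r a \<alpha> \<theta> \<eta> \<gamma>"
proof -
  define \<epsilon> where "\<epsilon> T = real T powr (- 1 / 3)" for T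
  define t where "t = 4 / \<rho>min * (2 * L\<^sup>2 / real n + 2048 * \<rho>t / (\<delta> * \<rho>min) + L\<^sup>2)"
  define m where "m = min (Min {\<rho>min\<^sup>2 / (\<rho>max\<^sup>2 * \<rho>t), 1 / (72 * real n * \<rho>t), \<rho>min / (2 * \<rho>t)})
    (if \<sigma>A = 0 then 1 else \<rho>min\<^sup>2 / (\<sigma>A\<^sup>2 * \<rho>max * \<rho>t))"
  define k where "k = \<delta> / (256 * t) * m"
  have t0: "0 < t"
    unfolding t_def using n rho \<delta> by (intro mult_pos_pos add_pos_nonneg add_nonneg_pos) auto
  have m0: "0 < m" unfolding m_def using n rho by auto
  have k0: "0 < k" unfolding k_def using t0 m0 \<delta> by simp
  have steps: "step_sizes n L \<rho>min \<rho>max \<rho>t \<sigma>A \<delta> r (\<epsilon> T) (k * (\<epsilon> T)\<^sup>2) (t * (1 / \<epsilon> T))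
      (r * (1 / r * \<epsilon> T) * \<delta> / (8 * \<rho>t)) (1 / r * \<epsilon> T)" if T: "1 \<le> T" for T
  proof -
    define e where "e = \<epsilon> T"
    have e: "0 < e" "e \<le> 1"
      using T powr_mono[of "- 1 / 3" 0 "real T"] by (simp_all add: e_def \<epsilon>_def)
    have re: "r * (1 / r * e) = e" using r by simp
    have max: "4 / \<rho>min * Max {2 * L\<^sup>2 / (real n * e), 2048 * \<rho>t / (e * \<delta> * \<rho>min), L\<^sup>2} \<le> t * (1 / e)"
    proof -
      have "Max {2 * L\<^sup>2 / (real n * e), 2048 * \<rho>t / (e * \<delta> * \<rho>min), L\<^sup>2}
          \<le> (2 * L\<^sup>2 / real n + 2048 * \<rho>t / (\<delta> * \<rho>min) + L\<^sup>2) * (1 / e)"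
      proof -
        have A: "0 \<le> 2 * L\<^sup>2 / real n * (1 / e)" "0 \<le> 2048 * \<rho>t / (\<delta> * \<rho>min) * (1 / e)" "0 \<le> L\<^sup>2 * (1 / e)"
          using e rho \<delta> by auto
        have B: "L\<^sup>2 \<le> L\<^sup>2 * (1 / e)" 
          using mult_left_mono[of 1 "1 / e" "L\<^sup>2"] e by simp
        have C: "2 * L\<^sup>2 / (real n * e) = 2 * L\<^sup>2 / real n * (1 / e)"
          "2048 * \<rho>t / (e * \<delta> * \<rho>min) = 2048 * \<rho>t / (\<delta> * \<rho>min) * (1 / e)" by (simp_all add: mult_ac)
        show ?thesis unfolding C distrib_right using A B by simp
      qed
      then have "4 / \<rho>min * Max {2 * L\<^sup>2 / (real n * e), 2048 * \<rho>t / (e * \<delta> * \<rho>min), L\<^sup>2}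
          \<le> 4 / \<rho>min * ((2 * L\<^sup>2 / real n + 2048 * \<rho>t / (\<delta> * \<rho>min) + L\<^sup>2) * (1 / e))"
        using rho by (intro mult_left_mono) auto
      then show ?thesis unfolding t_def by (simp only: mult.assoc)
    qed
    have K: "e * \<delta> / (256 * (t * (1 / e))) = \<delta> / (256 * t) * e\<^sup>2"
      using e t0 by (simp add: power2_eq_square)
    have K0: "0 \<le> \<delta> / (256 * t) * e\<^sup>2" using \<delta> t0 by simp
    have \<alpha>: "k * e\<^sup>2 = \<delta> / (256 * t) * e\<^sup>2 * m" by (simp add: k_def)
    have min: "m \<le> Min {\<rho>min\<^sup>2 / (\<rho>max\<^sup>2 * \<rho>t), 1 / (72 * real n * e * \<rho>t), \<rho>min / (2 * \<rho>t * e)}"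
    proof -
      have "1 / (72 * real n * \<rho>t) \<le> 1 / (72 * real n * e * \<rho>t)"
        using e n rho by (intro divide_left_mono mult_right_mono mult_pos_pos) (auto simp: mult_left_le)
      moreover have "\<rho>min / (2 * \<rho>t) \<le> \<rho>min / (2 * \<rho>t * e)"
        using e rho by (intro divide_left_mono mult_pos_pos) (auto simp: mult_left_le)
      ultimately show ?thesis unfolding m_def by (auto simp: min_le_iff_disj)
    qed
    have sA: "m \<le> \<rho>min\<^sup>2 / (\<sigma>A\<^sup>2 * \<rho>max * \<rho>t)" if "\<sigma>A \<noteq> 0"
      using that unfolding m_def by simp
    show ?thesis
      unfolding step_sizes_def e_def[symmetric] re K \<alpha>
      using e k0 t0 r \<delta> rho max m0 mult_left_mono[OF min K0] mult_left_mono[OF sA K0]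
      by (auto simp: divide_simps)
  qed
  have "rate_choice n L \<rho>min \<rho>max \<rho>t \<sigma>A \<delta> r \<epsilon> (\<lambda>T. k * (\<epsilon> T)\<^sup>2) (\<lambda>T. t * (1 / \<epsilon> T))
      (\<lambda>T. r * (1 / r * \<epsilon> T) * \<delta> / (8 * \<rho>t)) (\<lambda>T. 1 / r * \<epsilon> T)"
  proof -
    have 1: "\<forall>\<^sub>F T in sequentially. k * (\<epsilon> T)\<^sup>2 = k * real T powr (- 2 / 3)"
      "\<forall>\<^sub>F T in sequentially. t * (1 / \<epsilon> T) = t * real T powr (1 / 3)"
      by (rule eventually_mono[OF eventually_gt_at_top[of 0]],
          simp only: \<epsilon>_def powr_thirds of_nat_0_less_iff)+
    have "(\<lambda>T. k * (\<epsilon> T)\<^sup>2) \<in> \<Theta>(\<lambda>T. real T powr (- 2 / 3))"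
      using k0 by (subst landau_theta.in_cong[OF 1(1)]) simp
    moreover have "(\<lambda>T. t * (1 / \<epsilon> T)) \<in> \<Theta>(\<lambda>T. real T powr (1 / 3))"
      using t0 by (subst landau_theta.in_cong[OF 1(2)]) simp
    moreover have "(\<lambda>T. 1 / r * \<epsilon> T) \<in> \<Theta>(\<lambda>T. real T powr (- 1 / 3))"
      using r by (simp add: \<epsilon>_def[abs_def])
    moreover have "\<epsilon> \<in> \<Theta>(\<lambda>T. real T powr (- 1 / 3))"
      by (simp add: \<epsilon>_def[abs_def])
    moreover have "\<forall>\<^sub>F T in sequentially. step_sizes n L \<rho>min \<rho>max \<rho>t \<sigma>A \<delta> r (\<epsilon> T) (k * (\<epsilon> T)\<^sup>2) (t * (1 / \<epsilon> T))
      (r * (1 / r * \<epsilon> T) * \<delta> / (8 * \<rho>t)) (1 / r * \<epsilon> T)"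
      by (rule eventually_mono[OF eventually_ge_at_top[of 1] steps])
    ultimately show ?thesis
      unfolding rate_choice_def by blast
  qed
  then show ?thesis by blast
qed

context stochastic_problem
begin

text \<open>
  The ratio \<open>c = \<eta> / (\<alpha> \<theta>)\<close> of two quantities of order \<open>\<epsilon>\<close> is bounded by \<open>cM\<close>, so the constants may be
  built from \<open>cM\<close>; every requirement then holds once \<open>\<epsilon>\<close> is small compared with a constant.
\<close>

lemma tuned_parameters:
  fixes a1 a2 t1 t2 g2 cM M M2 M3 \<sigma>A a \<alpha> \<theta> \<eta> \<gamma> \<epsilon> :: real
  assumes cM: "cM = r * g2 * \<delta> / (8 * \<rho>t * (a1 * t1))"
    and M: "M = 5 * (1 + L\<^sup>2 + cM\<^sup>2) + 12 * (L\<^sup>2 + L ^ 4)"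
    and M2: "M2 = 8 / \<rho>min + \<rho>max / \<rho>t\<^sup>2" and M3: "M3 = M2 * M * (1 + 2 * M)"
    and ss: "step_sizes CARD('n) L \<rho>min \<rho>max \<rho>t \<sigma>A \<delta> r a \<alpha> \<theta> \<eta> \<gamma>"
    and const: "0 < a1" "0 < a2" "0 < t1" "0 < t2" "0 < g2" "0 < \<epsilon>" "\<epsilon> \<le> 1"
    and size: "a1 * \<epsilon>\<^sup>2 \<le> \<alpha>" "\<alpha> \<le> a2 * \<epsilon>\<^sup>2" "t1 \<le> \<theta> * \<epsilon>" "\<theta> * \<epsilon> \<le> t2" "\<gamma> \<le> g2 * \<epsilon>"
    and small: "\<epsilon> \<le> 8 * \<rho>t * t1" "8 * (a2 * t2) * \<rho>t\<^sup>2 * \<epsilon> \<le> \<rho>min" "a2 * t2 * \<rho>min * \<epsilon> \<le> 1"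
      "6 * L * a2 * \<epsilon> \<le> 1" "g2 * \<epsilon> \<le> 1" "64 * (L\<^sup>2 + 1) * M3 * real CARD('n) * \<epsilon> \<le> \<rho>min * t1\<^sup>2"
  shows "sampled_problem E g F L fstar \<rho>min \<rho>max \<rho>t \<alpha> \<theta> \<eta> (r * \<gamma> * \<delta>) (\<eta> / (\<alpha> * \<theta>)) M M2 M3
      P Pa act R fs \<sigma> \<delta> r \<gamma>"
    and "\<eta> / (\<alpha> * \<theta>) \<le> cM"
proof -
  let ?n = "real CARD('n)"
  have pos: "0 < \<alpha>" "0 < \<theta>" "0 < \<gamma>" and \<gamma>: "\<gamma> \<le> 1 / r" and \<eta>: "\<eta> = r * \<gamma> * \<delta> / (8 * \<rho>t)"
    using ss by (auto simp: step_sizes_def)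
  have \<rho>max: "0 < \<rho>max" using rho by simp
  have r\<gamma>: "r * \<gamma> \<le> 1" using \<gamma> contraction by (simp add: field_simps)
  have q: "0 < r * \<gamma> * \<delta>" "r * \<gamma> * \<delta> \<le> 1"
    using contraction pos r\<gamma> by (simp_all add: mult_le_one)
  have \<tau>l: "a1 * t1 * \<epsilon> \<le> \<alpha> * \<theta>"
  proof -
    have "(a1 * \<epsilon>\<^sup>2) * t1 \<le> \<alpha> * (\<theta> * \<epsilon>)" using size const pos by (intro mult_mono) auto
    then have "(a1 * t1 * \<epsilon>) * \<epsilon> \<le> (\<alpha> * \<theta>) * \<epsilon>" by (simp add: power2_eq_square mult_ac)
    then show ?thesis using const by simp
  qed
  have \<tau>u: "\<alpha> * \<theta> \<le> a2 * t2 * \<epsilon>"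
  proof -
    have "\<alpha> * (\<theta> * \<epsilon>) \<le> (a2 * \<epsilon>\<^sup>2) * t2" using size const pos by (intro mult_mono) auto
    then have "(\<alpha> * \<theta>) * \<epsilon> \<le> (a2 * t2 * \<epsilon>) * \<epsilon>" by (simp add: power2_eq_square mult_ac)
    then show ?thesis using const by simp
  qed
  have \<tau>: "0 < \<alpha> * \<theta>" using pos by simp
  have c0: "0 < \<eta> / (\<alpha> * \<theta>)" using \<tau> q rho by (simp add: \<eta>)
  show c: "\<eta> / (\<alpha> * \<theta>) \<le> cM"
  proof -
    have "\<eta> / (\<alpha> * \<theta>) \<le> (r * (g2 * \<epsilon>) * \<delta> / (8 * \<rho>t)) / (a1 * t1 * \<epsilon>)"
      unfolding \<eta> using size \<tau>l contraction rho pos const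
      by (intro frac_le divide_right_mono mult_right_mono mult_left_mono) auto
    also have "\<dots> = cM" using const by (simp add: cM)
    finally show ?thesis .
  qed
  have \<epsilon>2: "\<epsilon>\<^sup>2 \<le> \<epsilon>" using const by (simp add: power2_eq_square mult_left_le_one_le)
  have M0: "0 < M"
    unfolding M by (intro add_pos_nonneg mult_pos_pos mult_nonneg_nonneg add_nonneg_nonneg) auto
  have M30: "0 < M3"
    using M0 rho by (simp add: M3 M2 add_pos_nonneg)
  have Kpos: "0 \<le> 64 * (L\<^sup>2 + 1) * M3 * ?n" using M30 by simp
  have big: "64 * (L\<^sup>2 + 1) * M3 * ?n \<le> \<rho>min * \<theta>\<^sup>2"
  proof -
    have "(64 * (L\<^sup>2 + 1) * M3 * ?n) * \<epsilon>\<^sup>2 \<le> (64 * (L\<^sup>2 + 1) * M3 * ?n) * \<epsilon>"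
      using \<epsilon>2 Kpos by (rule mult_left_mono)
    also have "\<dots> \<le> \<rho>min * t1\<^sup>2" by (rule small)
    also have "\<dots> \<le> \<rho>min * (\<theta> * \<epsilon>)\<^sup>2" using size const rho by (intro mult_left_mono power_mono) auto
    also have "\<dots> = \<rho>min * \<theta>\<^sup>2 * \<epsilon>\<^sup>2" by (simp add: power_mult_distrib)
    finally show ?thesis using const by simp
  qed
  have "8 * M3 \<le> 64 * (L\<^sup>2 + 1) * M3 * ?n"
  proof -
    have "8 * 1 \<le> 64 * (L\<^sup>2 + 1) * ?n"
      using mult_mono[of 8 "64 * (L\<^sup>2 + 1)" 1 ?n] by (simp add: Suc_leI)
    from mult_right_mono[OF this less_imp_le[OF M30]] show ?thesis by (simp add: mult_ac)
  qed
  with big have big8: "8 * M3 \<le> \<rho>min * \<theta>\<^sup>2" by linarith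
  have \<tau>\<rho>: "\<alpha> * \<theta> * \<rho>t \<le> r * \<gamma> * \<delta> / 256 * (\<rho>min / \<rho>max)\<^sup>2"
  proof -
    have "\<alpha> \<le> r * \<gamma> * \<delta> / (256 * \<theta>) *
       Min {\<rho>min\<^sup>2 / (\<rho>max\<^sup>2 * \<rho>t), 1 / (72 * ?n * a * \<rho>t), \<rho>min / (2 * \<rho>t * a)}"
      using ss by (simp add: step_sizes_def)
    also have "\<dots> \<le> r * \<gamma> * \<delta> / (256 * \<theta>) * (\<rho>min\<^sup>2 / (\<rho>max\<^sup>2 * \<rho>t))"
      using q pos by (intro mult_left_mono Min_le) auto
    finally have "\<alpha> * (\<theta> * \<rho>t) \<le> r * \<gamma> * \<delta> / (256 * \<theta>) * (\<rho>min\<^sup>2 / (\<rho>max\<^sup>2 * \<rho>t)) * (\<theta> * \<rho>t)"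
      using pos rho by (intro mult_right_mono) auto
    also have "\<dots> = r * \<gamma> * \<delta> / 256 * (\<rho>min / \<rho>max)\<^sup>2"
      using pos rho by (simp add: power_divide)
    finally show ?thesis by (simp add: mult.assoc)
  qed
  have "\<eta> / \<theta> \<le> 1"
  proof -
    have "\<eta> \<le> 1 / (8 * \<rho>t)" unfolding \<eta> using q rho by (intro divide_right_mono) auto
    also have "\<dots> \<le> \<theta>"
    proof -
      have "8 * \<rho>t * t1 \<le> 8 * \<rho>t * (\<theta> * \<epsilon>)"
        using size(3) rho by (intro mult_left_mono) auto
      with small(1) have "\<epsilon> * 1 \<le> (8 * \<rho>t) * (\<theta> * \<epsilon>)" by linarith
      then have "1 \<le> 8 * \<rho>t * \<theta>" using const by (simp add: mult_ac)
      then show ?thesis using rho by (simp add: field_simps)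
    qed
    finally show ?thesis using pos by simp
  qed
  moreover have "5 * (1 + L\<^sup>2 + (\<eta> / (\<alpha> * \<theta>))\<^sup>2) + 12 * (L\<^sup>2 + L ^ 4) \<le> M"
    unfolding M using c c0 by (simp add: power_mono)
  moreover have "8 * (\<alpha> * \<theta>) * \<rho>t\<^sup>2 \<le> \<rho>min"
  proof -
    have "8 * (\<alpha> * \<theta>) * \<rho>t\<^sup>2 \<le> 8 * (a2 * t2 * \<epsilon>) * \<rho>t\<^sup>2" using \<tau>u by (intro mult_right_mono) auto
    then show ?thesis using small(2) by (simp add: mult_ac)
  qed
  moreover have "\<alpha> * \<theta> * \<rho>min \<le> 1"
  proof -
    have "\<alpha> * \<theta> * \<rho>min \<le> (a2 * t2 * \<epsilon>) * \<rho>min" using \<tau>u rho by (intro mult_right_mono) auto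
    then show ?thesis using small(3) by (simp add: mult_ac)
  qed
  moreover have "6 * L * \<alpha> \<le> 1"
  proof -
    have "6 * L * \<alpha> \<le> 6 * L * (a2 * \<epsilon>)"
    proof (rule mult_left_mono)
      show "\<alpha> \<le> a2 * \<epsilon>" using size(2) mult_left_mono[OF \<epsilon>2, of a2] const by linarith
    qed (use L_nonneg in simp)
    then show ?thesis using small(4) by (simp add: mult_ac)
  qed
  moreover have "\<gamma> \<le> 1" using size small by linarith
  ultimately show "sampled_problem E g F L fstar \<rho>min \<rho>max \<rho>t \<alpha> \<theta> \<eta> (r * \<gamma> * \<delta>) (\<eta> / (\<alpha> * \<theta>)) M M2 M3
      P Pa act R fs \<sigma> \<delta> r \<gamma>"
    using pos q \<eta> M2 M3 \<tau>\<rho> big big8 r\<gamma> by unfold_locales auto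
qed

end

context sampled_problem
begin

lemma wB_le: "wB \<le> \<rho>max / (8 * \<rho>t)"
proof -
  have "wB = 32 * \<rho>max / (q * \<rho>t) * (\<tau> * \<rho>t)" using rho pos by simp
  also have "\<dots> \<le> 32 * \<rho>max / (q * \<rho>t) * (q / 256)"
    using \<tau>_le' \<rho>max_pos pos rho by (intro mult_left_mono) auto
  also have "\<dots> = \<rho>max / (8 * \<rho>t)" using pos by simp
  finally show ?thesis .
qed

text \<open>
  Each of the three contributions, from the initial state, the gradient noise and the channel
  noise, is of order \<open>\<epsilon>\<close>. The constant depends on the parameter sequences only through the
  constants of their orders of magnitude.
\<close>

lemma bias_bound:
  fixes a1 a2 t1 g2 cM \<epsilon> :: real
  assumes const: "0 < a1" "0 < a2" "0 < t1" "0 < g2" "0 < \<epsilon>" "\<epsilon> \<le> 1"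
    and size: "a1 * \<epsilon>\<^sup>2 \<le> \<alpha>" "\<alpha> \<le> a2 * \<epsilon>\<^sup>2" "t1 \<le> \<theta> * \<epsilon>" "\<gamma> \<le> g2 * \<epsilon>" "c \<le> cM"
    and T: "x * \<epsilon> ^ 3 = 1"
    and W: "W = 8 * (L\<^sup>2 + 1) / (t1 * \<rho>min)"
    and V: "V = F (average X) - fstar + W * ((norm (centered X))\<^sup>2 + \<rho>max / (8 * \<rho>t) * (norm (X - Xh))\<^sup>2
      + 2 * M2 * M / t1 * (3 * ((norm lt)\<^sup>2 + cM\<^sup>2 * (norm (centered X))\<^sup>2 + (norm (centered (meangrad X)))\<^sup>2)))"
    and C: "C = V / a1 + (3 * L * a2 / 2 + W * M3 / t1) * (\<Sum>i\<in>UNIV. (\<sigma> i)\<^sup>2)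
      + W * (\<rho>max / (8 * \<rho>t)) * g2\<^sup>2 * (1 + 2 * r / \<delta>) / a1"
  shows "lyapunov (X, lt, Xh) / (\<alpha> * x) + noise_level \<sigma>\<xi> / \<alpha> \<le> C * (1 + \<sigma>\<xi>\<^sup>2) * \<epsilon>"
proof -
  have W0: "0 < W" unfolding W using const rho by (intro divide_pos_pos mult_pos_pos add_nonneg_pos) auto
  have \<epsilon>2: "\<epsilon>\<^sup>2 \<le> \<epsilon>" using const by (simp add: power2_eq_square mult_left_le_one_le)
  have t: "1 / \<theta> \<le> \<epsilon> / t1" using size(3) const pos by (simp add: field_simps)
  have t': "1 / \<theta> \<le> 1 / t1"
    using t divide_right_mono[OF const(6), of t1] const by linarith
  have wF: "wF \<le> W * \<epsilon>"
  proof -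
    have "wF = 8 * (L\<^sup>2 + 1) / \<rho>min * (1 / \<theta>)" by simp
    also have "\<dots> \<le> 8 * (L\<^sup>2 + 1) / \<rho>min * (\<epsilon> / t1)"
      using t rho by (intro mult_left_mono) auto
    finally show ?thesis by (simp add: W mult_ac)
  qed
  have wF': "wF \<le> W" using wF mult_left_mono[OF const(6), of W] W0 by linarith
  have wD: "wD \<le> 2 * M2 * M / t1"
  proof -
    have "wD = 2 * M2 * M * (1 / c * (1 / \<theta>))" by simp
    also have "\<dots> \<le> 2 * M2 * M * (1 * (1 / t1))"
      using constants_pos c_ge c_pos t' pos by (intro mult_left_mono mult_mono) auto
    finally show ?thesis by simp
  qed
  have L0: "lyapunov (X, lt, Xh) \<le> V"
  proof -
    have h: "(norm (hetero c X lt))\<^sup>2 \<le> 3 * ((norm lt)\<^sup>2 + cM\<^sup>2 * (norm (centered X))\<^sup>2 + (norm (centered (meangrad X)))\<^sup>2)"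
    proof -
      have "c\<^sup>2 * (norm (centered X))\<^sup>2 \<le> cM\<^sup>2 * (norm (centered X))\<^sup>2"
        using size(5) c_pos by (intro mult_right_mono power_mono) auto
      then show ?thesis
        using norm_add3_le[of lt "c *\<^sub>R centered X" "centered (meangrad X)"]
        by (simp add: hetero_def power_mult_distrib)
    qed
    have "wF * ((norm (centered X))\<^sup>2 + wB * (norm (X - Xh))\<^sup>2 + wD * (norm (hetero c X lt))\<^sup>2)
      \<le> W * ((norm (centered X))\<^sup>2 + \<rho>max / (8 * \<rho>t) * (norm (X - Xh))\<^sup>2
      + 2 * M2 * M / t1 * (3 * ((norm lt)\<^sup>2 + cM\<^sup>2 * (norm (centered X))\<^sup>2 + (norm (centered (meangrad X)))\<^sup>2)))"
      by (intro mult_mono[OF wF'] add_mono mult_mono[OF wD h] mult_right_mono[OF wB_le] order_refl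
          less_imp_le[OF W0] zero_le_power2 add_nonneg_nonneg mult_nonneg_nonneg
          less_imp_le[OF weights_pos(1)] less_imp_le[OF weights_pos(2)])
        (use constants_pos const in auto)
    then show ?thesis by (simp only: lyapunov_def prod.case V)
  qed
  have V0: "0 \<le> V" using L0 lyapunov_nonneg[of "(X, lt, Xh)"] by linarith
  have x: "x = 1 / \<epsilon> ^ 3" using T const by (simp add: field_simps)
  have 1: "lyapunov (X, lt, Xh) / (\<alpha> * x) \<le> V / a1 * \<epsilon>"
  proof -
    have "lyapunov (X, lt, Xh) / (\<alpha> * x) \<le> V / (a1 * \<epsilon>\<^sup>2 * x)"
      using L0 V0 size(1) const pos by (intro frac_le mult_right_mono) (auto simp: x)
    also have "\<dots> = V / a1 * \<epsilon>" using const by (simp add: x power2_eq_square power3_eq_cube)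
    finally show ?thesis .
  qed
  have S2: "0 \<le> S2" by (simp add: S2_def sum_nonneg)
  have 2: "(3 * L * \<alpha>\<^sup>2 / 2 + wF * (\<alpha> / \<theta>) * M3) * S2 / \<alpha> \<le> (3 * L * a2 / 2 + W * M3 / t1) * S2 * \<epsilon>"
  proof -
    have "(3 * L * \<alpha>\<^sup>2 / 2 + wF * (\<alpha> / \<theta>) * M3) * S2 / \<alpha> = (3 * L / 2 * \<alpha> + wF * (1 / \<theta>) * M3) * S2"
    proof -
      have "(3 * L * \<alpha>\<^sup>2 / 2 + w * (\<alpha> / \<theta>) * M3) * S2 / \<alpha> = (3 * L / 2 * \<alpha> + w * (1 / \<theta>) * M3) * S2" for w
        using pos by (simp add: field_simps power2_eq_square)
      then show ?thesis .
    qed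
    also have "\<dots> \<le> (3 * L / 2 * (a2 * \<epsilon>) + W * (\<epsilon> / t1) * M3) * S2"
    proof (intro mult_right_mono[OF _ S2] add_mono mult_left_mono mult_right_mono mult_mono[OF wF' t])
      show "\<alpha> \<le> a2 * \<epsilon>" using size(2) mult_left_mono[OF \<epsilon>2, of a2] const by linarith
    qed (use L_nonneg W0 constants_pos pos in auto)
    also have "\<dots> = (3 * L * a2 / 2 + W * M3 / t1) * S2 * \<epsilon>"
      by (simp add: algebra_simps)
    finally show ?thesis .
  qed
  have 3: "wF * wB * (\<gamma>\<^sup>2 * (1 + 2 * r / \<delta>) * \<sigma>\<xi>\<^sup>2) / \<alpha>
      \<le> W * (\<rho>max / (8 * \<rho>t)) * g2\<^sup>2 * (1 + 2 * r / \<delta>) / a1 * \<sigma>\<xi>\<^sup>2 * \<epsilon>"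
  proof -
    have "\<gamma>\<^sup>2 / \<alpha> \<le> (g2 * \<epsilon>)\<^sup>2 / (a1 * \<epsilon>\<^sup>2)"
      using size const \<gamma> by (intro frac_le power_mono) auto
    also have "\<dots> = g2\<^sup>2 / a1" using const by (simp add: power_mult_distrib)
    finally have g: "\<gamma>\<^sup>2 / \<alpha> \<le> g2\<^sup>2 / a1" .
    have k0: "0 \<le> (1 + 2 * r / \<delta>) * \<sigma>\<xi>\<^sup>2" using contraction by simp
    have "wF * wB * (\<gamma>\<^sup>2 * (1 + 2 * r / \<delta>) * \<sigma>\<xi>\<^sup>2) / \<alpha> = (wF * wB) * (\<gamma>\<^sup>2 / \<alpha>) * ((1 + 2 * r / \<delta>) * \<sigma>\<xi>\<^sup>2)"
      by simp
    also have "\<dots> \<le> (W * \<epsilon> * (\<rho>max / (8 * \<rho>t))) * (g2\<^sup>2 / a1) * ((1 + 2 * r / \<delta>) * \<sigma>\<xi>\<^sup>2)"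
      by (intro mult_right_mono[OF _ k0] mult_mono[OF _ g] mult_mono[OF wF wB_le]
          mult_nonneg_nonneg less_imp_le[OF W0] less_imp_le[OF weights_pos(1)])
        (use W0 const \<rho>max_pos rho pos in auto)
    also have "\<dots> = W * (\<rho>max / (8 * \<rho>t)) * g2\<^sup>2 * (1 + 2 * r / \<delta>) / a1 * \<sigma>\<xi>\<^sup>2 * \<epsilon>"
      by simp
    finally show ?thesis .
  qed
  have "noise_level \<sigma>\<xi> / \<alpha> = (3 * L * \<alpha>\<^sup>2 / 2 + wF * (\<alpha> / \<theta>) * M3) * S2 / \<alpha>
      + wF * wB * (\<gamma>\<^sup>2 * (1 + 2 * r / \<delta>) * \<sigma>\<xi>\<^sup>2) / \<alpha>"
    unfolding noise_level_def by (rule add_divide_distrib)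
  with 1 2 3 have "lyapunov (X, lt, Xh) / (\<alpha> * x) + noise_level \<sigma>\<xi> / \<alpha>
      \<le> (V / a1 + (3 * L * a2 / 2 + W * M3 / t1) * S2) * \<epsilon>
        + W * (\<rho>max / (8 * \<rho>t)) * g2\<^sup>2 * (1 + 2 * r / \<delta>) / a1 * \<sigma>\<xi>\<^sup>2 * \<epsilon>"
    by (simp only: distrib_right)
  also have "\<dots> \<le> C * (1 + \<sigma>\<xi>\<^sup>2) * \<epsilon>"
  proof -
    have A: "0 \<le> V / a1 + (3 * L * a2 / 2 + W * M3 / t1) * S2"
      using V0 S2 const L_nonneg W0 constants_pos by (intro add_nonneg_nonneg mult_nonneg_nonneg divide_nonneg_pos) auto
    have B: "0 \<le> W * (\<rho>max / (8 * \<rho>t)) * g2\<^sup>2 * (1 + 2 * r / \<delta>) / a1"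
      using W0 const \<rho>max_pos rho contraction by (intro divide_nonneg_pos mult_nonneg_nonneg) auto
    have "A * \<epsilon> + B * \<sigma>\<xi>\<^sup>2 * \<epsilon> \<le> (A + B) * (1 + \<sigma>\<xi>\<^sup>2) * \<epsilon>" if "0 \<le> A" "0 \<le> B" for A B
    proof -
      have "0 \<le> A * \<sigma>\<xi>\<^sup>2 * \<epsilon> + B * \<epsilon>" using that const by simp
      then show ?thesis by (simp add: algebra_simps)
    qed
    from this[OF A B] show ?thesis unfolding C S2_def .
  qed
  finally show ?thesis .
qed

end

section \<open>The rate\<close>

context stochastic_problem
begin

text \<open>
  The constants are fixed before the number of steps and the probability space are, since they
  depend on neither; the process is interpreted only afterwards.
\<close>

lemma rate:
  fixes X0 Xh0 :: "(real ^ 'd) ^ 'n" and dual0 :: "(real ^ 'd) ^ ('n \<times> 'n)"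
  assumes rc: "rate_choice CARD('n) L \<rho>min \<rho>max \<rho>t \<sigma>A \<delta> r a \<alpha> \<theta> \<eta> \<gamma>"
  shows "\<exists>C T0. \<forall>T\<ge>T0. \<forall>\<sigma>\<xi>.
    \<forall>(Mq::'q measure) (Q::(real ^ 'd) ^ 'n \<Rightarrow> 'q \<Rightarrow> (real ^ 'd) ^ 'n) (M::'w measure) xi xa xq idx.
      noisy_compressor \<delta> r \<sigma>\<xi> Mq Q \<longrightarrow> fresh_samples M P Pa Mq xi xa xq \<longrightarrow>
      uniform_index M P Pa Mq xi xa xq T idx \<longrightarrow>
      (let X = (\<lambda>t w. fst (ticopd fs E act Q (\<alpha> T) (\<theta> T) (\<eta> T) (\<gamma> T) X0 dual0 Xh0
            (\<lambda>t i. xi t i w) (\<lambda>t. xa t w) (\<lambda>t. xq t w) t));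
           G = (\<lambda>w. (norm (grad F (average (X (idx w) w))))\<^sup>2);
           H = (\<lambda>w. sqnorm centering (X (idx w) w));
           b = C * (1 + \<sigma>\<xi>\<^sup>2) * (1 / real T powr (1 / 3))
       in integrable M G \<and> integrable M H \<and> (LINT w|M. G w) \<le> 8 * b \<and> (LINT w|M. H w) \<le> b)"
proof -
  define \<epsilon> where "\<epsilon> T = real T powr (- 1 / 3)" for T
  have ss: "\<forall>\<^sub>F T in sequentially. step_sizes CARD('n) L \<rho>min \<rho>max \<rho>t \<sigma>A \<delta> r (a T) (\<alpha> T) (\<theta> T) (\<eta> T) (\<gamma> T)"
    using rc by (simp add: rate_choice_def)
  then have evpos: "\<forall>\<^sub>F T in sequentially. 0 < \<alpha> T" "\<forall>\<^sub>F T in sequentially. 0 < \<theta> T" "\<forall>\<^sub>F T in sequentially. 0 < \<gamma> T"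
    by (auto elim!: eventually_mono simp: step_sizes_def)
  have powpos: "\<forall>\<^sub>F T in sequentially. 0 < real T powr p" for p
    using eventually_gt_at_top[of 0] by eventually_elim simp
  obtain a1 a2 where a: "0 < a1" "0 < a2"
    "\<forall>\<^sub>F T in sequentially. a1 * real T powr (- 2 / 3) \<le> \<alpha> T \<and> \<alpha> T \<le> a2 * real T powr (- 2 / 3)"
    using bigtheta_bounds[OF _ evpos(1) powpos, of "- 2 / 3"] rc by (auto simp: rate_choice_def)
  obtain t1 t2 where t: "0 < t1" "0 < t2"
    "\<forall>\<^sub>F T in sequentially. t1 * real T powr (1 / 3) \<le> \<theta> T \<and> \<theta> T \<le> t2 * real T powr (1 / 3)"
    using bigtheta_bounds[OF _ evpos(2) powpos, of "1 / 3"] rc by (auto simp: rate_choice_def)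
  obtain g1 g2 where g: "0 < g1" "0 < g2"
    "\<forall>\<^sub>F T in sequentially. g1 * real T powr (- 1 / 3) \<le> \<gamma> T \<and> \<gamma> T \<le> g2 * real T powr (- 1 / 3)"
    using bigtheta_bounds[OF _ evpos(3) powpos, of "- 1 / 3"] rc by (auto simp: rate_choice_def)
  define cM where "cM = r * g2 * \<delta> / (8 * \<rho>t * (a1 * t1))"
  define K where "K = 5 * (1 + L\<^sup>2 + cM\<^sup>2) + 12 * (L\<^sup>2 + L ^ 4)"
  define M2 where "M2 = 8 / \<rho>min + \<rho>max / \<rho>t\<^sup>2"
  define M3 where "M3 = M2 * K * (1 + 2 * K)"
  define lt0 where "lt0 = kron_id (transpose (incidence E)) dual0"
  define W where "W = 8 * (L\<^sup>2 + 1) / (t1 * \<rho>min)"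
  define V where "V = F (average X0) - fstar + W * ((norm (centered X0))\<^sup>2 + \<rho>max / (8 * \<rho>t) * (norm (X0 - Xh0))\<^sup>2
      + 2 * M2 * K / t1 * (3 * ((norm lt0)\<^sup>2 + cM\<^sup>2 * (norm (centered X0))\<^sup>2 + (norm (centered (meangrad X0)))\<^sup>2)))"
  define C where "C = V / a1 + (3 * L * a2 / 2 + W * M3 / t1) * (\<Sum>i\<in>UNIV. (\<sigma> i)\<^sup>2)
      + W * (\<rho>max / (8 * \<rho>t)) * g2\<^sup>2 * (1 + 2 * r / \<delta>) / a1"
  have ev_small: "\<forall>\<^sub>F T in sequentially. k * \<epsilon> T \<le> b" if "0 < b" for k b
    unfolding \<epsilon>_def by (rule eventually_scale_small[OF that])
  have b1: "0 < 8 * \<rho>t * t1" and b2: "0 < \<rho>min * t1\<^sup>2" using rho t by simp_all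
  have "\<forall>\<^sub>F T in sequentially. 0 < T \<and> 0 < \<epsilon> T \<and> \<epsilon> T \<le> 1
      \<and> a1 * (\<epsilon> T)\<^sup>2 \<le> \<alpha> T \<and> \<alpha> T \<le> a2 * (\<epsilon> T)\<^sup>2 \<and> t1 \<le> \<theta> T * \<epsilon> T \<and> \<theta> T * \<epsilon> T \<le> t2 \<and> \<gamma> T \<le> g2 * \<epsilon> T
      \<and> real T * (\<epsilon> T) ^ 3 = 1
      \<and> \<epsilon> T \<le> 8 * \<rho>t * t1 \<and> 8 * (a2 * t2) * \<rho>t\<^sup>2 * \<epsilon> T \<le> \<rho>min \<and> a2 * t2 * \<rho>min * \<epsilon> T \<le> 1
      \<and> 6 * L * a2 * \<epsilon> T \<le> 1 \<and> g2 * \<epsilon> T \<le> 1 \<and> 64 * (L\<^sup>2 + 1) * M3 * real CARD('n) * \<epsilon> T \<le> \<rho>min * t1\<^sup>2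
      \<and> step_sizes CARD('n) L \<rho>min \<rho>max \<rho>t \<sigma>A \<delta> r (a T) (\<alpha> T) (\<theta> T) (\<eta> T) (\<gamma> T)"
    using a(3) t(3) g(3) ss eventually_gt_at_top[of 0] ev_small[OF zero_less_one, of 1]
      ev_small[OF b1, of 1] ev_small[OF rho(1), of "8 * (a2 * t2) * \<rho>t\<^sup>2"]
      ev_small[OF zero_less_one, of "a2 * t2 * \<rho>min"] ev_small[OF zero_less_one, of "6 * L * a2"]
      ev_small[OF zero_less_one, of g2] ev_small[OF b2, of "64 * (L\<^sup>2 + 1) * M3 * real CARD('n)"]
  proof eventually_elim
    case (elim T)
    have T: "0 < real T" using elim by simp
    have e: "0 < \<epsilon> T" using T by (simp add: \<epsilon>_def)
    note th = powr_thirds[OF T, folded \<epsilon>_def]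
    have "t1 \<le> \<theta> T * \<epsilon> T" "\<theta> T * \<epsilon> T \<le> t2"
      using elim(2) e unfolding th by (simp_all add: field_simps)
    then show ?case
      using elim e th t rho unfolding \<epsilon>_def[symmetric] by simp
  qed
  then obtain T0 where T0: "\<And>T. T \<ge> T0 \<Longrightarrow> 0 < T \<and> 0 < \<epsilon> T \<and> \<epsilon> T \<le> 1
      \<and> a1 * (\<epsilon> T)\<^sup>2 \<le> \<alpha> T \<and> \<alpha> T \<le> a2 * (\<epsilon> T)\<^sup>2 \<and> t1 \<le> \<theta> T * \<epsilon> T \<and> \<theta> T * \<epsilon> T \<le> t2 \<and> \<gamma> T \<le> g2 * \<epsilon> T
      \<and> real T * (\<epsilon> T) ^ 3 = 1
      \<and> \<epsilon> T \<le> 8 * \<rho>t * t1 \<and> 8 * (a2 * t2) * \<rho>t\<^sup>2 * \<epsilon> T \<le> \<rho>min \<and> a2 * t2 * \<rho>min * \<epsilon> T \<le> 1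
      \<and> 6 * L * a2 * \<epsilon> T \<le> 1 \<and> g2 * \<epsilon> T \<le> 1 \<and> 64 * (L\<^sup>2 + 1) * M3 * real CARD('n) * \<epsilon> T \<le> \<rho>min * t1\<^sup>2
      \<and> step_sizes CARD('n) L \<rho>min \<rho>max \<rho>t \<sigma>A \<delta> r (a T) (\<alpha> T) (\<theta> T) (\<eta> T) (\<gamma> T)"
    unfolding eventually_sequentially by blast
  show ?thesis
  proof (intro exI[of _ C] exI[of _ T0] allI impI)
    fix T \<sigma>\<xi> and Mq :: "'q measure" and Q :: "(real ^ 'd) ^ 'n \<Rightarrow> 'q \<Rightarrow> (real ^ 'd) ^ 'n" and M :: "'w measure"
      and xi xa xq idx
    assume T: "T \<ge> T0" and Q: "noisy_compressor \<delta> r \<sigma>\<xi> Mq Q" and fresh: "fresh_samples M P Pa Mq xi xa xq"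
      and idx: "uniform_index M P Pa Mq xi xa xq T idx"
    note facts = T0[OF T]
    let ?c = "\<eta> T / (\<alpha> T * \<theta> T)"
    have tuned: "sampled_problem E g F L fstar \<rho>min \<rho>max \<rho>t (\<alpha> T) (\<theta> T) (\<eta> T) (r * \<gamma> T * \<delta>) ?c K M2 M3
        P Pa act R fs \<sigma> \<delta> r (\<gamma> T)" and c: "?c \<le> cM"
      using tuned_parameters[OF cM_def K_def M2_def M3_def, of \<sigma>A "a T" "\<alpha> T" "\<theta> T" "\<eta> T" "\<gamma> T" a2 t2 "\<epsilon> T"]
        facts a t g by blast+
    interpret S: sampled_problem E g F L fstar \<rho>min \<rho>max \<rho>t "\<alpha> T" "\<theta> T" "\<eta> T" "r * \<gamma> T * \<delta>" ?c K M2 M3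
        P Pa act R fs \<sigma> \<delta> r "\<gamma> T"
      by (rule tuned)
    interpret D: ticopd_process E g F L fstar \<rho>min \<rho>max \<rho>t "\<alpha> T" "\<theta> T" "\<eta> T" "r * \<gamma> T * \<delta>" ?c K M2 M3
        P Pa act R fs \<sigma> \<delta> r "\<gamma> T" Mq Q \<sigma>\<xi> M xi xa xq X0 Xh0 dual0
      using Q fresh by unfold_locales
    have b: "S.lyapunov (X0, lt0, Xh0) / (\<alpha> T * real T) + S.noise_level \<sigma>\<xi> / \<alpha> T \<le> C * (1 + \<sigma>\<xi>\<^sup>2) * \<epsilon> T"
      using facts c
      by (intro S.bias_bound[OF a(1,2) t(1) g(2) _ _ _ _ _ _ _ _ W_def V_def C_def]) auto
    show "let X = (\<lambda>t w. fst (ticopd fs E act Q (\<alpha> T) (\<theta> T) (\<eta> T) (\<gamma> T) X0 dual0 Xh0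
            (\<lambda>t i. xi t i w) (\<lambda>t. xa t w) (\<lambda>t. xq t w) t));
           G = (\<lambda>w. (norm (grad F (average (X (idx w) w))))\<^sup>2);
           H = (\<lambda>w. sqnorm centering (X (idx w) w));
           b = C * (1 + \<sigma>\<xi>\<^sup>2) * (1 / real T powr (1 / 3))
       in integrable M G \<and> integrable M H \<and> (LINT w|M. G w) \<le> 8 * b \<and> (LINT w|M. H w) \<le> b"
    proof -
      have T: "0 < T" using facts by blast
      then have "1 / real T powr (1 / 3) = \<epsilon> T" by (simp add: \<epsilon>_def powr_thirds)
      with b D.random_iterate_bound[OF idx T] show ?thesis
        unfolding Let_def D.ticopd_run lt0_def by auto
    qed
  qed
qed

end

theorem mainTheorem3:
  fixes E :: "('n::finite \<times> 'n) set"
    and Pa :: "'c measure" and act :: "'c \<Rightarrow> ('n \<times> 'n) set"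
    and R :: "real ^ ('n \<times> 'n) ^ ('n \<times> 'n)"
    and P :: "'n \<Rightarrow> 'b measure"
    and fs :: "'n \<Rightarrow> real ^ 'd::finite \<Rightarrow> 'b \<Rightarrow> real"
    and X0 Xh0 :: "(real ^ 'd) ^ 'n" and dual0 :: "(real ^ 'd) ^ ('n \<times> 'n)"
    and \<delta> r L fstar \<rho>min \<rho>max \<rho>tmin \<rho>tmax \<sigma>A :: real and \<sigma> :: "'n \<Rightarrow> real"
  assumes graph: "connected_graph E"
    and edge_law: "prob_space Pa"
    and active: "(\<lambda>s. selector (act s)) \<in> borel_measurable Pa" "\<And>s. s \<in> space Pa \<Longrightarrow> act s \<subseteq> E"
    and R_eq: "R = (LINT s|Pa. selector (act s))"
    and R_pos: "\<exists>c0>0. \<forall>v. v \<noteq> 0 \<and> (\<forall>e. e \<notin> E \<longrightarrow> v $ e = 0) \<longrightarrow> c0 * (v \<bullet> v) < v \<bullet> (R *v v)"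
    and sample_law: "\<And>i. prob_space (P i)"
    and f_int: "\<And>i x. integrable (P i) (fs i x)"
    and fs_diff: "\<And>i s x. s \<in> space (P i) \<Longrightarrow> (\<lambda>y. fs i y s) differentiable (at x)"
    and fs_meas: "\<And>i. (\<lambda>(x, s). grad (\<lambda>y. fs i y s) x) \<in> borel_measurable (borel \<Otimes>\<^sub>M P i)"
    and f_diff: "\<And>i x. local_obj P fs i differentiable (at x)"
    and f_C1: "\<And>i. continuous_on UNIV (grad (local_obj P fs i))"
    and unbiased: "\<And>i x. has_bochner_integral (P i) (\<lambda>s. grad (\<lambda>y. fs i y s) x) (grad (local_obj P fs i) x)"
    and compr: "0 < \<delta>" "\<delta> \<le> 1" "0 < r"
    and smooth: "\<And>i x y. norm (grad (local_obj P fs i) x - grad (local_obj P fs i) y) \<le> L * norm (x - y)"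
    and bounded_below: "\<And>i x. fstar \<le> local_obj P fs i x"
    and var_nonneg: "\<And>i. 0 \<le> \<sigma> i"
    and var_int: "\<And>i y. integrable (P i)
          (\<lambda>s. (norm (grad (\<lambda>z. fs i z s) y - grad (local_obj P fs i) y))\<^sup>2)"
    and var: "\<And>i y. (LINT s|P i.
          (norm (grad (\<lambda>z. fs i z s) y - grad (local_obj P fs i) y))\<^sup>2) \<le> (\<sigma> i)\<^sup>2"
    and rho: "0 < \<rho>min" "\<rho>min \<le> \<rho>max" "0 < \<rho>tmin" "\<rho>tmin \<le> \<rho>tmax"
    and spec_R: "\<And>X :: (real ^ 'd) ^ 'n. \<rho>min * sqnorm centering X \<le> sqnorm (laplacian E R) X"
                "\<And>X :: (real ^ 'd) ^ 'n. sqnorm (laplacian E R) X \<le> \<rho>max * sqnorm centering X"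
    and spec: "\<And>X :: (real ^ 'd) ^ 'n. \<rho>tmin * sqnorm centering X \<le> sqnorm (laplacian E (mat 1)) X"
              "\<And>X :: (real ^ 'd) ^ 'n. sqnorm (laplacian E (mat 1)) X \<le> \<rho>tmax * sqnorm centering X"
    and sigmaA: "0 \<le> \<sigma>A"
    and graph_var: "\<And>X :: (real ^ 'd) ^ 'n.
          (LINT s|Pa. (norm (kron_id (laplacian E (selector (act s))) X - kron_id (laplacian E R) X))\<^sup>2)
            \<le> \<sigma>A\<^sup>2 * sqnorm R (kron_id (incidence E) X)"
  shows "(\<exists>a \<alpha> \<theta> \<eta> \<gamma>. rate_choice CARD('n) L \<rho>min \<rho>max \<rho>tmax \<sigma>A \<delta> r a \<alpha> \<theta> \<eta> \<gamma>) \<and>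
    (\<forall>a \<alpha> \<theta> \<eta> \<gamma>. rate_choice CARD('n) L \<rho>min \<rho>max \<rho>tmax \<sigma>A \<delta> r a \<alpha> \<theta> \<eta> \<gamma> \<longrightarrow>
      (\<exists>(C1::real) (C2::real \<Rightarrow> real) T0. \<forall>T\<ge>T0. \<forall>\<sigma>\<xi>>0.
        \<forall>(Mq::'q measure) (Q::(real ^ 'd) ^ 'n \<Rightarrow> 'q \<Rightarrow> (real ^ 'd) ^ 'n)
         (M::'w measure) xi xa xq idx.
          noisy_compressor \<delta> r \<sigma>\<xi> Mq Q \<longrightarrow>
          fresh_samples M P Pa Mq xi xa xq \<longrightarrow>
          uniform_index M P Pa Mq xi xa xq T idx \<longrightarrow>
          (let X = (\<lambda>t w. fst (ticopd fs E act Q (\<alpha> T) (\<theta> T) (\<eta> T) (\<gamma> T) X0 dual0 Xh0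
                      (\<lambda>t i. xi t i w) (\<lambda>t. xa t w) (\<lambda>t. xq t w) t));
               G = (\<lambda>w. (norm (grad (global_obj P fs) (average (X (idx w) w))))\<^sup>2);
               H = (\<lambda>w. sqnorm centering (X (idx w) w))
           in integrable M G \<and> integrable M H \<and>
              (LINT w|M. G w) \<le> C1 * ((1 + \<sigma>\<xi>\<^sup>2) / real T powr (1 / 3)) \<and>
              (LINT w|M. H w) \<le> C2 \<sigma>\<xi> * (1 / real T powr (1 / 3)))))"
proof (rule conjI)
  show "\<exists>a \<alpha> \<theta> \<eta> \<gamma>. rate_choice CARD('n) L \<rho>min \<rho>max \<rho>tmax \<sigma>A \<delta> r a \<alpha> \<theta> \<eta> \<gamma>"
    using rho compr by (intro rate_choice_exists) auto
  have "consensus_problem E (\<lambda>i. grad (local_obj P fs i)) (global_obj P fs) L fstar \<rho>min \<rho>max \<rho>tmax"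
  proof
    show "GDERIV (global_obj P fs) x :> (1 / real CARD('n)) *\<^sub>R (\<Sum>i\<in>UNIV. grad (local_obj P fs i) x)" for x
      by (rule grad_global_obj[OF f_diff])
    show "fstar \<le> global_obj P fs x" for x
    proof -
      have "real CARD('n) * fstar \<le> (\<Sum>i\<in>UNIV. local_obj P fs i x)"
        using sum_mono[of UNIV "\<lambda>_. fstar" "\<lambda>i. local_obj P fs i x"] bounded_below by simp
      then show ?thesis by (simp add: global_obj_def field_simps)
    qed
    show "0 < \<rho>tmax" using rho by simp
  qed (fact smooth rho spec)+
  moreover have "stochastic_problem_axioms E (\<lambda>i. grad (local_obj P fs i)) \<rho>min \<rho>max P Pa act R fs \<sigma> \<delta> r"
    by (rule stochastic_problem_axioms.intro)
      (fact sample_law edge_law active R_eq fs_meas unbiased var_int var spec_R compr)+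
  ultimately interpret stochastic_problem E "\<lambda>i. grad (local_obj P fs i)" "global_obj P fs" L fstar
      \<rho>min \<rho>max \<rho>tmax P Pa act R fs \<sigma> \<delta> r
    by (rule stochastic_problem.intro)
  show "\<forall>a \<alpha> \<theta> \<eta> \<gamma>. rate_choice CARD('n) L \<rho>min \<rho>max \<rho>tmax \<sigma>A \<delta> r a \<alpha> \<theta> \<eta> \<gamma> \<longrightarrow>
      (\<exists>(C1::real) (C2::real \<Rightarrow> real) T0. \<forall>T\<ge>T0. \<forall>\<sigma>\<xi>>0.
        \<forall>(Mq::'q measure) (Q::(real ^ 'd) ^ 'n \<Rightarrow> 'q \<Rightarrow> (real ^ 'd) ^ 'n)
         (M::'w measure) xi xa xq idx.
          noisy_compressor \<delta> r \<sigma>\<xi> Mq Q \<longrightarrow>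
          fresh_samples M P Pa Mq xi xa xq \<longrightarrow>
          uniform_index M P Pa Mq xi xa xq T idx \<longrightarrow>
          (let X = (\<lambda>t w. fst (ticopd fs E act Q (\<alpha> T) (\<theta> T) (\<eta> T) (\<gamma> T) X0 dual0 Xh0
                      (\<lambda>t i. xi t i w) (\<lambda>t. xa t w) (\<lambda>t. xq t w) t));
               G = (\<lambda>w. (norm (grad (global_obj P fs) (average (X (idx w) w))))\<^sup>2);
               H = (\<lambda>w. sqnorm centering (X (idx w) w))
           in integrable M G \<and> integrable M H \<and>
              (LINT w|M. G w) \<le> C1 * ((1 + \<sigma>\<xi>\<^sup>2) / real T powr (1 / 3)) \<and>
              (LINT w|M. H w) \<le> C2 \<sigma>\<xi> * (1 / real T powr (1 / 3))))"
  proof (intro allI impI)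
    fix a \<alpha> \<theta> \<eta> \<gamma>
    assume "rate_choice CARD('n) L \<rho>min \<rho>max \<rho>tmax \<sigma>A \<delta> r a \<alpha> \<theta> \<eta> \<gamma>"
    from rate[OF this, where ?X0.0 = X0 and ?Xh0.0 = Xh0 and ?dual0.0 = dual0 and ?'q = 'q and ?'w = 'w]
    obtain C T0 where *: "\<forall>T\<ge>T0. \<forall>\<sigma>\<xi>.
      \<forall>(Mq::'q measure) (Q::(real ^ 'd) ^ 'n \<Rightarrow> 'q \<Rightarrow> (real ^ 'd) ^ 'n) (M::'w measure) xi xa xq idx.
      noisy_compressor \<delta> r \<sigma>\<xi> Mq Q \<longrightarrow> fresh_samples M P Pa Mq xi xa xq \<longrightarrow>
      uniform_index M P Pa Mq xi xa xq T idx \<longrightarrow>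
      (let X = (\<lambda>t w. fst (ticopd fs E act Q (\<alpha> T) (\<theta> T) (\<eta> T) (\<gamma> T) X0 dual0 Xh0
            (\<lambda>t i. xi t i w) (\<lambda>t. xa t w) (\<lambda>t. xq t w) t));
           G = (\<lambda>w. (norm (grad (global_obj P fs) (average (X (idx w) w))))\<^sup>2);
           H = (\<lambda>w. sqnorm centering (X (idx w) w));
           b = C * (1 + \<sigma>\<xi>\<^sup>2) * (1 / real T powr (1 / 3))
       in integrable M G \<and> integrable M H \<and> (LINT w|M. G w) \<le> 8 * b \<and> (LINT w|M. H w) \<le> b)"
      by blast
    show "\<exists>(C1::real) (C2::real \<Rightarrow> real) T0. \<forall>T\<ge>T0. \<forall>\<sigma>\<xi>>0.
        \<forall>(Mq::'q measure) (Q::(real ^ 'd) ^ 'n \<Rightarrow> 'q \<Rightarrow> (real ^ 'd) ^ 'n)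
         (M::'w measure) xi xa xq idx.
          noisy_compressor \<delta> r \<sigma>\<xi> Mq Q \<longrightarrow>
          fresh_samples M P Pa Mq xi xa xq \<longrightarrow>
          uniform_index M P Pa Mq xi xa xq T idx \<longrightarrow>
          (let X = (\<lambda>t w. fst (ticopd fs E act Q (\<alpha> T) (\<theta> T) (\<eta> T) (\<gamma> T) X0 dual0 Xh0
                      (\<lambda>t i. xi t i w) (\<lambda>t. xa t w) (\<lambda>t. xq t w) t));
               G = (\<lambda>w. (norm (grad (global_obj P fs) (average (X (idx w) w))))\<^sup>2);
               H = (\<lambda>w. sqnorm centering (X (idx w) w))
           in integrable M G \<and> integrable M H \<and>
              (LINT w|M. G w) \<le> C1 * ((1 + \<sigma>\<xi>\<^sup>2) / real T powr (1 / 3)) \<and>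
              (LINT w|M. H w) \<le> C2 \<sigma>\<xi> * (1 / real T powr (1 / 3)))"
      by (rule exI[of _ "8 * C"], rule exI[of _ "\<lambda>s. C * (1 + s\<^sup>2)"], rule exI[of _ T0])
        (use * in \<open>simp add: Let_def mult.assoc\<close>)
  qed
qed

end
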